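(* Let $X=T[(\theta_n,\mathcal{F}_n)_{n=1}^\infty]$, $\alpha_n=\iota(\mathcal{F}_n)>1$ for all $n$, $\alpha=\sup_n\alpha_n$, and assume $\alpha\neq\alpha_n$ for all $n$ and $\alpha=\omega^{\omega^\xi}$ with $0<\xi<\omega_1$. Suppose condition $(\dagger)$ holds: there exists $\varepsilon>0$ such that for every ordinal $\beta<\omega^\xi$ there is $m\in\mathbb{N}$ with $\gamma(\varepsilon,m)+2+\beta<\ell(\alpha_m)$. Then for every infinite $M\subseteq\mathbb{N}$, the closed linear span $[(e_n)_{n\in M}]$ of the subsequence $(e_n)_{n\in M}$ of the unit vector basis of $X$ contains an $\ell^1$-$\mathcal{S}_{\omega^\xi}$-spreading model.
   Context: Regular families, $\mathcal{F}$-admissibility, the index $\iota$, Schreier families $\mathcal{S}_\beta$ (defined for limit $\beta$ via a fixed sequence strictly increasing to $\beta$: $\mathcal{S}_\beta=\{F:F\in\mathcal{S}_{\beta_n}\text{ for some } n\le\min F\}$, with $\mathcal{S}_0$ the singletons and $\emptyset$, $\mathcal{S}_1=\{F:|F|\le\min F\}$, $\mathcal{S}_{\beta+1}=\mathcal{S}_1[\mathcal{S}_\beta]$ where $\mathcal{M}[\mathcal{N}]$ is the set of unions of $\mathcal{M}$-admissible sequences of members of $\mathcal{N}$). A sequence $E_1<\dots<E_k$ of finite sets ($\max E_i<\min E_{i+1}$) is $\mathcal{F}$-admissible if $\{\min E_i\}\in\mathcal{F}$. A regular family is hereditary, spreading and compact in $2^{\mathbb{N}}$; $\iota(\mathcal{F})$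 is its Cantor–Bendixson index (the $\beta$ with $\mathcal{F}^{(\beta)}=\{\emptyset\}$). $T[(\theta_n,\mathcal{F}_n)_{n=1}^\infty]$, for regular $\mathcal{F}_n$ and $(\theta_n)$ nonincreasing null in $(0,1)$, is the completion of $c_{00}$ under $\|x\|=\max\{\|x\|_{c_0},\sup_n\sup\theta_n\sum_{i=1}^k\|E_ix\|\}$, inner sup over $\mathcal{F}_n$-admissible $(E_i)$, $E x$ the restriction of $x$ to $E$; $(e_n)$ is the unit vector basis. For a nonzero ordinal with Cantor normal form $\omega^{\beta_1}m_1+\dots+\omega^{\beta_n}m_n$ ($\beta_1>\dots>\beta_n$), $\ell$ of it is $\beta_1$. For $m\in\mathbb{N}$, $\varepsilon>0$: $\gamma(\varepsilon,m)=\max\{\ell(\alpha_{n_s}\cdots\alpha_{n_1}): s\ge1,\ n_1,\dots,n_s\in\mathbb{N},\ \varepsilon\theta_{n_1}\cdots\theta_{n_s}>\theta_m\}$ (ordinal products; $\max\emptyset=0$). A normalized sequence $(x_n)$ is an $\ell^1$-$\mathcal{F}$-spreading model if for some $K$, $\|\sum_{n\in F}a_nx_n\|\ge K^{-1}\sum_{n\in F}|a_n|$ for all $F\in\mathcal{F}$ and all scalars. *)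

theory Defs
  imports "HOL-Analysis.Analysis"
begin

text \<open>A Brouwer tree denotes a countable ordinal: BZ = 0, BS b = b+1, BL f = sup of f n.
  Every countable ordinal is denoted by some tree; ordinal comparison is the inductive
  relation ole below (sound and complete for this semantics).\<close>

datatype bord = BZ | BS bord | BL "nat \<Rightarrow> bord"

inductive ole :: "bord \<Rightarrow> bord \<Rightarrow> bool" where
  ole_zero: "ole BZ y"
| ole_suc: "ole x y \<Longrightarrow> ole (BS x) (BS y)"
| ole_cocone: "ole x (f k) \<Longrightarrow> ole x (BL f)"
| ole_limiting: "(\<forall>k. ole (f k) y) \<Longrightarrow> ole (BL f) y"

definition olt :: "bord \<Rightarrow> bord \<Rightarrow> bool" where
  "olt x y \<longleftrightarrow> ole (BS x) y"

definition oeq :: "bord \<Rightarrow> bord \<Rightarrow> bool" where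
  "oeq x y \<longleftrightarrow> ole x y \<and> ole y x"

definition is_limit :: "bord \<Rightarrow> bool" where
  "is_limit b \<longleftrightarrow> \<not> oeq b BZ \<and> \<not> (\<exists>c. oeq b (BS c))"

primrec ofnat :: "nat \<Rightarrow> bord" where
  "ofnat 0 = BZ"
| "ofnat (Suc n) = BS (ofnat n)"

definition omega :: bord where "omega = BL ofnat"

primrec oadd :: "bord \<Rightarrow> bord \<Rightarrow> bord" where
  "oadd a BZ = a"
| "oadd a (BS b) = BS (oadd a b)"
| "oadd a (BL f) = BL (\<lambda>n. oadd a (f n))"

primrec omul :: "bord \<Rightarrow> bord \<Rightarrow> bord" where
  "omul a BZ = BZ"
| "omul a (BS b) = oadd (omul a b) a"
| "omul a (BL f) = BL (\<lambda>n. omul a (f n))"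

primrec opow :: "bord \<Rightarrow> bord \<Rightarrow> bord" where
  "opow a BZ = BS BZ"
| "opow a (BS b) = omul (opow a b) a"
| "opow a (BL f) = BL (\<lambda>n. opow a (f n))"

text \<open>Leading exponent of the Cantor normal form of a nonzero ordinal d:
  the unique (up to oeq) b with omega^b \<le> d < omega^(b+1).\<close>
definition lead :: "bord \<Rightarrow> bord" where
  "lead d = (SOME b. ole (opow omega b) d \<and> olt d (opow omega (BS b)))"

definition omax :: "bord set \<Rightarrow> bord" where
  "omax S = (if S = {} then BZ else (SOME x. x \<in> S \<and> (\<forall>y\<in>S. ole y x)))"

primrec oprodl :: "(nat \<Rightarrow> bord) \<Rightarrow> nat list \<Rightarrow> bord" where
  "oprodl alpha [] = BS BZ"
| "oprodl alpha (n # ns) = omul (oprodl alpha ns) (alpha n)"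

definition gamma :: "(nat \<Rightarrow> real) \<Rightarrow> (nat \<Rightarrow> bord) \<Rightarrow> real \<Rightarrow> nat \<Rightarrow> bord" where
  "gamma \<theta> alpha \<epsilon> m = omax {lead (oprodl alpha ns) | ns.
       ns \<noteq> [] \<and> \<epsilon> * prod_list (map \<theta> ns) > \<theta> m}"

definition hereditary :: "nat set set \<Rightarrow> bool" where
  "hereditary F \<longleftrightarrow> (\<forall>A\<in>F. \<forall>B. B \<subseteq> A \<longrightarrow> B \<in> F)"

definition spreading :: "nat set set \<Rightarrow> bool" where
  "spreading F \<longleftrightarrow> (\<forall>A\<in>F. \<forall>f. strict_mono_on A f \<and> (\<forall>a\<in>A. a \<le> f a) \<longrightarrow> f ` A \<in> F)"

definition cantor :: "(nat \<Rightarrow> bool) topology" where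
  "cantor = product_topology (\<lambda>_. discrete_topology UNIV) UNIV"

definition ind :: "nat set \<Rightarrow> (nat \<Rightarrow> bool)" where
  "ind A = (\<lambda>i. i \<in> A)"

definition regular_family :: "nat set set \<Rightarrow> bool" where
  "regular_family F \<longleftrightarrow> (\<forall>A\<in>F. finite A) \<and> hereditary F \<and> spreading F
      \<and> compactin cantor (ind ` F)"

definition cb_deriv :: "nat set set \<Rightarrow> nat set set" where
  "cb_deriv F = {A. ind A \<in> cantor derived_set_of (ind ` F)}"

primrec cb_iter :: "nat set set \<Rightarrow> bord \<Rightarrow> nat set set" where
  "cb_iter F BZ = F"
| "cb_iter F (BS b) = cb_deriv (cb_iter F b)"
| "cb_iter F (BL f) = (\<Inter>n. cb_iter F (f n))"

definition cb_index :: "nat set set \<Rightarrow> bord \<Rightarrow> bool" where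
  "cb_index F b \<longleftrightarrow> cb_iter F b = {{}}"

definition admissible :: "nat set set \<Rightarrow> nat set list \<Rightarrow> bool" where
  "admissible F Es \<longleftrightarrow> (\<forall>E\<in>set Es. finite E \<and> E \<noteq> {})
      \<and> sorted_wrt (\<lambda>A B. \<forall>a\<in>A. \<forall>b\<in>B. a < b) Es
      \<and> set (map Min Es) \<in> F"

text \<open>N is modelled by nat with k in nat standing for k+1; hence S_1 = {F. |F| \<le> min F}
  becomes card F \<le> Min F + 1, and the limit clause n \<le> min F (n \<ge> 1) becomes
  n \<le> Min F with 0-indexed sequences.\<close>
definition schreier1 :: "nat set set" where
  "schreier1 = {F. finite F \<and> card F \<le> Min F + 1}"

text \<open>A choice, for each countable limit ordinal, of a sequence strictly increasing to it
  (depending only on the ordinal, not on its tree representation).\<close>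
definition valid_seq :: "(bord \<Rightarrow> nat \<Rightarrow> bord) \<Rightarrow> bool" where
  "valid_seq sq \<longleftrightarrow> (\<forall>b b'. oeq b b' \<longrightarrow> sq b = sq b')
     \<and> (\<forall>b. is_limit b \<longrightarrow> (\<forall>n. olt (sq b n) (sq b (Suc n))) \<and> oeq (BL (sq b)) b)"

inductive schreier :: "(bord \<Rightarrow> nat \<Rightarrow> bord) \<Rightarrow> bord \<Rightarrow> nat set \<Rightarrow> bool" for sq where
  sch_zero: "oeq b BZ \<Longrightarrow> finite F \<Longrightarrow> card F \<le> 1 \<Longrightarrow> schreier sq b F"
| sch_suc: "oeq b (BS c) \<Longrightarrow> admissible schreier1 Es \<Longrightarrow> (\<forall>E\<in>set Es. schreier sq c E)
              \<Longrightarrow> schreier sq b (\<Union>(set Es))"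
| sch_lim: "is_limit b \<Longrightarrow> (\<forall>x\<in>F. n \<le> x) \<Longrightarrow> schreier sq (sq b n) F \<Longrightarrow> schreier sq b F"

definition c00 :: "(nat \<Rightarrow> real) \<Rightarrow> bool" where
  "c00 x \<longleftrightarrow> finite {i. x i \<noteq> 0}"

definition restr :: "nat set \<Rightarrow> (nat \<Rightarrow> real) \<Rightarrow> (nat \<Rightarrow> real)" where
  "restr E x = (\<lambda>i. if i \<in> E then x i else 0)"

definition norm_set :: "(nat \<Rightarrow> real) \<Rightarrow> (nat \<Rightarrow> nat set set) \<Rightarrow> ((nat \<Rightarrow> real) \<Rightarrow> real)
     \<Rightarrow> (nat \<Rightarrow> real) \<Rightarrow> real set" where
  "norm_set \<theta> Fs N x = range (\<lambda>i. \<bar>x i\<bar>)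
     \<union> {\<theta> n * (\<Sum>E\<leftarrow>Es. N (restr E x)) | n Es. admissible (Fs n) Es}"

definition is_T_norm :: "(nat \<Rightarrow> real) \<Rightarrow> (nat \<Rightarrow> nat set set) \<Rightarrow> ((nat \<Rightarrow> real) \<Rightarrow> real) \<Rightarrow> bool" where
  "is_T_norm \<theta> Fs N \<longleftrightarrow> (\<forall>x. \<not> c00 x \<longrightarrow> N x = 0)
     \<and> (\<forall>x. c00 x \<longrightarrow> (\<forall>v\<in>norm_set \<theta> Fs N x. v \<le> N x)
                     \<and> (\<forall>u. (\<forall>v\<in>norm_set \<theta> Fs N x. v \<le> u) \<longrightarrow> N x \<le> u))"

definition tnorm :: "(nat \<Rightarrow> real) \<Rightarrow> (nat \<Rightarrow> nat set set) \<Rightarrow> (nat \<Rightarrow> real) \<Rightarrow> real" where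
  "tnorm \<theta> Fs = (THE N. is_T_norm \<theta> Fs N)"

definition trunc :: "nat \<Rightarrow> (nat \<Rightarrow> real) \<Rightarrow> (nat \<Rightarrow> real)" where
  "trunc n x = restr {..<n} x"

text \<open>The completion X, realised (via the unit vector basis) as the coordinate sequences x
  whose truncations form a Cauchy sequence in the norm; its norm is the limit.\<close>
definition inX :: "(nat \<Rightarrow> real) \<Rightarrow> (nat \<Rightarrow> nat set set) \<Rightarrow> (nat \<Rightarrow> real) \<Rightarrow> bool" where
  "inX \<theta> Fs x \<longleftrightarrow> (\<forall>e>0. \<exists>N. \<forall>m\<ge>N. \<forall>n\<ge>N.
      tnorm \<theta> Fs (\<lambda>i. trunc m x i - trunc n x i) < e)"

definition xnorm :: "(nat \<Rightarrow> real) \<Rightarrow> (nat \<Rightarrow> nat set set) \<Rightarrow> (nat \<Rightarrow> real) \<Rightarrow> real" where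
  "xnorm \<theta> Fs x = lim (\<lambda>n. tnorm \<theta> Fs (trunc n x))"

definition closed_span :: "(nat \<Rightarrow> real) \<Rightarrow> (nat \<Rightarrow> nat set set) \<Rightarrow> nat set \<Rightarrow> (nat \<Rightarrow> real) set" where
  "closed_span \<theta> Fs M = {x. inX \<theta> Fs x \<and> (\<forall>e>0. \<exists>y. c00 y \<and> {i. y i \<noteq> 0} \<subseteq> M
       \<and> xnorm \<theta> Fs (\<lambda>i. x i - y i) < e)}"

definition l1_spreading_model :: "(nat \<Rightarrow> real) \<Rightarrow> (nat \<Rightarrow> nat set set) \<Rightarrow> nat set set
     \<Rightarrow> (nat \<Rightarrow> nat \<Rightarrow> real) \<Rightarrow> bool" where
  "l1_spreading_model \<theta> Fs G xs \<longleftrightarrow> (\<forall>k. xnorm \<theta> Fs (xs k) = 1)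
     \<and> (\<exists>K>0. \<forall>F\<in>G. \<forall>a::nat \<Rightarrow> real.
          xnorm \<theta> Fs (\<lambda>i. \<Sum>n\<in>F. a n * xs n i) \<ge> (\<Sum>n\<in>F. \<bar>a n\<bar>) / K)"

end

theory Submission
  imports Defs
begin

text \<open>Fix \<open>\<epsilon>\<close> from the dagger condition and choose levels \<open>m 0, m 1, \<dots>\<close> inductively. A layered
  vector from level \<open>n\<close> on is an average \<open>\<Sum> a p (e p / \<theta> (m n) + u p)\<close>, where \<open>u p\<close> is layered from
  level \<open>n + 1\<close> on and supported between \<open>p\<close> and the next point of the average. The average has order
  \<open>\<omega>^\<delta>\<close> with \<open>\<delta>\<close> slightly larger than \<open>\<gamma>(\<epsilon>, m n)\<close>, so the part of a norming functional that still
  has weight above \<open>\<theta> (m n) / \<epsilon>\<close> meets only a small fraction of the points \<open>p\<close>. At any other \<open>p\<close>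
  the functional either treats \<open>p\<close> negligibly and gains no more than on \<open>u p\<close>, or its weight has dropped
  to \<open>\<theta> (m n) / \<epsilon> \<le> 1/2\<close> and it gains at most \<open>1/\<epsilon>\<close> on \<open>e p / \<theta> (m n)\<close> plus half of the bound
  on \<open>u p\<close>. Hence the norms stay below \<open>2/\<epsilon> + 2\<close> however many levels are stacked.

  Let \<open>x k\<close> carry the levels \<open>0, \<dots>, k\<close>. The slack \<open>\<beta>\<close> in the dagger condition absorbs the orders of all
  coarser levels and of a Schreier family, so if \<open>n \<le> min K\<close> and \<open>K\<close> lies in the \<open>n\<close>-th Schreier
  family below \<open>\<omega>^\<xi>\<close>, then the points of level \<open>n\<close> in all \<open>x k\<close> with \<open>k \<in> K\<close> together form a set in
  \<open>Fs (m n)\<close>. Each \<open>x k\<close> has mass \<open>1 / \<theta> (m n)\<close> there, which gives a lower estimate independent of \<open>n\<close>.\<close>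

section \<open>Ordinal arithmetic on Brouwer trees\<close>

text \<open>The obstacle is that \<open>\<omega>^\<xi>\<close> is a limit: one sequence has to serve
  infinitely many Schreier families, each through its own weight, and the triangle inequality for a
  sum of one average per weight gives a bound that grows with the number of weights. Hanging the
  later levels on single points of the earlier average couples them. A functional that is efficient
  at a point has already lost a factor 2 on what hangs there, and
  \<open>1/\<epsilon> + b/2 \<le> b\<close> once \<open>b \<ge> 2/\<epsilon>\<close>; this is the
  origin of \<open>2/\<epsilon>\<close>. The remaining 2 is the sum of the errors
  \<open>2^-n\<close> of the levels.

  Families are handled through the rank of the empty set under end extension. Upper bounds on ranks
  yield averages that a family hardly sees; lower bounds let points be chosen arbitrarily far out in
  \<open>M\<close> so that the resulting sets belong to \<open>Fs (m n)\<close>. Both demands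
  concern the same points, so an average is built as a play of a game whose state records the
  families from which the remaining points of each level must come.\<close>

lemma ole_refl [simp, intro!]: "ole x x"
proof (induction x)
  case (BL f)
  then show ?case by (intro ole_limiting allI ole_cocone) auto
qed (auto intro: ole.intros)

lemma ole_BL_D:
  assumes "ole (BL f) y"
  shows "ole (f k) y"
proof -
  have "ole x y \<Longrightarrow> x = BL f \<Longrightarrow> ole (f k) y" for x
    by (induction rule: ole.induct) (auto intro: ole_cocone)
  with assms show ?thesis by blast
qed

lemma ole_BL_iff: "ole (BL f) y \<longleftrightarrow> (\<forall>k. ole (f k) y)"
  using ole_BL_D ole_limiting by blast

lemma ole_BL_mono: "(\<And>k. ole (f k) (g k)) \<Longrightarrow> ole (BL f) (BL g)"
  by (intro ole_limiting allI ole_cocone)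

lemma ole_BS_BS [simp]: "ole (BS x) (BS y) \<longleftrightarrow> ole x y"
  by (auto intro: ole_suc elim: ole.cases)

lemma ole_BS_BZ [simp]: "\<not> ole (BS x) BZ"
  by (auto elim: ole.cases)

text \<open>The only rule that puts a successor below a limit tree is \<open>ole_cocone\<close>.
  This moves every strict inequality below a supremum to one of its terms.\<close>

lemma ole_BS_BL: "ole (BS x) (BL f) \<longleftrightarrow> (\<exists>k. ole (BS x) (f k))"
  by (auto intro: ole_cocone elim: ole.cases)

lemma ole_trans [trans]: "ole x y \<Longrightarrow> ole y z \<Longrightarrow> ole x z"
proof (induction arbitrary: z rule: ole.induct)
  case (ole_suc x y)
  from ole_suc.prems show ?case
  proof (induction z rule: bord.induct)
    case (BS z)
    then show ?case using ole_suc.IH by simp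
  qed (auto simp: ole_BS_BL)
qed (auto intro: ole.intros dest: ole_BL_D)

text \<open>Comparability lets two witnesses at different terms of a limit be replaced by the larger
  one. Different trees may denote the same ordinal, so \<open>ole\<close> is a total preorder rather
  than an order.\<close>

lemma ole_total: "ole x y \<or> ole (BS y) x"
proof (induction x arbitrary: y)
  case (BS x)
  show ?case
  proof (induction y)
    case (BL g)
    show ?case
    proof (cases "\<exists>k. ole (BS x) (g k)")
      case False
      with BL show ?thesis by (auto simp: ole_BL_iff)
    qed (auto intro: ole_cocone)
  qed (use BS in \<open>auto intro: ole.intros\<close>)
next
  case (BL f)
  show ?case
  proof (cases "\<forall>k. ole (f k) y")
    case False
    then show ?thesis using BL by (auto simp: ole_BS_BL)
  qed (auto intro: ole_limiting)
qed (auto intro: ole_zero)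

lemma ole_BS_self [simp]: "ole x (BS x)"
proof (induction x)
  case (BL f)
  show ?case
    unfolding ole_BL_iff
    by (intro allI ole_trans[OF BL[OF rangeI]]) (auto intro: ole_cocone)
qed (auto intro: ole_zero)

lemma not_ole_BS_self [simp]: "\<not> ole (BS x) x"
proof (induction x)
  case (BL f)
  show ?case
  proof
    assume "ole (BS (BL f)) (BL f)"
    then obtain k where "ole (BS (BL f)) (f k)" by (auto simp: ole_BS_BL)
    moreover have "ole (BS (f k)) (BS (BL f))" by (auto intro: ole_cocone)
    ultimately show False using BL[OF rangeI] ole_trans by blast
  qed
qed auto

lemma olt_imp_ole: "olt x y \<Longrightarrow> ole x y"
  unfolding olt_def by (rule ole_trans[OF ole_BS_self])

lemma not_ole: "\<not> ole x y \<longleftrightarrow> olt y x"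
proof
  assume "\<not> ole x y"
  then show "olt y x" using ole_total[of x y] by (simp add: olt_def)
next
  assume "olt y x"
  then show "\<not> ole x y"
    unfolding olt_def using ole_trans[of "BS y" x y] not_ole_BS_self by auto
qed

lemma olt_irrefl [simp]: "\<not> olt x x"
  by (simp add: olt_def)

lemma ole_olt_trans [trans]: "ole x y \<Longrightarrow> olt y z \<Longrightarrow> olt x z"
  unfolding olt_def by (rule ole_trans[of _ "BS y"]) simp_all

lemma olt_ole_trans [trans]: "olt x y \<Longrightarrow> ole y z \<Longrightarrow> olt x z"
  unfolding olt_def by (rule ole_trans)

lemma olt_trans [trans]: "olt x y \<Longrightarrow> olt y z \<Longrightarrow> olt x z"
  by (rule ole_olt_trans[OF olt_imp_ole])

lemma olt_BS_iff [simp]: "olt x (BS y) \<longleftrightarrow> ole x y"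
  by (simp add: olt_def)

lemma ole_BZ_iff: "ole x BZ \<longleftrightarrow> \<not> olt BZ x"
  by (simp flip: not_ole)

lemma finite_omax:
  assumes "finite S" "S \<noteq> {}"
  shows "\<exists>x\<in>S. \<forall>y\<in>S. ole y x"
  using assms
proof (induction rule: finite_ne_induct)
  case (insert y S)
  then obtain x where x: "x \<in> S" "\<forall>y\<in>S. ole y x" by blast
  show ?case
  proof (cases "ole y x")
    case True
    show ?thesis by (rule bexI[of _ x]) (use x True in simp_all)
  next
    case False
    then have "ole x y" by (simp only: not_ole olt_imp_ole)
    have "ole z y" if "z \<in> S" for z
      by (rule ole_trans[OF _ \<open>ole x y\<close>]) (use x(2) that in blast)
    then show ?thesis by (intro bexI[of _ y] ballI) auto
  qed
qed simp

section \<open>Sums and products of ordinals\<close>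

lemma oadd_BZ [simp]: "oadd BZ x = x"
  by (induction x) auto

text \<open>Both sides recurse on the last argument, so the algebraic laws hold as equalities of
  trees and can be used for rewriting without passing through \<open>oeq\<close>.\<close>

lemma oadd_assoc: "oadd (oadd a b) c = oadd a (oadd b c)"
  by (induction c) auto

lemma omul_oadd: "omul a (oadd b c) = oadd (omul a b) (omul a c)"
  by (induction c) (auto simp: oadd_assoc)

lemma omul_assoc: "omul (omul a b) c = omul a (omul b c)"
  by (induction c) (auto simp: omul_oadd)

lemma omul_one [simp]: "omul (BS BZ) x = x"
  by (induction x) auto

lemma opow_oadd: "opow a (oadd b c) = omul (opow a b) (opow a c)"
  by (induction c) (auto simp: omul_assoc)

lemma ole_oadd_right: "ole b c \<Longrightarrow> ole (oadd a b) (oadd a c)"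
proof (induction rule: ole.induct)
  case (ole_zero y)
  show ?case
  proof (induction y)
    case (BS y)
    then show ?case by (auto intro: ole_trans[OF _ ole_BS_self])
  next
    case (BL f)
    then show ?case by (auto intro: ole_cocone)
  qed auto
qed (auto intro: ole.intros)

lemma ole_oadd_self: "ole a (oadd a b)"
  using ole_oadd_right[OF ole_zero, of a b] by simp

lemma ole_oadd_left: "ole a b \<Longrightarrow> ole (oadd a c) (oadd b c)"
  by (induction c) (auto intro: ole_BL_mono)

lemma ole_oadd: "ole a b \<Longrightarrow> ole c d \<Longrightarrow> ole (oadd a c) (oadd b d)"
  by (rule ole_trans[OF ole_oadd_left ole_oadd_right])

lemma ole_oadd_self2: "ole b (oadd a b)"
  using ole_oadd_left[OF ole_zero, of b a] by simp

lemma ole_omul_right: "ole b c \<Longrightarrow> ole (omul a b) (omul a c)"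
proof (induction rule: ole.induct)
  case (ole_suc x y)
  then show ?case by (auto intro: ole_oadd_left)
qed (auto intro: ole.intros)

lemma ole_omul_left: "ole a b \<Longrightarrow> ole (omul a c) (omul b c)"
  by (induction c) (auto intro: ole_BL_mono ole_oadd)

lemma ole_omul: "ole a b \<Longrightarrow> ole c d \<Longrightarrow> ole (omul a c) (omul b d)"
  by (rule ole_trans[OF ole_omul_left ole_omul_right])

lemma olt_omul_right:
  assumes "olt BZ a" "olt b c"
  shows "olt (omul a b) (omul a c)"
proof -
  have "ole (BS (omul a b)) (oadd (omul a b) a)"
    using ole_oadd_right[of "BS BZ" a "omul a b"] assms(1) by (simp add: olt_def)
  also have "ole \<dots> (omul a c)"
    using ole_omul_right[of "BS b" c a] assms(2) by (simp add: olt_def)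
  finally show ?thesis by (simp add: olt_def)
qed

section \<open>Powers of omega\<close>

lemma ofnat_le_omega: "ole (ofnat n) omega"
  unfolding omega_def by (rule ole_cocone) (rule ole_refl)

lemma one_lt_omega: "olt (BS BZ) omega"
  using ofnat_le_omega[of 2] by (simp add: olt_def numeral_2_eq_2)

lemma zero_lt_omega: "olt BZ omega"
  using ofnat_le_omega[of 1] by (simp add: olt_def)

lemma wpow_pos: "olt BZ (opow omega b)"
proof (induction b)
  case (BS b)
  have "ole (BS BZ) omega" using zero_lt_omega by (simp add: olt_def)
  with BS have "ole (omul (BS BZ) (BS BZ)) (omul (opow omega b) omega)"
    by (intro ole_omul) (auto simp: olt_def)
  then show ?case by (simp add: olt_def)
qed (auto simp: olt_def intro: ole_cocone)

lemma wpow_lt_Suc: "olt (opow omega b) (opow omega (BS b))"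
  using olt_omul_right[OF wpow_pos one_lt_omega, of b] by simp

lemma ole_wpow: "ole a b \<Longrightarrow> ole (opow omega a) (opow omega b)"
proof (induction rule: ole.induct)
  case (ole_zero y)
  then show ?case using wpow_pos by (simp add: olt_def)
next
  case (ole_suc x y)
  then show ?case by (auto intro: ole_omul_left)
qed (auto intro: ole.intros)

lemma olt_wpow: "olt a b \<Longrightarrow> olt (opow omega a) (opow omega b)"
  using olt_ole_trans[OF wpow_lt_Suc ole_wpow[of "BS a" b]] by (simp add: olt_def)

lemma olt_wpow_iff: "olt (opow omega a) (opow omega b) \<longleftrightarrow> olt a b"
  using ole_wpow[of b a] olt_wpow[of a b] by (auto simp flip: not_ole)

lemma olt_wpow_Suc_D:
  assumes "olt a (opow omega (BS b))"
  shows "\<exists>k. olt a (omul (opow omega b) (ofnat k))"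
  using assms by (simp add: omega_def olt_def ole_BS_BL)

text \<open>Powers of omega are additively indecomposable. At a successor exponent both summands lie
  below finite multiples of the previous power. At a limit the sequence of exponents need not
  increase, so the larger of the two exponents found is used.\<close>

lemma oadd_lt_wpow:
  assumes "olt a (opow omega x)" "olt b (opow omega x)"
  shows "olt (oadd a b) (opow omega x)"
  using assms
proof (induction x arbitrary: a b)
  case BZ
  then have "ole a BZ" "ole b BZ" by auto
  then have "ole (oadd a b) (oadd BZ BZ)" by (rule ole_oadd)
  then show ?case by simp
next
  case (BS x)
  from BS.prems obtain k l where
    "ole a (omul (opow omega x) (ofnat k))" "ole b (omul (opow omega x) (ofnat l))"
    using olt_wpow_Suc_D olt_imp_ole by metis
  then have "ole (oadd a b) (omul (opow omega x) (oadd (ofnat k) (ofnat l)))"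
    by (simp add: omul_oadd ole_oadd)
  also have "oadd (ofnat k) (ofnat l) = ofnat (k + l)"
    by (induction l) auto
  also have "olt (omul (opow omega x) (ofnat (k + l))) (opow omega (BS x))"
    unfolding opow.simps
    by (rule olt_omul_right[OF wpow_pos]) (metis ofnat.simps(2) ofnat_le_omega olt_def)
  finally show ?case .
next
  case (BL f)
  then obtain i j where ij: "olt a (opow omega (f i))" "olt b (opow omega (f j))"
    by (auto simp: olt_def ole_BS_BL)
  have "\<exists>k. olt a (opow omega (f k)) \<and> olt b (opow omega (f k))"
  proof (cases "ole (f i) (f j)")
    case True
    then show ?thesis using ij olt_ole_trans[OF ij(1) ole_wpow] by blast
  next
    case False
    then have "ole (f j) (f i)" by (simp only: not_ole olt_imp_ole)
    then show ?thesis using ij olt_ole_trans[OF ij(2) ole_wpow] by blast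
  qed
  then obtain k where "olt (oadd a b) (opow omega (f k))"
    using BL.IH[OF rangeI] by blast
  then show ?case by (auto simp: olt_def intro: ole_cocone)
qed

lemma one_lt_wpow:
  assumes "olt BZ x"
  shows "olt (BS BZ) (opow omega x)"
proof -
  have "ole (BS BZ) x" using assms by (simp add: olt_def)
  then have "ole (opow omega (BS BZ)) (opow omega x)" by (rule ole_wpow)
  then show ?thesis using olt_ole_trans[OF one_lt_omega] by simp
qed

lemma is_limit_wpow:
  assumes "olt BZ x"
  shows "is_limit (opow omega x)"
  unfolding is_limit_def
proof (intro conjI notI)
  assume "oeq (opow omega x) BZ"
  then show False using wpow_pos[of x] by (simp add: oeq_def ole_BZ_iff)
next
  assume "\<exists>c. oeq (opow omega x) (BS c)"
  then obtain c where c: "ole (opow omega x) (BS c)" "olt c (opow omega x)"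
    by (auto simp: oeq_def olt_def)
  then have "olt (oadd c (BS BZ)) (opow omega x)"
    by (intro oadd_lt_wpow one_lt_wpow assms)
  with c(1) show False by (simp flip: not_ole)
qed

section \<open>Leading exponents\<close>

lemma lead_exists_below:
  assumes "olt BZ d" "olt d (opow omega b)"
  shows "\<exists>c. ole (opow omega c) d \<and> olt d (opow omega (BS c))"
  using assms
proof (induction b)
  case BZ
  then show ?case by (simp add: olt_def ole_BZ_iff[unfolded olt_def])
next
  case (BS b)
  then show ?case by (cases "ole (opow omega b) d") (auto simp: not_ole)
next
  case (BL f)
  then show ?case by (auto simp: olt_def ole_BS_BL)
qed

lemma ole_wpow_self: "ole b (opow omega b)"
proof (induction b)
  case (BS b)
  then have "ole (BS b) (BS (opow omega b))" by simp
  also have "ole \<dots> (opow omega (BS b))" using wpow_lt_Suc[of b] by (simp add: olt_def)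
  finally show ?case .
qed (auto intro: ole_zero ole_BL_mono)

text \<open>The search for the leading exponent descends from an exponent that is already too large;
  \<open>BS d\<close> is one, since \<open>d\<close> lies below its own power of omega or equals it
  in rank.\<close>

lemma lead_spec:
  assumes "olt BZ d"
  shows "ole (opow omega (lead d)) d" "olt d (opow omega (BS (lead d)))"
proof -
  have "olt d (opow omega (BS d))"
    by (rule ole_olt_trans[OF ole_wpow_self wpow_lt_Suc])
  from someI_ex[OF lead_exists_below[OF assms this]]
  show "ole (opow omega (lead d)) d" "olt d (opow omega (BS (lead d)))"
    by (auto simp: lead_def)
qed

lemma omax_spec:
  assumes "finite S" "x \<in> S"
  shows "ole x (omax S)"
proof -
  have "S \<noteq> {}" using assms by blast
  with someI_ex[OF finite_omax[unfolded Bex_def, OF assms(1)]] assms show ?thesis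
    by (auto simp: omax_def)
qed

text \<open>The exponent is \<open>lead d\<close> plus one, which stays below the limit
  \<open>opow omega x\<close>. Since exponents of products add, this is the source of closure under
  products below \<open>opow omega (opow omega x)\<close>.\<close>

lemma bounded_below_wwpow:
  assumes x: "olt BZ x" and d: "olt d (opow omega (opow omega x))"
  shows "\<exists>e. olt e (opow omega x) \<and> ole d (opow omega e)"
proof (cases "olt BZ d")
  case True
  have *: "olt (lead d) (opow omega x)"
    using ole_olt_trans[OF lead_spec(1)[OF True] d] by (simp only: olt_wpow_iff)
  then have "olt (oadd (lead d) (BS BZ)) (opow omega x)"
    by (intro oadd_lt_wpow one_lt_wpow x)
  then show ?thesis using olt_imp_ole[OF lead_spec(2)[OF True]] by auto
next
  case False
  then have "ole d BZ" by (simp add: ole_BZ_iff)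
  then have "ole d (opow omega BZ)" by (rule ole_trans[OF _ ole_zero])
  then show ?thesis using wpow_pos[of x] by blast
qed

section \<open>Ranks of families under end extension\<close>

text \<open>A family is viewed as a tree of sets under end extension; this is the subtree above the
  node \<open>A\<close>, with \<open>A\<close> removed from its members.\<close>

definition tails :: "nat set \<Rightarrow> nat set set \<Rightarrow> nat set set" where
  "tails A F = {B. (\<forall>a\<in>A. \<forall>b\<in>B. a < b) \<and> A \<union> B \<in> F}"

text \<open>\<open>rk_lt b F\<close> and \<open>rk_ge b F\<close> say that the empty set is not, respectively is, in the \<open>b\<close>-th
  derivative of \<open>F\<close>. They are complementary for regular families; in general each is stated so as to be
  closed under the operation needed below, finite unions for \<open>rk_lt\<close> and intersections for \<open>rk_ge\<close>.\<close>
primrec rk_lt :: "bord \<Rightarrow> nat set set \<Rightarrow> bool" where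
  "rk_lt BZ F \<longleftrightarrow> F = {}"
| "rk_lt (BS b) F \<longleftrightarrow> (\<forall>n. rk_lt b (tails {n} F))"
| "rk_lt (BL f) F \<longleftrightarrow> (\<exists>k. rk_lt (f k) F)"

primrec rk_ge :: "bord \<Rightarrow> nat set set \<Rightarrow> bool" where
  "rk_ge BZ F \<longleftrightarrow> {} \<in> F"
| "rk_ge (BS b) F \<longleftrightarrow> (\<exists>n0. \<forall>n\<ge>n0. rk_ge b (tails {n} F))"
| "rk_ge (BL f) F \<longleftrightarrow> (\<forall>k. rk_ge (f k) F)"

lemma tails_empty_left [simp]: "tails {} F = F"
  by (auto simp: tails_def)

lemma tails_empty_right [simp]: "tails A {} = {}"
  by (auto simp: tails_def)

lemma tails_tails: "(\<And>a b. a \<in> A \<Longrightarrow> b \<in> B \<Longrightarrow> a < b) \<Longrightarrow> tails B (tails A F) = tails (A \<union> B) F"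
  by (auto simp: tails_def Un_assoc)

lemma tails_mono: "F \<subseteq> G \<Longrightarrow> tails A F \<subseteq> tails A G"
  by (auto simp: tails_def)

lemma rk_lt_empty [simp]: "rk_lt b {}"
  by (induction b) auto

lemma rk_lt_antimono: "rk_lt b G \<Longrightarrow> G' \<subseteq> G \<Longrightarrow> rk_lt b G'"
proof (induction b arbitrary: G G')
  case (BS b)
  then show ?case using tails_mono by (metis rk_lt.simps(2))
next
  case (BL f)
  then show ?case by simp (metis rangeI)
qed auto

lemma rk_lt_mono: "ole a b \<Longrightarrow> rk_lt a G \<Longrightarrow> rk_lt b G"
  by (induction arbitrary: G rule: ole.induct) auto

lemma tails_Un: "tails A (F \<union> G) = tails A F \<union> tails A G"
  by (auto simp: tails_def)

text \<open>At a limit the two families may be small at different terms; comparability of ordinals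
  moves both to the larger term.\<close>

lemma rk_lt_Un: "rk_lt b F \<Longrightarrow> rk_lt b G \<Longrightarrow> rk_lt b (F \<union> G)"
proof (induction b arbitrary: F G)
  case (BS b)
  then show ?case by (simp add: tails_Un)
next
  case (BL f)
  then obtain j k where jk: "rk_lt (f j) F" "rk_lt (f k) G" by auto
  show ?case
  proof (cases "ole (f j) (f k)")
    case True
    from BL.IH[OF rangeI rk_lt_mono[OF True jk(1)] jk(2)] show ?thesis by auto
  next
    case False
    then have "ole (f k) (f j)" by (simp only: not_ole olt_imp_ole)
    from BL.IH[OF rangeI jk(1) rk_lt_mono[OF this jk(2)]] show ?thesis by auto
  qed
qed auto

lemma rk_lt_UN: "finite I \<Longrightarrow> (\<And>i. i \<in> I \<Longrightarrow> rk_lt b (F i)) \<Longrightarrow> rk_lt b (\<Union>i\<in>I. F i)"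
  by (induction rule: finite_induct) (auto intro: rk_lt_Un)

lemma tails_split_least:
  fixes A :: "nat set"
  assumes "A \<noteq> {}"
  obtains a where "a \<in> A" "tails A F = tails (A - {a}) (tails {a} F)"
proof -
  define a where "a = (LEAST a. a \<in> A)"
  have a: "a \<in> A" "\<And>b. b \<in> A \<Longrightarrow> a \<le> b"
    using assms LeastI_ex[of "\<lambda>a. a \<in> A"] Least_le[of "\<lambda>a. a \<in> A"] by (auto simp: a_def)
  have "a < b" if "b \<in> A - {a}" for b
    using a(2)[of b] that by (simp add: order.not_eq_order_implies_strict)
  then have "tails (A - {a}) (tails {a} F) = tails ({a} \<union> (A - {a})) F"
    by (intro tails_tails) auto
  then show ?thesis using that a by (simp add: insert_absorb)
qed

lemma rk_lt_tails: "rk_lt b F \<Longrightarrow> rk_lt b (tails A F)"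
proof (induction b arbitrary: F A)
  case (BL f)
  then show ?case by simp (metis rangeI)
next
  case (BS b)
  show ?case
  proof (cases "A = {}")
    case False
    then obtain a where "tails A F = tails (A - {a}) (tails {a} F)"
      by (rule tails_split_least)
    with BS show ?thesis by simp
  qed (use BS in simp)
qed auto

text \<open>The least element of \<open>A\<close> already uses up the successor step, and removing
  the other elements cannot raise the rank again.\<close>

lemma rk_lt_BS_tails:
  assumes "rk_lt (BS b) F" "A \<noteq> {}"
  shows "rk_lt b (tails A F)"
proof -
  obtain a where "tails A F = tails (A - {a}) (tails {a} F)"
    using tails_split_least[OF assms(2)] by metis
  with assms(1) show ?thesis by (simp add: rk_lt_tails)
qed

section \<open>Ranks of concatenations and compositions\<close>

definition concat_fam :: "nat set set \<Rightarrow> nat set set \<Rightarrow> nat set set" where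
  "concat_fam G F = {B \<union> C | B C. B \<in> G \<and> C \<in> F \<and> (\<forall>b\<in>B. \<forall>c\<in>C. b < c)}"

text \<open>The least element \<open>n\<close> lies in the first or in the second part. In the
  latter case the first part is empty, because its elements would have to be below \<open>n\<close>
  and at least \<open>n\<close> at once.\<close>

lemma tails_concat_fam: "tails {n} (concat_fam G F) \<subseteq> concat_fam (tails {n} G) F \<union> tails {n} F"
proof
  fix X assume "X \<in> tails {n} (concat_fam G F)"
  then obtain B C where X: "\<And>x. x \<in> X \<Longrightarrow> n < x" "insert n X = B \<union> C" "B \<in> G" "C \<in> F"
    "\<And>b c. b \<in> B \<Longrightarrow> c \<in> C \<Longrightarrow> b < c"
    by (auto simp: tails_def concat_fam_def)
  show "X \<in> concat_fam (tails {n} G) F \<union> tails {n} F"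
  proof (cases "n \<in> B")
    case True
    have "n \<notin> C" using True X(5) by blast
    moreover have "n \<notin> X" using X(1) by blast
    ultimately have "X = insert n X - {n}" "(B \<union> C) - {n} = (B - {n}) \<union> C" by auto
    then have XBC: "X = (B - {n}) \<union> C" using X(2) by simp
    have "B - {n} \<in> tails {n} G"
      using True X(1,3) XBC by (auto simp: tails_def insert_absorb)
    then show ?thesis using XBC X(4,5) unfolding concat_fam_def by blast
  next
    case False
    then have n: "n \<in> C" using X(2) by blast
    have "B = {}"
    proof (rule ccontr)
      assume "B \<noteq> {}"
      then obtain b where "b \<in> B" by blast
      then have "b < n" "b = n \<or> n < b" using X n by blast+
      then show False by simp
    qed
    then show ?thesis using X by (auto simp: tails_def)
  qed
qed

text \<open>Rank is consumed from the right end of the ordinal and the part from \<open>G\<close>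
  comes first in the sets, so \<open>b\<close> stands on the right. The bound on \<open>F\<close>
  has successor form because removing a point may fall on \<open>F\<close> when the part from
  \<open>G\<close> is empty.\<close>

lemma rk_lt_concat_fam: "rk_lt (BS a) F \<Longrightarrow> rk_lt b G \<Longrightarrow> rk_lt (oadd a b) (concat_fam G F)"
proof (induction b arbitrary: G)
  case BZ
  then show ?case by (auto simp: concat_fam_def)
next
  case (BS b)
  have "rk_lt (oadd a b) (tails {n} (concat_fam G F))" for n
  proof (rule rk_lt_antimono[OF rk_lt_Un tails_concat_fam])
    show "rk_lt (oadd a b) (concat_fam (tails {n} G) F)" using BS by simp
    show "rk_lt (oadd a b) (tails {n} F)" using BS.prems(1) rk_lt_mono[OF ole_oadd_self] by simp
  qed
  then show ?case by simp
next
  case (BL f)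
  then show ?case by simp (metis rangeI)
qed

text \<open>This contains the family written \<open>F[G]\<close> in the paper. A piece may be empty or start after its tag \<open>t\<close>,
  which makes heredity and spreading of \<open>F\<close> unnecessary.\<close>
definition comp_fam :: "nat set set \<Rightarrow> nat set set \<Rightarrow> nat set set" where
  "comp_fam F G = {A. \<exists>T\<in>F. finite T \<and> (\<exists>V. (\<forall>t\<in>T. V t \<in> G \<and> V t \<subseteq> {t..}
      \<and> (\<forall>t'\<in>T. t < t' \<longrightarrow> V t \<subseteq> {..<t'})) \<and> A = (\<Union>t\<in>T. V t))}"

lemma comp_fam_empty [simp]: "comp_fam {} G = {}"
  by (auto simp: comp_fam_def)

lemma concat_fam_empty [simp]: "concat_fam G {} = {}"
  by (auto simp: concat_fam_def)

text \<open>A tag is a lower bound of its piece, so the tag of the piece containing \<open>n\<close>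
  and all earlier tags are at most \<open>n\<close>. Hence only finitely many sets \<open>T\<close>
  of opened tags occur, and a finite union does not raise the rank. Pieces with earlier tags are
  empty, as \<open>n\<close> is the least point.\<close>

lemma tails_comp:
  "tails {n} (comp_fam F G) \<subseteq> (\<Union>T\<in>{T. T \<subseteq> {..n}
      \<and> T \<noteq> {}}. concat_fam (tails {n} G) (comp_fam (tails T F) G))"
proof
  fix X assume "X \<in> tails {n} (comp_fam F G)"
  then obtain T V where X: "\<And>x. x \<in> X \<Longrightarrow> n < x" and T: "T \<in> F" "finite T"
    and V: "\<And>t. t \<in> T \<Longrightarrow> V t \<in> G" "\<And>t x. t \<in> T \<Longrightarrow> x \<in> V t \<Longrightarrow> t \<le> x"
      "\<And>t t' x. t \<in> T \<Longrightarrow> t' \<in> T \<Longrightarrow> t < t' \<Longrightarrow> x \<in> V t \<Longrightarrow> x < t'"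
    and eq: "insert n X = (\<Union>t\<in>T. V t)"
    by (force simp: tails_def comp_fam_def)
  from eq obtain t0 where t0: "t0 \<in> T" "n \<in> V t0" by blast
  define T1 where "T1 = {t\<in>T. t \<le> t0}"
  define T2 where "T2 = {t\<in>T. t0 < t}"
  define C where "C = (\<Union>t\<in>T2. V t)"
  have T12: "T1 \<union> T2 = T" by (auto simp: T1_def T2_def)
  have early: "V t = {}" if "t \<in> T" "t < t0" for t
  proof (rule ccontr)
    assume "V t \<noteq> {}"
    then obtain x where x: "x \<in> V t" by blast
    have "x < t0" using V(3)[OF that(1) t0(1) that(2) x] .
    moreover have "t0 \<le> n" using V(2) t0 by blast
    moreover have "x \<in> insert n X" using eq x that by blast
    then have "n \<le> x" using X[of x] by (cases "x = n") (auto intro: less_imp_le)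
    ultimately show False by simp
  qed
  have VC: "x < y" if "x \<in> V t0" "y \<in> C" for x y
  proof -
    obtain t where t: "t \<in> T2" "y \<in> V t" using \<open>y \<in> C\<close> by (auto simp: C_def)
    then have "x < t" "t \<le> y" using V t0 that by (auto simp: T2_def)
    then show ?thesis by simp
  qed
  have eq2: "insert n X = V t0 \<union> C"
  proof -
    have "(\<Union>t\<in>T. V t) = V t0 \<union> C"
    proof
      show "(\<Union>t\<in>T. V t) \<subseteq> V t0 \<union> C"
        using early by (auto simp: C_def T2_def) (metis linorder_neqE_nat empty_iff)
      show "V t0 \<union> C \<subseteq> (\<Union>t\<in>T. V t)" using t0 by (auto simp: C_def T2_def)
    qed
    then show ?thesis using eq by simp
  qed
  have "n \<notin> C" using VC t0(2) by blast
  moreover have "n \<notin> X" using X by blast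
  ultimately have "X = insert n X - {n}" "(V t0 \<union> C) - {n} = (V t0 - {n}) \<union> C" by auto
  then have XVC: "X = (V t0 - {n}) \<union> C" using eq2 by simp
  have "V t0 - {n} \<in> tails {n} G"
    using XVC X t0 V(1)[OF t0(1)] by (auto simp: tails_def insert_absorb)
  moreover have "C \<in> comp_fam (tails T1 F) G"
    unfolding comp_fam_def
  proof (intro CollectI bexI[of _ T2] conjI exI[of _ V])
    show "finite T2" using T by (simp add: T2_def)
    have "\<forall>a\<in>T1. \<forall>b\<in>T2. a < b" by (auto simp: T1_def T2_def)
    then show "T2 \<in> tails T1 F" using T(1) by (simp add: tails_def T12)
    show "\<forall>t\<in>T2. V t \<in> G \<and> V t \<subseteq> {t..} \<and> (\<forall>t'\<in>T2. t < t' \<longrightarrow> V t \<subseteq> {..<t'})"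
    proof (intro ballI conjI impI subsetI)
      fix t assume t: "t \<in> T2"
      then have "t \<in> T" by (simp add: T2_def)
      then show "V t \<in> G" by (rule V(1))
      show "x \<in> {t..}" if "x \<in> V t" for x
        using V(2)[OF \<open>t \<in> T\<close> that] by simp
      show "x \<in> {..<t'}" if "t' \<in> T2" "t < t'" "x \<in> V t" for x t'
        using V(3)[OF \<open>t \<in> T\<close> _ that(2,3)] that(1) by (simp add: T2_def)
    qed
  qed (simp add: C_def)
  moreover have "\<forall>b\<in>V t0 - {n}. \<forall>c\<in>C. b < c" using VC by blast
  ultimately have "X \<in> concat_fam (tails {n} G) (comp_fam (tails T1 F) G)"
    using XVC unfolding concat_fam_def by blast
  moreover have "T1 \<subseteq> {..n}" using V(2)[OF t0] by (auto simp: T1_def)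
  moreover have "T1 \<noteq> {}" using t0 by (auto simp: T1_def)
  ultimately show "X \<in> (\<Union>T\<in>{T. T \<subseteq> {..n}
      \<and> T \<noteq> {}}. concat_fam (tails {n} G) (comp_fam (tails T F) G))"
    by blast
qed

lemma finite_tails_index: "finite {T. T \<subseteq> {..n::nat} \<and> T \<noteq> {}}"
  by (rule finite_subset[of _ "Pow {..n}"]) auto

text \<open>A limit \<open>b\<close> has no predecessor to multiply by, hence the existential
  \<open>r\<close>. Opening a tag passes from \<open>F\<close> to some \<open>tails T F\<close> and
  costs one copy of \<open>\<beta>\<close>, the rank of the inner family;
  \<open>\<beta> r + \<beta> = \<beta> (r + 1)\<close> shows why the inner rank stands on the left
  of the product.\<close>

lemma rk_lt_comp_aux:
  assumes G: "rk_lt (BS \<beta>) G"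
  shows "rk_lt b F \<Longrightarrow> F \<noteq> {} \<Longrightarrow> \<exists>r. ole (BS r) b \<and> (rk_lt (BS (omul \<beta> r)) (comp_fam F G))"
proof (induction b arbitrary: F)
  case (BS b)
  have "rk_lt (omul \<beta> b) (tails {n} (comp_fam F G))" for n
  proof (rule rk_lt_antimono[OF rk_lt_UN[OF finite_tails_index] tails_comp])
    fix T :: "nat set" assume "T \<in> {T. T \<subseteq> {..n} \<and> T \<noteq> {}}"
    then have T: "rk_lt b (tails T F)" using rk_lt_BS_tails BS.prems(1) by blast
    show "rk_lt (omul \<beta> b) (concat_fam (tails {n} G) (comp_fam (tails T F) G))"
    proof (cases "tails T F = {}")
      case False
      then obtain r where r: "ole (BS r) b" "rk_lt (BS (omul \<beta> r)) (comp_fam (tails T F) G)"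
        using BS.IH[OF T] by blast
      have "rk_lt (oadd (omul \<beta> r) \<beta>) (concat_fam (tails {n} G) (comp_fam (tails T F) G))"
        using G by (intro rk_lt_concat_fam r) simp
      then show ?thesis
        using rk_lt_mono[OF ole_omul_right[OF r(1)]] by simp
    qed simp
  qed
  then show ?case by auto
next
  case (BL f)
  then obtain k where "rk_lt (f k) F" by auto
  then obtain r where "ole (BS r) (f k)" "rk_lt (BS (omul \<beta> r)) (comp_fam F G)"
    using BL.IH[OF rangeI] BL.prems(2) by blast
  then show ?case by (blast intro: ole_cocone)
qed auto

lemma rk_lt_comp:
  assumes "rk_lt (BS \<beta>) G" "rk_lt (BS b) F"
  shows "rk_lt (BS (omul \<beta> b)) (comp_fam F G)"
proof (cases "F = {}")
  case False
  then obtain r where "ole r b" "rk_lt (BS (omul \<beta> r)) (comp_fam F G)"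
    using rk_lt_comp_aux[OF assms(1) assms(2)] by auto
  then show ?thesis using rk_lt_mono[OF ole_suc[OF ole_omul_right]] by blast
qed simp

section \<open>Subtraction of ranks and explicit rankings\<close>

definition high_part :: "bord \<Rightarrow> nat set set \<Rightarrow> nat set set" where
  "high_part a F = {A. \<not> rk_lt a (tails A F)}"

lemma tails_high_part: "tails {n} (high_part a F) \<subseteq> high_part a (tails {n} F)"
proof
  fix B assume "B \<in> tails {n} (high_part a F)"
  then have "\<forall>b\<in>B. n < b" "\<not> rk_lt a (tails ({n} \<union> B) F)"
    by (auto simp: tails_def high_part_def)
  then show "B \<in> high_part a (tails {n} F)"
    using tails_tails[of "{n}" B F] by (simp add: high_part_def)
qed

text \<open>The family \<open>high_part a F\<close> plays the role of the \<open>a\<close>-th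
  derivative of \<open>F\<close>; passing to it removes \<open>a\<close> from the left of the
  rank.\<close>

lemma rk_lt_high_part: "rk_lt (oadd a b) F \<Longrightarrow> rk_lt b (high_part a F)"
proof (induction b arbitrary: F)
  case BZ
  then show ?case using rk_lt_tails by (auto simp: high_part_def)
next
  case (BS b)
  then show ?case using rk_lt_antimono[OF _ tails_high_part] by simp
next
  case (BL f)
  then show ?case by simp (metis rangeI)
qed

text \<open>Turns a rank bound into ordinal labels that drop with every extension that can still be
  completed in \<open>Z\<close>. At a successor the empty set gets the label \<open>b\<close>, and a
  set with least element \<open>m\<close> takes its label from a ranking of
  \<open>tails {m} Z\<close>. The labels later measure how much rank must be held in reserve for a
  partially built member of a Schreier family.\<close>

lemma rk_lt_ranking_aux:
  assumes "rk_lt b Z" "Z \<noteq> {}"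
  shows "\<exists>r. ole (BS (r {})) b \<and> (\<forall>A n. finite A \<longrightarrow> (\<forall>a\<in>A. a < n) \<longrightarrow>
           tails (insert n A) Z \<noteq> {} \<longrightarrow> olt (r (insert n A)) (r A))"
  using assms
proof (induction b arbitrary: Z)
  case (BS b)
  have "\<exists>r. tails {n} Z \<noteq> {} \<longrightarrow> ole (BS (r {})) b \<and> (\<forall>A k. finite A \<longrightarrow> (\<forall>a\<in>A. a < k) \<longrightarrow>
           tails (insert k A) (tails {n} Z) \<noteq> {} \<longrightarrow> olt (r (insert k A)) (r A))" for n
    using BS.IH[of "tails {n} Z"] BS.prems(1) by (metis rk_lt.simps(2))
  then obtain R where R: "\<And>n. tails {n} Z \<noteq> {} \<Longrightarrow> ole (BS (R n {})) b"
    "\<And>n A k. tails {n} Z \<noteq> {} \<Longrightarrow> finite A \<Longrightarrow> (\<forall>a\<in>A. a < k) \<Longrightarrow>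
           tails (insert k A) (tails {n} Z) \<noteq> {} \<Longrightarrow> olt (R n (insert k A)) (R n A)"
    by metis
  define r where "r A = (if A = {} then b else R (Min A) (A - {Min A}))" for A
  have "olt (r (insert n A)) (r A)"
    if A: "finite A" "\<forall>a\<in>A. a < n" "tails (insert n A) Z \<noteq> {}" for A n
  proof (cases "A = {}")
    case True
    then show ?thesis using R(1) A by (simp add: r_def olt_def)
  next
    case False
    define m where "m = Min A"
    have m: "m \<in> A" "\<And>a. a \<in> A \<Longrightarrow> m \<le> a" using A False by (auto simp: m_def)
    then have "m < n" using A by blast
    have "Min (insert n A) = m" using A False \<open>m < n\<close> by (simp add: m_def)
    moreover have "insert n A - {m} = insert n (A - {m})" using \<open>m < n\<close> by auto
    moreover have eq: "tails (insert n (A - {m})) (tails {m} Z) = tails (insert n A) Z"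
    proof -
      have "m < a" if "a \<in> insert n (A - {m})" for a
        using that m(2)[of a] \<open>m < n\<close> by (auto simp: order.not_eq_order_implies_strict)
      then have "tails (insert n (A - {m})) (tails {m} Z) = tails ({m} \<union> insert n (A - {m})) Z"
        by (intro tails_tails) auto
      also have "{m} \<union> insert n (A - {m}) = insert n A" using m by auto
      finally show ?thesis .
    qed
    moreover have "tails {m} Z \<noteq> {}" using A(3) unfolding eq[symmetric] by auto
    ultimately show ?thesis using R(2)[of m "A - {m}" n] A False by (simp add: r_def m_def)
  qed
  then show ?case by (intro exI[of _ r]) (simp add: r_def)
next
  case (BL f)
  then obtain k where "rk_lt (f k) Z" by auto
  from BL.IH[OF rangeI this BL.prems(2)] show ?case by (blast intro: ole_cocone)
qed simp

lemma rk_lt_ranking: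
  assumes "rk_lt (BS b) Z"
  shows "\<exists>r. ole (r {}) b \<and> (\<forall>A n. finite A \<longrightarrow> (\<forall>a\<in>A. a < n) \<longrightarrow>
           tails (insert n A) Z \<noteq> {} \<longrightarrow> olt (r (insert n A)) (r A))"
proof (cases "Z = {}")
  case True
  then show ?thesis by (intro exI[of _ "\<lambda>_. BZ"]) (simp add: ole_zero)
next
  case False
  from rk_lt_ranking_aux[OF assms this] show ?thesis unfolding ole_BS_BS .
qed

section \<open>Lower bounds on ranks\<close>

lemma rk_ge_empty [simp]: "\<not> rk_ge b {}"
  by (induction b) auto

lemma rk_ge_mono_set: "rk_ge b F \<Longrightarrow> F \<subseteq> G \<Longrightarrow> rk_ge b G"
proof (induction b arbitrary: F G)
  case (BS b)
  then show ?case using tails_mono by (metis rk_ge.simps(2))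
next
  case (BL f)
  then show ?case by simp (metis rangeI)
qed auto

lemma tails_Int: "tails A (F \<inter> G) = tails A F \<inter> tails A G"
  by (auto simp: tails_def)

lemma rk_ge_Int: "rk_ge b F \<Longrightarrow> rk_ge b G \<Longrightarrow> rk_ge b (F \<inter> G)"
proof (induction b arbitrary: F G)
  case (BS b)
  then obtain n1 n2 where "\<forall>n\<ge>n1. rk_ge b (tails {n} F)" "\<forall>n\<ge>n2. rk_ge b (tails {n} G)" by auto
  then have "\<forall>n\<ge>max n1 n2. rk_ge b (tails {n} (F \<inter> G))" using BS.IH by (simp add: tails_Int)
  then show ?case unfolding rk_ge.simps by blast
qed auto

lemma hereditary_tails: "hereditary F \<Longrightarrow> hereditary (tails A F)"
  unfolding hereditary_def tails_def
  by (clarsimp, meson Un_mono order_refl subsetD)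

lemma rk_ge_imp_empty_mem: "rk_ge b F \<Longrightarrow> hereditary F \<Longrightarrow> {} \<in> F"
proof (induction b arbitrary: F)
  case (BS b)
  then obtain n where "rk_ge b (tails {n} F)" by auto
  then have "{} \<in> tails {n} F" using BS hereditary_tails by blast
  then show ?case using BS.prems(2) by (auto simp: tails_def hereditary_def)
qed auto

lemma rk_ge_antimono: "ole a b \<Longrightarrow> rk_ge b F \<Longrightarrow> hereditary F \<Longrightarrow> rk_ge a F"
proof (induction arbitrary: F rule: ole.induct)
  case (ole_zero y)
  then show ?case using rk_ge_imp_empty_mem by simp
next
  case (ole_suc x y)
  then show ?case using hereditary_tails by (metis rk_ge.simps(2))
qed auto

text \<open>The counterpart of \<open>high_part\<close> for lower bounds: points placed so as to
  form a set in \<open>rich_part a F\<close> leave rank \<open>a\<close> of \<open>F\<close> for the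
  points that follow.\<close>

definition rich_part :: "bord \<Rightarrow> nat set set \<Rightarrow> nat set set" where
  "rich_part a F = {A. rk_ge a (tails A F)}"

lemma tails_rich_part: "rich_part a (tails {n} F) \<subseteq> tails {n} (rich_part a F)"
proof
  fix B assume B: "B \<in> rich_part a (tails {n} F)"
  then have "tails B (tails {n} F) \<noteq> {}" by (auto simp: rich_part_def)
  then have "\<forall>b\<in>B. n < b" by (auto simp: tails_def)
  then show "B \<in> tails {n} (rich_part a F)"
    using B tails_tails[of "{n}" B F] by (auto simp: rich_part_def tails_def[of "{n}" "{A. _ A}"])
qed

lemma rk_ge_rich_part: "rk_ge (oadd a b) F \<Longrightarrow> rk_ge b (rich_part a F)"
proof (induction b arbitrary: F)
  case BZ
  then show ?case by (simp add: rich_part_def)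
next
  case (BS b)
  then show ?case using rk_ge_mono_set[OF _ tails_rich_part] by auto metis
qed auto

lemma rk_ge_card: "rk_ge (ofnat j) F \<Longrightarrow> \<exists>A\<in>F. finite A \<and> card A = j"
proof (induction j arbitrary: F)
  case (Suc j)
  then obtain n where "rk_ge (ofnat j) (tails {n} F)" by auto
  then obtain A where A: "A \<in> tails {n} F" "finite A" "card A = j" using Suc.IH by blast
  then have "n \<notin> A" by (auto simp: tails_def)
  with A have "insert n A \<in> F" "finite (insert n A)" "card (insert n A) = Suc j"
    by (simp_all add: tails_def)
  then show ?case by blast
next
  case 0
  then show ?case by (intro bexI[of _ "{}"]) simp_all
qed

section \<open>The Cantor--Bendixson index\<close>

lemma spreading_insert:
  assumes "spreading G" "insert n A \<in> G" "\<forall>a\<in>A. a < n" "n \<le> n'"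
  shows "insert n' A \<in> G"
proof -
  define f where "f a = (if a = n then n' else a)" for a
  have "f ` insert n A \<in> G"
    using assms unfolding spreading_def
    by (elim ballE[of _ _ "insert n A"] allE[of _ f] mp) (auto simp: f_def strict_mono_on_def)
  moreover have "f ` A = A" using assms(3) by (force simp: f_def)
  moreover have "f n = n'" by (simp add: f_def)
  ultimately show ?thesis by simp
qed

lemma topspace_cantor [simp]: "topspace cantor = UNIV"
  by (simp add: cantor_def)

lemma openin_cantor_cylinder: "openin cantor {g. \<forall>i\<le>N. g i = f i}"
proof -
  have "openin cantor (\<Pi>\<^sub>E i\<in>UNIV. if i \<le> N then {f i} else UNIV)"
    unfolding cantor_def
  proof (rule product_topology_basis)
    show "finite {i. (if i \<le> N then {f i} else UNIV) \<noteq> topspace (discrete_topology (UNIV :: bool set))}"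
      by (rule finite_subset[of _ "{..N}"]) auto
  qed simp
  moreover have "(\<Pi>\<^sub>E i\<in>UNIV. if i \<le> N then {f i} else UNIV) = {g. \<forall>i\<le>N. g i = f i}"
    by (auto simp: PiE_iff split: if_splits)
  ultimately show ?thesis by simp
qed

lemma openin_cantor_imp_cylinder:
  assumes "openin cantor T" "f \<in> T"
  shows "\<exists>N. {g. \<forall>i\<le>N. g i = f i} \<subseteq> T"
proof -
  obtain U where U: "finite {i. U i \<noteq> UNIV}" "\<And>i. f i \<in> U i" "(\<Pi>\<^sub>E i\<in>UNIV. U i) \<subseteq> T"
    using product_topology_open_contains_basis[OF assms[unfolded cantor_def]]
    by (auto simp: PiE_iff)
  obtain N where N: "\<And>i. U i \<noteq> UNIV \<Longrightarrow> i \<le> N"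
    using finite_nat_set_iff_bounded_le[THEN iffD1, OF U(1)] by auto
  have "g \<in> T" if "\<forall>i\<le>N. g i = f i" for g
  proof -
    have "g i \<in> U i" for i using N[of i] U(2)[of i] that by (cases "U i = UNIV") auto
    then show ?thesis using U(3) by (auto simp: PiE_iff)
  qed
  then show ?thesis by blast
qed

lemma inj_ind: "ind A = ind B \<longleftrightarrow> A = B"
  by (auto simp: ind_def fun_eq_iff)

lemma cb_deriv_iff_cylinder:
  "A \<in> cb_deriv G \<longleftrightarrow> (\<forall>N. \<exists>B\<in>G. B \<noteq> A \<and> (\<forall>i\<le>N. i \<in> B \<longleftrightarrow> i \<in> A))"
proof -
  have *: "(\<exists>y. y \<noteq> ind A \<and> y \<in> ind ` G \<and> y \<in> T) \<longleftrightarrow> (\<exists>B\<in>G. B \<noteq> A \<and> ind B \<in> T)" for T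
  proof
    assume "\<exists>y. y \<noteq> ind A \<and> y \<in> ind ` G \<and> y \<in> T"
    then obtain y where y: "y \<noteq> ind A" "y \<in> ind ` G" "y \<in> T" by (elim exE conjE)
    from y(2) obtain B where "y = ind B" "B \<in> G" by (rule imageE)
    then show "\<exists>B\<in>G. B \<noteq> A \<and> ind B \<in> T" using y by (intro bexI[of _ B]) auto
  next
    assume "\<exists>B\<in>G. B \<noteq> A \<and> ind B \<in> T"
    then obtain B where "B \<in> G" "B \<noteq> A" "ind B \<in> T" by (elim bexE conjE)
    moreover from this have "ind B \<noteq> ind A" by (simp add: inj_ind)
    ultimately show "\<exists>y. y \<noteq> ind A \<and> y \<in> ind ` G \<and> y \<in> T"
      by (intro exI[of _ "ind B"] conjI imageI)
  qed
  have "A \<in> cb_deriv G \<longleftrightarrow> (\<forall>T. ind A \<in> T \<and> openin cantor T \<longrightarrow> (\<exists>B\<in>G. B \<noteq> A \<and> ind B \<in> T))"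
    unfolding cb_deriv_def in_derived_set_of mem_Collect_eq * by simp
  also have "\<dots> \<longleftrightarrow> (\<forall>N. \<exists>B\<in>G. B \<noteq> A \<and> (\<forall>i\<le>N. i \<in> B \<longleftrightarrow> i \<in> A))"
  proof safe
    fix N assume *: "\<forall>T. ind A \<in> T \<and> openin cantor T \<longrightarrow> (\<exists>B\<in>G. B \<noteq> A \<and> ind B \<in> T)"
    have "\<exists>B\<in>G. B \<noteq> A \<and> ind B \<in> {g. \<forall>i\<le>N. g i = ind A i}"
      using *[rule_format, of "{g. \<forall>i\<le>N. g i = ind A i}"] openin_cantor_cylinder[of N "ind A"]
      by simp
    then show "\<exists>B\<in>G. B \<noteq> A \<and> (\<forall>i\<le>N. i \<in> B \<longleftrightarrow> i \<in> A)" by (simp add: ind_def)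
  next
    fix T assume *: "\<forall>N. \<exists>B\<in>G. B \<noteq> A \<and> (\<forall>i\<le>N. i \<in> B \<longleftrightarrow> i \<in> A)"
      and T: "ind A \<in> T" "openin cantor T"
    obtain N where N: "{g. \<forall>i\<le>N. g i = ind A i} \<subseteq> T"
      using openin_cantor_imp_cylinder[OF T(2,1)] by blast
    obtain B where B: "B \<in> G" "B \<noteq> A" "\<forall>i\<le>N. i \<in> B \<longleftrightarrow> i \<in> A"
      using *[rule_format, of N] by (elim bexE conjE)
    then have "ind B \<in> {g. \<forall>i\<le>N. g i = ind A i}" by (simp add: ind_def)
    then show "\<exists>B\<in>G. B \<noteq> A \<and> ind B \<in> T" using N B by (intro bexI[of _ B] conjI) auto
  qed
  finally show ?thesis .
qed

lemma cb_deriv_mono: "D \<subseteq> F \<Longrightarrow> cb_deriv D \<subseteq> cb_deriv F"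
  by (auto simp: cb_deriv_iff_cylinder) blast

lemma cb_deriv_subset_regular:
  assumes "regular_family F"
  shows "cb_deriv F \<subseteq> F"
proof -
  have "Hausdorff_space cantor"
    by (simp add: cantor_def Hausdorff_space_product_topology)
  then have "closedin cantor (ind ` F)"
    using assms compactin_imp_closedin by (auto simp: regular_family_def)
  then have *: "cantor derived_set_of (ind ` F) \<subseteq> ind ` F"
    by (simp add: closedin_contains_derived_set)
  show ?thesis
  proof
    fix A assume "A \<in> cb_deriv F"
    then have "ind A \<in> ind ` F" using * by (auto simp only: cb_deriv_def)
    then obtain B where "ind A = ind B" "B \<in> F" by (rule imageE)
    then show "A \<in> F" by (simp only: inj_ind)
  qed
qed

text \<open>A limit point is approximated by members of \<open>D\<close> agreeing with it on long
  initial segments; such a member has a further point beyond, and heredity trims it to a one-point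
  extension. Conversely, spreading pushes the added point to infinity. Compactness of
  \<open>F\<close> puts the limit point into \<open>F\<close>, which makes it finite.\<close>

lemma cb_deriv_iff:
  assumes F: "regular_family F" and D: "D \<subseteq> F" "hereditary D" "spreading D"
  shows "A \<in> cb_deriv D \<longleftrightarrow> finite A \<and> (\<exists>n. (\<forall>a\<in>A. a < n) \<and> insert n A \<in> D)"
proof
  assume A: "A \<in> cb_deriv D"
  then have "A \<in> F" using cb_deriv_mono[OF D(1)] cb_deriv_subset_regular[OF F] by blast
  then have fin: "finite A" using F by (simp add: regular_family_def)
  then obtain N where N: "\<forall>a\<in>A. a \<le> N" by (meson finite_nat_set_iff_bounded_le)
  obtain B where B: "B \<in> D" "B \<noteq> A" "\<forall>i\<le>N. i \<in> B \<longleftrightarrow> i \<in> A"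
    using A[unfolded cb_deriv_iff_cylinder, rule_format, of N] by (elim bexE conjE)
  then have "A \<subseteq> B" using N by blast
  then obtain n where n: "n \<in> B" "n \<notin> A" using B(2) by blast
  then have "N < n" using B(3) by (metis not_le)
  then have "\<forall>a\<in>A. a < n" using N by force
  moreover have "insert n A \<in> D"
    using B(1) n \<open>A \<subseteq> B\<close> D(2) unfolding hereditary_def by (metis insert_subset)
  ultimately show "finite A \<and> (\<exists>n. (\<forall>a\<in>A. a < n) \<and> insert n A \<in> D)" using fin by blast
next
  assume "finite A \<and> (\<exists>n. (\<forall>a\<in>A. a < n) \<and> insert n A \<in> D)"
  then obtain n where n: "\<forall>a\<in>A. a < n" "insert n A \<in> D" by blast
  show "A \<in> cb_deriv D"
    unfolding cb_deriv_iff_cylinder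
  proof
    fix N
    have "insert (max n (Suc N)) A \<in> D"
      using spreading_insert[OF D(3) n(2,1), of "max n (Suc N)"] by simp
    moreover have "max n (Suc N) \<notin> A" using n(1) by (metis max.cobounded1 not_le)
    ultimately show "\<exists>B\<in>D. B \<noteq> A \<and> (\<forall>i\<le>N. i \<in> B \<longleftrightarrow> i \<in> A)"
      by (intro bexI[of _ "insert (max n (Suc N)) A"]) auto
  qed
qed

lemma cb_deriv_hereditary:
  assumes F: "regular_family F" and D: "D \<subseteq> F" "hereditary D" "spreading D"
  shows "hereditary (cb_deriv D)"
  unfolding hereditary_def
proof (intro ballI allI impI)
  fix A B assume A: "A \<in> cb_deriv D" "B \<subseteq> A"
  then obtain n where n: "finite A" "\<forall>a\<in>A. a < n" "insert n A \<in> D"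
    unfolding cb_deriv_iff[OF assms] by blast
  then have "finite B" "\<forall>a\<in>B. a < n" using A(2) finite_subset by auto
  moreover have "insert n B \<in> D"
    using n(3) A(2) D(2) unfolding hereditary_def by (metis insert_mono)
  ultimately show "B \<in> cb_deriv D" unfolding cb_deriv_iff[OF assms] by blast
qed

lemma cb_deriv_spreading:
  assumes F: "regular_family F" and D: "D \<subseteq> F" "hereditary D" "spreading D"
  shows "spreading (cb_deriv D)"
  unfolding spreading_def
proof (intro ballI allI impI)
  fix A f assume A: "A \<in> cb_deriv D" and f: "strict_mono_on A f \<and> (\<forall>a\<in>A. a \<le> f a)"
  then obtain n where n: "finite A" "\<forall>a\<in>A. a < n" "insert n A \<in> D"
    unfolding cb_deriv_iff[OF assms] by blast
  define n' where "n' = max n (Suc (Max (insert 0 (f ` A))))"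
  have n': "f a < n'" if "a \<in> A" for a
  proof -
    have "f a \<le> Max (insert 0 (f ` A))" using n(1) that by (intro Max_ge) auto
    then show ?thesis by (simp add: n'_def)
  qed
  have "n \<le> n'" by (simp add: n'_def)
  define g where "g a = (if a = n then n' else f a)" for a
  have "strict_mono_on (insert n A) g"
  proof (rule strict_mono_onI)
    fix r s assume rs: "r \<in> insert n A" "s \<in> insert n A" "r < s"
    then have "r \<in> A" "r < n" "s \<noteq> n \<longrightarrow> s \<in> A" using n(2) by force+
    then show "g r < g s"
      using n'[of r] f rs by (auto simp: g_def strict_mono_on_def)
  qed
  moreover have "\<forall>a\<in>insert n A. a \<le> g a" using f \<open>n \<le> n'\<close> by (auto simp: g_def)
  ultimately have "g ` insert n A \<in> D" using D(3) n(3) unfolding spreading_def by blast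
  moreover have "g ` A = f ` A" using n(2) by (force simp: g_def)
  moreover have "g n = n'" by (simp add: g_def)
  ultimately have "insert n' (f ` A) \<in> D" by simp
  moreover have "\<forall>a\<in>f ` A. a < n'" using n' by blast
  ultimately show "f ` A \<in> cb_deriv D" unfolding cb_deriv_iff[OF assms] using n(1) by blast
qed

lemma cb_iter_regular:
  assumes F: "regular_family F"
  shows "cb_iter F b \<subseteq> F \<and> hereditary (cb_iter F b) \<and> spreading (cb_iter F b)"
proof (induction b)
  case BZ
  then show ?case using F by (simp add: regular_family_def)
next
  case (BS b)
  then show ?case
    using cb_deriv_hereditary[OF F] cb_deriv_spreading[OF F]
      cb_deriv_mono[of "cb_iter F b" F] cb_deriv_subset_regular[OF F] by auto
next
  case (BL f)
  then have "\<And>n. hereditary (cb_iter F (f n))" "\<And>n. spreading (cb_iter F (f n))"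
    "cb_iter F (f 0) \<subseteq> F" by auto
  then show ?case by (auto simp: hereditary_def spreading_def) blast+
qed

text \<open>Spreading turns one extending point into all later ones, which is the form that the
  successor clause of \<open>rk_ge\<close> asks for.\<close>

lemma cb_iter_imp_rk_ge:
  assumes F: "regular_family F"
  shows "A \<in> cb_iter F b \<Longrightarrow> rk_ge b (tails A F)"
proof (induction b arbitrary: A)
  case BZ
  then show ?case by (simp add: tails_def)
next
  case (BS b)
  note r = cb_iter_regular[OF F, of b]
  obtain n where n: "\<forall>a\<in>A. a < n" "insert n A \<in> cb_iter F b"
    using BS.prems cb_deriv_iff[OF F, of "cb_iter F b" A] r by auto
  have "rk_ge b (tails {m} (tails A F))" if "m \<ge> n" for m
  proof -
    have "\<forall>a\<in>A. a < m" using n(1) that by auto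
    then have "tails {m} (tails A F) = tails (insert m A) F" by (subst tails_tails) auto
    moreover have "insert m A \<in> cb_iter F b"
      using spreading_insert[of "cb_iter F b" n A m] r n that by blast
    ultimately show ?thesis using BS.IH by simp
  qed
  then show ?case by auto
qed auto

lemma not_cb_iter_imp_rk_lt:
  assumes F: "regular_family F"
  shows "A \<notin> cb_iter F b \<Longrightarrow> finite A \<Longrightarrow> rk_lt b (tails A F)"
proof (induction b arbitrary: A)
  case BZ
  have "hereditary F" using F by (simp add: regular_family_def)
  with BZ show ?case by (auto simp: tails_def hereditary_def)
next
  case (BS b)
  note r = cb_iter_regular[OF F, of b]
  show ?case unfolding rk_lt.simps
  proof
    fix n
    show "rk_lt b (tails {n} (tails A F))"
    proof (cases "\<forall>a\<in>A. a < n")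
      case True
      then have "insert n A \<notin> cb_iter F b"
        using BS.prems cb_deriv_iff[OF F, of "cb_iter F b" A] r by auto
      moreover have "tails {n} (tails A F) = tails (insert n A) F" using True
        by (subst tails_tails) auto
      ultimately show ?thesis using BS by simp
    next
      case False
      then have "tails {n} (tails A F) = {}" by (auto simp: tails_def)
      then show ?thesis by simp
    qed
  qed
next
  case (BL f)
  then show ?case by simp (metis rangeI)
qed

lemma cb_index_imp_rk_ge:
  assumes "regular_family F" "cb_index F a"
  shows "rk_ge a F"
  using cb_iter_imp_rk_ge[OF assms(1), of "{}" a] assms(2) by (simp add: cb_index_def)

text \<open>No singleton survives in the \<open>a\<close>-th derivative, so every
  \<open>tails {n} F\<close> has rank below \<open>a\<close>; this is the successor clause of
  \<open>rk_lt\<close>.\<close>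

lemma cb_index_imp_rk_lt:
  assumes "regular_family F" "cb_index F a"
  shows "rk_lt (BS a) F"
  using not_cb_iter_imp_rk_lt[OF assms(1), of "{_}" a] assms(2) by (simp add: cb_index_def)

section \<open>Averages with small mass\<close>

text \<open>The averaging argument needs to know of a block only the interval from
  \<open>lo c\<close> to \<open>hi c\<close>. The state of the game lets earlier blocks constrain
  later ones.\<close>

locale block_game =
  fixes step :: "'s \<Rightarrow> 'c \<Rightarrow> 's \<Rightarrow> bool" and fin :: "'s \<Rightarrow> bool" and lo hi :: "'c \<Rightarrow> nat"
  assumes lo_le_hi: "step s c s' \<Longrightarrow> lo c \<le> hi c"
begin

text \<open>Each move appends a block beyond an arbitrary threshold; \<open>win b s\<close> means that from \<open>s\<close> this can be
  kept up while an ordinal counts down from \<open>b\<close>.\<close>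
primrec win :: "bord \<Rightarrow> 's \<Rightarrow> bool" where
  "win BZ s \<longleftrightarrow> fin s"
| "win (BS b) s \<longleftrightarrow> (\<forall>N. \<exists>c s'. N < lo c \<and> step s c s' \<and> win b s')"
| "win (BL f) s \<longleftrightarrow> (\<forall>k. win (f k) s)"

primrec path :: "'s \<Rightarrow> 'c list \<Rightarrow> 's \<Rightarrow> bool" where
  "path s [] s' \<longleftrightarrow> s = s'"
| "path s (c # cs) s' \<longleftrightarrow> (\<exists>s1. step s c s1 \<and> path s1 cs s')"

primrec successive :: "nat \<Rightarrow> 'c list \<Rightarrow> bool" where
  "successive N [] \<longleftrightarrow> True"
| "successive N (c # cs) \<longleftrightarrow> N < lo c \<and> lo c \<le> hi c \<and> successive (hi c) cs"

primrec seqend :: "nat \<Rightarrow> 'c list \<Rightarrow> nat" where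
  "seqend N [] = N"
| "seqend N (c # cs) = seqend (hi c) cs"

definition hits :: "'c \<Rightarrow> nat set \<Rightarrow> bool" where
  "hits c A \<longleftrightarrow> A \<inter> {lo c..hi c} \<noteq> {}"

definition mass :: "(real \<times> 'c) list \<Rightarrow> nat set \<Rightarrow> real" where
  "mass w A = (\<Sum>(a, c)\<leftarrow>w. if hits c A then a else 0)"

lemma path_append: "path s (cs @ ds) s' \<longleftrightarrow> (\<exists>s1. path s cs s1 \<and> path s1 ds s')"
  by (induction cs arbitrary: s) auto

lemma successive_append:
  "successive N (cs @ ds) \<longleftrightarrow> successive N cs \<and> successive (seqend N cs) ds"
  by (induction cs arbitrary: N) auto

lemma le_seqend: "successive N cs \<Longrightarrow> N \<le> seqend N cs"
  by (induction cs arbitrary: N) force+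

lemma successive_bounds:
  "successive N cs \<Longrightarrow> c \<in> set cs \<Longrightarrow> N < lo c \<and> lo c \<le> hi c \<and> hi c \<le> seqend N cs"
proof (induction cs arbitrary: N)
  case (Cons d cs)
  have "hi d \<le> seqend (hi d) cs"
    using Cons.prems(1) le_seqend by simp
  then show ?case using Cons by force
qed simp

lemma mass_append: "mass (v @ w) A = mass v A + mass w A"
  by (simp add: mass_def)

lemma mass_le_sum:
  "(\<forall>(a, c)\<in>set w. 0 \<le> a) \<Longrightarrow> mass w A \<le> sum_list (map fst w)"
  unfolding mass_def by (induction w) auto

lemma mass_cong:
  "(\<And>c. c \<in> snd ` set w \<Longrightarrow> hits c A \<longleftrightarrow> hits c B) \<Longrightarrow> mass w A = mass w B"
  unfolding mass_def by (intro arg_cong[of _ _ sum_list] map_cong) force+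

lemma mass_scale: "mass (map (\<lambda>(a, c). (r * a, c)) w) A = r * mass w A"
  unfolding mass_def by (induction w) (auto simp: algebra_simps)

text \<open>The ordinal \<open>a\<close> is the rank of the game still available after the average,
  so that further averages can be appended.\<close>

definition avg :: "bord \<Rightarrow> 's \<Rightarrow> nat \<Rightarrow> real \<Rightarrow> (real \<times> 'c) list \<Rightarrow> bool" where
  "avg a s N r w \<longleftrightarrow> (\<exists>s'. path s (map snd w) s' \<and> win a s') \<and> successive N (map snd w)
     \<and> (\<forall>(x, c)\<in>set w. 0 \<le> x) \<and> sum_list (map fst w) = r"

text \<open>The number of whole multiples of \<open>x\<close> left in the rank of \<open>G\<close> above \<open>A \<inter> {..N}\<close>. It only decreases
  with \<open>N\<close>, and a block of order \<open>x\<close> on which it stays constant sees \<open>A\<close> as a member of a family of rank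
  below \<open>x\<close>.\<close>
definition crossing :: "bord \<Rightarrow> nat set set \<Rightarrow> nat set \<Rightarrow> nat \<Rightarrow> nat" where
  "crossing x G A N = (LEAST q. rk_lt (omul x (ofnat (Suc q))) (tails (A \<inter> {..N}) G))"

text \<open>An appended average of order \<open>x\<close> either leaves \<open>crossing\<close>
  unchanged and then gives \<open>A\<close> mass at most \<open>\<tau>\<close>, or it lowers
  \<open>crossing\<close> by at least one, which pays for its full mass 1. The payments telescope,
  so the excess over \<open>j * \<tau>\<close> is at most the initial value of
  \<open>crossing\<close>, however large \<open>j\<close> is.\<close>

lemma blocks_exist:
  assumes IH: "\<And>G \<tau> a s N. 0 < \<tau> \<Longrightarrow> rk_lt x G \<Longrightarrow> win (oadd a x) s \<Longrightarrow>
      \<exists>w. avg a s N 1 w \<and> (\<forall>A\<in>G. mass w A \<le> \<tau>)"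
    and \<tau>: "0 < \<tau>" and G: "rk_lt (omul x (ofnat k)) G"
  shows "win (oadd a (omul x (ofnat j))) s \<Longrightarrow>
    \<exists>w. avg a s N (real j) w \<and> (\<forall>A\<in>G. mass w A \<le> real j * \<tau> + real (crossing x G A N))"
proof (induction j arbitrary: s N)
  case 0
  then show ?case by (intro exI[of _ "[]"]) (simp add: avg_def mass_def)
next
  case (Suc j)
  \<comment> \<open>What the next average can see of a set depends on the part of the set up to
    \<open>N\<close> and on the current quotient, so finitely many families are treated at once
    through their union \<open>GN\<close>.\<close>
  define I where "I = {p \<in> Pow {..N} \<times> {..k}. rk_lt (omul x (ofnat (Suc (snd p)))) (tails (fst p) G)}"
  define GN where "GN = (\<Union>p\<in>I. high_part (omul x (ofnat (snd p))) (tails (fst p) G))"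
  have "rk_lt x GN"
    unfolding GN_def
  proof (rule rk_lt_UN)
    show "finite I" by (rule finite_subset[of _ "Pow {..N} \<times> {..k}"]) (auto simp: I_def)
    show "rk_lt x (high_part (omul x (ofnat (snd p))) (tails (fst p) G))" if "p \<in> I" for p
      using that by (intro rk_lt_high_part) (simp add: I_def)
  qed
  moreover have "win (oadd (oadd a (omul x (ofnat j))) x) s"
    using Suc.prems by (simp add: oadd_assoc)
  ultimately obtain v where v: "avg (oadd a (omul x (ofnat j))) s N 1 v" "\<forall>A\<in>GN. mass v A \<le> \<tau>"
    using IH[OF \<tau>] by meson
  then obtain s1 where s1: "path s (map snd v) s1" "win (oadd a (omul x (ofnat j))) s1"
    by (auto simp: avg_def)
  define N1 where "N1 = seqend N (map snd v)"
  obtain w where w: "avg a s1 N1 (real j) w"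
    "\<forall>A\<in>G. mass w A \<le> real j * \<tau> + real (crossing x G A N1)"
    using Suc.IH[OF s1(2)] by blast
  have sv: "successive N (map snd v)" using v by (simp add: avg_def)
  have "avg a s N (real (Suc j)) (v @ w)"
    using v w s1 by (auto simp: avg_def path_append successive_append N1_def)
  moreover have "mass (v @ w) A \<le> real (Suc j) * \<tau> + real (crossing x G A N)" if A: "A \<in> G" for A
  proof -
    define A0 where "A0 = A \<inter> {..N}"
    define B where "B = A \<inter> {N<..N1}"
    define q where "q = crossing x G A N"
    define q1 where "q1 = crossing x G A N1"
    have "N \<le> N1" unfolding N1_def by (rule le_seqend[OF sv])
    then have A01: "A0 \<union> B = A \<inter> {..N1}" by (auto simp: A0_def B_def)
    have sub1: "tails B (tails A0 G) = tails (A \<inter> {..N1}) G"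
      unfolding A01[symmetric] by (rule tails_tails) (auto simp: A0_def B_def)
    have k: "rk_lt (omul x (ofnat (Suc k))) (tails A0 G)"
      using G by (intro rk_lt_tails rk_lt_mono[OF _ G] ole_omul_right) simp
    have q: "rk_lt (omul x (ofnat (Suc q))) (tails A0 G)"
      unfolding q_def crossing_def A0_def[symmetric]
      by (rule LeastI[of "\<lambda>q. rk_lt (omul x (ofnat (Suc q))) (tails A0 G)", OF k])
    have qk: "q \<le> k"
      unfolding q_def crossing_def A0_def[symmetric]
      by (rule Least_le[of "\<lambda>q. rk_lt (omul x (ofnat (Suc q))) (tails A0 G)", OF k])
    have "rk_lt (omul x (ofnat (Suc q))) (tails B (tails A0 G))" by (rule rk_lt_tails[OF q])
    then have q1q: "q1 \<le> q"
      unfolding q1_def crossing_def sub1 by (rule Least_le)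
    have "mass v A \<le> \<tau> + (real q - real q1)"
    proof (cases "q1 = q")
      case True
      have "\<not> rk_lt (omul x (ofnat q)) (tails (A \<inter> {..N1}) G)"
      proof (cases q)
        case 0
        have "A \<inter> {..N1} \<union> (A - {..N1}) = A" by auto
        then have "A - {..N1} \<in> tails (A \<inter> {..N1}) G" using A by (auto simp: tails_def)
        then show ?thesis using 0 by auto
      next
        case (Suc q')
        then have "q' < crossing x G A N1" using True by (simp add: q1_def)
        then show ?thesis unfolding crossing_def Suc by (rule not_less_Least)
      qed
      then have "B \<in> high_part (omul x (ofnat q)) (tails A0 G)"
        by (simp add: high_part_def sub1)
      moreover have "(A0, q) \<in> I" using q qk by (simp add: I_def A0_def)
      ultimately have "B \<in> GN" unfolding GN_def by force
      then have "mass v B \<le> \<tau>" using v(2) by blast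
      moreover have "mass v A = mass v B"
      proof (rule mass_cong)
        fix c assume "c \<in> snd ` set v"
        then have "c \<in> set (map snd v)" by simp
        from successive_bounds[OF sv this]
        show "hits c A \<longleftrightarrow> hits c B" by (force simp: hits_def B_def N1_def)
      qed
      ultimately show ?thesis using True by simp
    next
      case False
      then have "1 \<le> real q - real q1" using q1q by simp
      moreover have "mass v A \<le> 1" using mass_le_sum[of v A] v(1) by (simp add: avg_def)
      ultimately show ?thesis using \<tau> by simp
    qed
    moreover have "mass w A \<le> real j * \<tau> + real q1" using w(2) A by (simp add: q1_def)
    ultimately show ?thesis by (simp add: mass_append q_def algebra_simps)
  qed
  ultimately show ?case by blast
qed

text \<open>A form of repeated averages along the exponent. At a successor, \<open>G\<close> has
  rank below \<open>k\<close> copies of \<open>opow omega \<delta>\<close>; joining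
  \<open>j \<ge> 2 k / \<tau>\<close> averages of tolerance \<open>\<tau> / 2\<close> and dividing
  by \<open>j\<close> turns the excess \<open>k\<close> into at most \<open>\<tau> / 2\<close>. At a
  limit the bound on \<open>G\<close> selects the term, and the game is winnable for every
  term.\<close>

theorem small_average:
  assumes "0 < \<tau>" "rk_lt (opow omega \<delta>) G" "win (oadd a (opow omega \<delta>)) s"
  shows "\<exists>w. avg a s N 1 w \<and> (\<forall>A\<in>G. mass w A \<le> \<tau>)"
  using assms
proof (induction \<delta> arbitrary: G \<tau> a s N)
  case BZ
  from BZ.prems(3) have "\<exists>c s'. N < lo c \<and> step s c s' \<and> win a s'" by simp
  then obtain c s' where c: "N < lo c" "step s c s'" "win a s'" by blast
  have "A = {}" if "A \<in> G" for A
  proof (rule ccontr)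
    assume "A \<noteq> {}"
    then obtain n where "tails A G = tails (A - {n}) (tails {n} G)" by (rule tails_split_least)
    moreover have "{} \<in> tails A G" using that by (simp add: tails_def)
    ultimately show False using BZ.prems(2) by simp
  qed
  then have "mass [(1, c)] A \<le> \<tau>" if "A \<in> G" for A
    using that BZ.prems(1) by (force simp: mass_def hits_def)
  moreover have "avg a s N 1 [(1, c)]"
    using c lo_le_hi by (auto simp: avg_def)
  ultimately show ?case by blast
next
  case (BS \<delta>)
  from BS.prems(2) obtain k where k: "rk_lt (omul (opow omega \<delta>) (ofnat k)) G"
    by (auto simp: omega_def)
  define j where "j = Suc (nat \<lceil>2 * real k / \<tau>\<rceil>)"
  have "2 * real k / \<tau> \<le> real j" unfolding j_def by linarith
  then have jk: "real k \<le> real j * (\<tau> / 2)" using BS.prems(1) by (simp add: field_simps)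
  have "win (oadd a (omul (opow omega \<delta>) (ofnat j))) s"
    using BS.prems(3) by (simp add: omega_def)
  from blocks_exist[OF BS.IH half_gt_zero[OF BS.prems(1)] k this]
  have "\<exists>w. avg a s N (real j) w \<and>
    (\<forall>A\<in>G. mass w A \<le> real j * (\<tau> / 2) + real (crossing (opow omega \<delta>) G A N))" .
  then obtain w where w: "avg a s N (real j) w"
    "\<forall>A\<in>G. mass w A \<le> real j * (\<tau> / 2) + real (crossing (opow omega \<delta>) G A N)"
    by (elim exE conjE)
  define w' where "w' = map (\<lambda>(b, c). (1 / real j * b, c)) w"
  have j0: "0 < real j" by (simp add: j_def)
  have "map snd w' = map snd w" by (auto simp: w'_def)
  moreover have "sum_list (map fst w') = 1 / real j * sum_list (map fst w)"
    unfolding w'_def by (induction w) (auto simp: algebra_simps add_divide_distrib)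
  moreover have "\<forall>(x, c)\<in>set w'. 0 \<le> x"
    using w(1) j0 by (auto simp: avg_def w'_def)
  ultimately have "avg a s N 1 w'"
    using w(1) j0 by (simp add: avg_def)
  moreover have "mass w' A \<le> \<tau>" if A: "A \<in> G" for A
  proof -
    have "rk_lt (omul (opow omega \<delta>) (ofnat (Suc k))) (tails (A \<inter> {..N}) G)"
      by (intro rk_lt_tails rk_lt_mono[OF _ k] ole_omul_right) simp
    then have "crossing (opow omega \<delta>) G A N \<le> k" unfolding crossing_def by (rule Least_le)
    then have "mass w A \<le> real j * (\<tau> / 2) + real k" using bspec[OF w(2) A] by simp
    also have "\<dots> \<le> real j * \<tau>" using jk by simp
    finally have "mass w A / real j \<le> \<tau>" using j0 by (simp add: field_simps)
    then show ?thesis unfolding w'_def mass_scale by simp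
  qed
  ultimately show ?case by blast
next
  case (BL f)
  then obtain n where "rk_lt (opow omega (f n)) G" "win (oadd a (opow omega (f n))) s" by auto
  then show ?case using BL by blast
qed

end

section \<open>Norming functionals\<close>

definition supp :: "(nat \<Rightarrow> real) \<Rightarrow> nat set" where
  "supp x = {i. x i \<noteq> 0}"

definition ev :: "(nat \<Rightarrow> real) \<Rightarrow> (nat \<Rightarrow> real) \<Rightarrow> real" where
  "ev f x = (\<Sum>i\<in>supp x. f i * \<bar>x i\<bar>)"

text \<open>A node keeps the sets \<open>E\<close> alongside the functionals. Restricting a
  functional may then annihilate a child without disturbing admissibility, and the zero functional
  belongs to the class for this reason. Signs are taken care of by \<open>ev\<close>, which pairs
  with absolute values.\<close>

inductive norming :: "(nat \<Rightarrow> real) \<Rightarrow> (nat \<Rightarrow> nat set set) \<Rightarrow> (nat \<Rightarrow> real) \<Rightarrow> bool" for \<theta> Fs where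
  norming_zero: "norming \<theta> Fs (\<lambda>i. 0)"
| norming_unit: "norming \<theta> Fs (\<lambda>i. if i = j then 1 else 0)"
| norming_node: "admissible (Fs n) (map fst egs) \<Longrightarrow> (\<forall>(E, g)\<in>set egs. norming \<theta> Fs g \<and> supp g \<subseteq> E) \<Longrightarrow>
    norming \<theta> Fs (\<lambda>i. \<theta> n * (\<Sum>(E, g)\<leftarrow>egs. g i))"

lemma c00_supp: "c00 x \<longleftrightarrow> finite (supp x)"
  by (simp add: c00_def supp_def)

lemma ev_superset:
  assumes "finite S" "supp x \<subseteq> S"
  shows "ev f x = (\<Sum>i\<in>S. f i * \<bar>x i\<bar>)"
  unfolding ev_def by (rule sum.mono_neutral_left[OF assms]) (auto simp: supp_def)

lemma supp_restr: "supp (restr E x) = supp x \<inter> E"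
  by (auto simp: supp_def restr_def)

lemma c00_restr: "c00 x \<Longrightarrow> c00 (restr E x)"
  by (simp add: c00_supp supp_restr)

lemma ev_restr:
  assumes "c00 x"
  shows "ev f (restr E x) = ev (restr E f) x"
proof -
  have "finite (supp x)" using assms by (simp add: c00_supp)
  then have "ev f (restr E x) = (\<Sum>i\<in>supp x. f i * \<bar>restr E x i\<bar>)"
    by (rule ev_superset) (simp add: supp_restr)
  also have "\<dots> = ev (restr E f) x"
    unfolding ev_def by (rule sum.cong) (auto simp: restr_def)
  finally show ?thesis .
qed

lemma ev_node: "ev (\<lambda>i. t * (\<Sum>(E, g)\<leftarrow>egs. g i)) x = t * (\<Sum>(E, g)\<leftarrow>egs. ev g x)"
proof -
  have "(\<Sum>(E, g)\<leftarrow>egs. ev g x) = (\<Sum>i\<in>supp x. (\<Sum>(E, g)\<leftarrow>egs. g i) * \<bar>x i\<bar>)"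
    by (induction egs) (auto simp: ev_def sum.distrib algebra_simps)
  then show ?thesis by (simp add: ev_def sum_distrib_left mult.assoc)
qed

lemma ev_scale: "0 \<le> c \<Longrightarrow> ev f (\<lambda>i. c * x i) = c * ev f x"
  by (cases "c = 0") (simp_all add: ev_def supp_def abs_mult sum_distrib_left mult.left_commute)

lemma c00_sum:
  assumes "finite K" "\<And>k. k \<in> K \<Longrightarrow> c00 (x k)"
  shows "c00 (\<lambda>i. \<Sum>k\<in>K. a k * x k i)"
proof -
  have "supp (\<lambda>i. \<Sum>k\<in>K. a k * x k i) \<subseteq> (\<Union>k\<in>K. supp (x k))"
  proof
    fix i assume "i \<in> supp (\<lambda>i. \<Sum>k\<in>K. a k * x k i)"
    then have "(\<Sum>k\<in>K. a k * x k i) \<noteq> 0" by (simp add: supp_def)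
    then obtain k where "k \<in> K" "a k * x k i \<noteq> 0" by (meson sum.neutral)
    then show "i \<in> (\<Union>k\<in>K. supp (x k))" by (auto simp: supp_def)
  qed
  moreover have "finite (\<Union>k\<in>K. supp (x k))" using assms by (simp add: c00_supp)
  ultimately show ?thesis unfolding c00_supp by (rule finite_subset)
qed

lemma restr_id: "supp g \<subseteq> E \<Longrightarrow> restr E g = g"
  by (auto simp: restr_def supp_def fun_eq_iff)

abbreviation before :: "nat set \<Rightarrow> nat set \<Rightarrow> bool" where
  "before \<equiv> \<lambda>A B. \<forall>a\<in>A. \<forall>b\<in>B. a < b"

lemma sum_list_map_eq_0: "(\<And>p. p \<in> set xs \<Longrightarrow> h p = (0::real)) \<Longrightarrow> (\<Sum>p\<leftarrow>xs. h p) = 0"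
  by (induction xs) auto

text \<open>At most one summand is nonzero: a nonzero one has \<open>i\<close> in its set, and the
  sets are successive.\<close>

lemma sum_list_disjoint_le:
  assumes "sorted_wrt before (map S ps)" "0 \<le> (K :: real)"
    "\<And>p. p \<in> set ps \<Longrightarrow> h p \<noteq> 0 \<Longrightarrow> (i :: nat) \<in> S p" "\<And>p. p \<in> set ps \<Longrightarrow> h p \<le> K"
  shows "(\<Sum>p\<leftarrow>ps. h p) \<le> K"
  using assms
proof (induction ps)
  case (Cons p ps)
  show ?case
  proof (cases "h p = 0")
    case False
    then have "i \<in> S p" using Cons.prems by simp
    have "h q = 0" if "q \<in> set ps" for q
    proof (rule ccontr)
      assume "h q \<noteq> 0"
      then have "i \<in> S q" using Cons.prems(3)[of q] that by simp
      then show False using Cons.prems(1) that \<open>i \<in> S p\<close> by auto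
    qed
    then have "(\<Sum>p\<leftarrow>ps. h p) = 0" by (rule sum_list_map_eq_0)
    then show ?thesis using Cons.prems(4)[of p] by simp
  qed (use Cons in simp)
qed simp

lemma sum_list_disjoint_le_1:
  assumes "sorted_wrt before (map fst egs)"
    "\<forall>(E, g)\<in>set egs. supp g \<subseteq> E \<and> 0 \<le> g i \<and> g i \<le> 1"
  shows "0 \<le> (\<Sum>(E, g)\<leftarrow>egs. g i) \<and> (\<Sum>(E, g)\<leftarrow>egs. g i) \<le> (1 :: real)"
proof
  show "0 \<le> (\<Sum>(E, g)\<leftarrow>egs. g i)" using assms(2) by (intro sum_list_nonneg) auto
  have *: "supp (snd p) \<subseteq> fst p \<and> snd p i \<le> 1" if "p \<in> set egs" for p
    using bspec[OF assms(2) that] by (simp add: case_prod_unfold)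
  show "(\<Sum>(E, g)\<leftarrow>egs. g i) \<le> 1"
    unfolding case_prod_unfold
  proof (rule sum_list_disjoint_le[OF assms(1), where i = i])
    show "i \<in> fst p" if "p \<in> set egs" "snd p i \<noteq> 0" for p
      using *[OF that(1)] that(2) by (auto simp: supp_def)
  qed (use * in auto)
qed

section \<open>The norm as a supremum over norming functionals\<close>

locale mixed_tsirelson =
  fixes \<theta> :: "nat \<Rightarrow> real" and Fs :: "nat \<Rightarrow> nat set set"
  assumes theta_pos: "0 < \<theta> n" and theta_le: "\<theta> n \<le> \<theta> 0" and theta0: "\<theta> 0 < 1"
    and theta_null: "\<theta> \<longlonglongrightarrow> 0"
begin

lemma theta_lt_1: "\<theta> n < 1"
  using theta_le[of n] theta0 by linarith

lemma norming_bounds: "norming \<theta> Fs f \<Longrightarrow> 0 \<le> f i \<and> f i \<le> 1"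
proof (induction rule: norming.induct)
  case (norming_node n egs)
  have "0 \<le> (\<Sum>(E, g)\<leftarrow>egs. g i) \<and> (\<Sum>(E, g)\<leftarrow>egs. g i) \<le> 1"
    using norming_node by (intro sum_list_disjoint_le_1) (auto simp: admissible_def)
  then show ?case using theta_pos[of n] theta_lt_1[of n] by (simp add: mult_le_one)
qed auto

lemma finite_supp_norming: "norming \<theta> Fs f \<Longrightarrow> finite (supp f)"
proof (induction rule: norming.induct)
  case (norming_unit j)
  show ?case by (rule finite_subset[of _ "{j}"]) (auto simp: supp_def)
next
  case (norming_node n egs)
  have "supp (\<lambda>i. \<theta> n * (\<Sum>(E, g)\<leftarrow>egs. g i)) \<subseteq> (\<Union>(E, g)\<in>set egs. supp g)"
  proof
    fix i assume "i \<in> supp (\<lambda>i. \<theta> n * (\<Sum>(E, g)\<leftarrow>egs. g i))"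
    then have "(\<Sum>(E, g)\<leftarrow>egs. g i) \<noteq> 0" by (simp add: supp_def)
    then have "\<exists>(E, g)\<in>set egs. g i \<noteq> 0" by (induction egs) auto
    then show "i \<in> (\<Union>(E, g)\<in>set egs. supp g)" by (auto simp: supp_def)
  qed
  moreover have "finite (\<Union>(E, g)\<in>set egs. supp g)" using norming_node by auto
  ultimately show ?case by (rule finite_subset)
qed (simp add: supp_def)

lemma norming_restr: "norming \<theta> Fs f \<Longrightarrow> norming \<theta> Fs (restr A f)"
proof (induction rule: norming.induct)
  case norming_zero
  show ?case using norming.norming_zero by (simp add: restr_def)
next
  case (norming_unit j)
  have "restr A (\<lambda>i. if i = j then 1 else 0) = (if j \<in> A then (\<lambda>i. if i = j then 1 else 0) else (\<lambda>i. 0))"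
    by (auto simp: restr_def fun_eq_iff)
  then show ?case using norming.norming_zero norming.norming_unit by simp
next
  case (norming_node n egs)
  define egs' where "egs' = map (\<lambda>p. (fst p, restr A (snd p))) egs"
  have "map fst egs' = map fst egs" by (simp add: egs'_def)
  moreover have "\<forall>(E, g)\<in>set egs'. norming \<theta> Fs g \<and> supp g \<subseteq> E"
    using norming_node(2) by (fastforce simp: egs'_def supp_restr)
  ultimately have "norming \<theta> Fs (\<lambda>i. \<theta> n * (\<Sum>(E, g)\<leftarrow>egs'. g i))"
    using norming_node(1) by (intro norming.norming_node) simp_all
  moreover have "(\<Sum>(E, g)\<leftarrow>egs'. g i) = (if i \<in> A then \<Sum>(E, g)\<leftarrow>egs. g i else 0)" for i
    unfolding egs'_def by (induction egs) (auto simp: restr_def)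
  ultimately show ?case by (simp add: restr_def if_distrib cong: if_cong)
qed

lemma ev_le_l1: "norming \<theta> Fs f \<Longrightarrow> ev f x \<le> (\<Sum>i\<in>supp x. \<bar>x i\<bar>)"
  unfolding ev_def using norming_bounds[of f] by (intro sum_mono) (simp add: mult_left_le_one_le)

lemma ev_nonneg: "norming \<theta> Fs f \<Longrightarrow> 0 \<le> ev f x"
  unfolding ev_def using norming_bounds[of f] by (intro sum_nonneg) simp

definition Tn :: "(nat \<Rightarrow> real) \<Rightarrow> real" where
  "Tn x = (if c00 x then Sup {ev f x | f. norming \<theta> Fs f} else 0)"

lemma ev_le_Tn:
  assumes "c00 x" "norming \<theta> Fs f"
  shows "ev f x \<le> Tn x"
proof -
  have "bdd_above {ev f x | f. norming \<theta> Fs f}"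
    using ev_le_l1 by (auto intro!: bdd_aboveI)
  then show ?thesis using assms by (auto simp: Tn_def intro!: cSup_upper)
qed

lemma Tn_le:
  assumes "c00 x" "\<And>f. norming \<theta> Fs f \<Longrightarrow> ev f x \<le> u"
  shows "Tn x \<le> u"
  using assms norming.norming_zero[of \<theta> Fs] by (auto simp: Tn_def intro!: cSup_least)

lemma Tn_approx:
  assumes "c00 x" "0 < e"
  shows "\<exists>f. norming \<theta> Fs f \<and> Tn x < ev f x + e"
proof (rule ccontr)
  assume "\<not> ?thesis"
  then have "Tn x \<le> Tn x - e" by (intro Tn_le[OF assms(1)]) force
  then show False using assms(2) by simp
qed

lemma ev_unit: "c00 x \<Longrightarrow> ev (\<lambda>i. if i = j then 1 else 0) x = \<bar>x j\<bar>"
  unfolding c00_supp ev_def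
    by (simp add: if_distrib sum.If_cases if_distribR cong: if_cong) (auto simp: supp_def)

text \<open>Nearly optimal functionals for the parts \<open>restr E x\<close>, restricted to the
  sets \<open>E\<close>, become the children of a single node; the total error \<open>e\<close> is
  spread evenly over the parts.\<close>

lemma Tn_node_le:
  assumes x: "c00 x" and adm: "admissible (Fs n) Es"
  shows "\<theta> n * (\<Sum>E\<leftarrow>Es. Tn (restr E x)) \<le> Tn x"
proof (rule field_le_epsilon)
  fix e :: real assume e: "0 < e"
  define e' where "e' = e / (real (length Es) + 1)"
  have e': "0 < e'" "real (length Es) * e' \<le> e" using e by (auto simp: e'_def field_simps)
  obtain G where G: "\<And>E. norming \<theta> Fs (G E)" "\<And>E. Tn (restr E x) < ev (G E) (restr E x) + e'"
    using Tn_approx[OF c00_restr[OF x] e'(1)] by metis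
  define egs where "egs = map (\<lambda>E. (E, restr E (G E))) Es"
  have "map fst egs = Es" by (simp add: egs_def comp_def)
  then have "norming \<theta> Fs (\<lambda>i. \<theta> n * (\<Sum>(E, g)\<leftarrow>egs. g i))"
    using adm G norming_restr by (intro norming.norming_node) (auto simp: egs_def supp_restr)
  from ev_le_Tn[OF x this] have "\<theta> n * (\<Sum>E\<leftarrow>Es. ev (G E) (restr E x)) \<le> Tn x"
    unfolding ev_node by (simp add: egs_def ev_restr[OF x] comp_def)
  moreover have "(\<Sum>E\<leftarrow>Es. Tn (restr E x)) \<le> (\<Sum>E\<leftarrow>Es. ev (G E) (restr E x)) + real (length Es) * e'"
  proof (induction Es)
    case (Cons E Es)
    then show ?case using less_imp_le[OF G(2)[of E]] by (simp add: algebra_simps)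
  qed simp
  then have "\<theta> n * (\<Sum>E\<leftarrow>Es. Tn (restr E x)) \<le> \<theta> n * (\<Sum>E\<leftarrow>Es. ev (G E) (restr E x)) + \<theta> n * e"
    using e'(2) theta_pos[of n] by (simp flip: distrib_left)
  moreover have "\<theta> n * e \<le> e" using theta_lt_1[of n] e by simp
  ultimately show "\<theta> n * (\<Sum>E\<leftarrow>Es. Tn (restr E x)) \<le> Tn x + e" by linarith
qed

lemma is_T_norm_Tn: "is_T_norm \<theta> Fs Tn"
  unfolding is_T_norm_def
proof (intro conjI allI impI ballI)
  show "Tn x = 0" if "\<not> c00 x" for x using that by (simp add: Tn_def)
next
  fix x v assume x: "c00 x" "v \<in> norm_set \<theta> Fs Tn x"
  then consider i where "v = \<bar>x i\<bar>" | n Es where "v = \<theta> n * (\<Sum>E\<leftarrow>Es. Tn (restr E x))" "admissible (Fs n) Es"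
    by (auto simp: norm_set_def)
  then show "v \<le> Tn x"
  proof cases
    case (1 i)
    then show ?thesis using ev_le_Tn[OF x(1) norming.norming_unit[of \<theta> Fs i]] ev_unit[OF x(1)]
      by simp
  next
    case 2
    then show ?thesis using Tn_node_le[OF x(1)] by simp
  qed
next
  fix x u assume x: "c00 x" and u: "\<forall>v\<in>norm_set \<theta> Fs Tn x. v \<le> u"
  have ui: "\<bar>x i\<bar> \<le> u" for i using u by (simp add: norm_set_def)
  show "Tn x \<le> u"
  proof (rule Tn_le[OF x])
    fix f assume "norming \<theta> Fs f"
    then show "ev f x \<le> u"
    proof cases
      case norming_zero
      then show ?thesis using ui[of 0] by (simp add: ev_def)
    next
      case (norming_unit j)
      then show ?thesis using ui ev_unit[OF x] by simp
    next
      case (norming_node n egs)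
      have "(\<Sum>(E, g)\<leftarrow>egs. ev g x) \<le> (\<Sum>E\<leftarrow>map fst egs. Tn (restr E x))"
        using norming_node(3)
      proof (induction egs)
        case (Cons p egs)
        obtain E g where p: "p = (E, g)" by force
        then have "ev g x = ev g (restr E x)"
          using Cons.prems by (simp add: ev_restr[OF x] restr_id)
        also have "\<dots> \<le> Tn (restr E x)" using Cons.prems p by (intro ev_le_Tn c00_restr x) simp
        finally show ?case using Cons p by simp
      qed simp
      then have "ev f x \<le> \<theta> n * (\<Sum>E\<leftarrow>map fst egs. Tn (restr E x))"
        unfolding norming_node(1) ev_node using theta_pos[of n] by simp
      also have "\<dots> \<le> u" using u norming_node(2) unfolding norm_set_def by blast
      finally show ?thesis .
    qed
  qed
qed

end

section \<open>Uniqueness of the implicit norm and the completion\<close>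

locale mixed_tsirelson_nontrivial = mixed_tsirelson +
  assumes large: "\<exists>n Es. admissible (Fs n) Es \<and> 1 < \<theta> n * real (length Es)"
begin

lemma T_norm_ge_coord: "is_T_norm \<theta> Fs N \<Longrightarrow> c00 x \<Longrightarrow> \<bar>x i\<bar> \<le> N x"
  unfolding is_T_norm_def norm_set_def by blast

lemma T_norm_node: "is_T_norm \<theta> Fs N \<Longrightarrow> c00 x \<Longrightarrow> admissible (Fs n) Es \<Longrightarrow>
    \<theta> n * (\<Sum>E\<leftarrow>Es. N (restr E x)) \<le> N x"
  unfolding is_T_norm_def norm_set_def by blast

text \<open>The assumption \<open>large\<close> supplies an admissible sequence with factor above 1;
  a positive value at the zero vector would then exceed itself. The comparison of two solutions
  starts from this value.\<close>

lemma T_norm_zero: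
  assumes N: "is_T_norm \<theta> Fs N"
  shows "N (\<lambda>i. 0) = 0"
proof -
  obtain n Es where n: "admissible (Fs n) Es" "1 < \<theta> n * real (length Es)" using large by blast
  have z: "c00 (\<lambda>i. 0)" by (simp add: c00_def)
  have "restr E (\<lambda>i. 0) = (\<lambda>i. 0)" for E by (simp add: restr_def)
  with T_norm_node[OF N z n(1)] have "\<theta> n * real (length Es) * N (\<lambda>i. 0) \<le> N (\<lambda>i. 0)"
    by (simp only: sum_list_triv mult.assoc)
  moreover have "0 \<le> N (\<lambda>i. 0)" using T_norm_ge_coord[OF N z] by simp
  moreover have "N (\<lambda>i. 0) < \<theta> n * real (length Es) * N (\<lambda>i. 0)" if "0 < N (\<lambda>i. 0)"
    using mult_strict_right_mono[OF n(2) that] by simp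
  ultimately show ?thesis by fastforce
qed

text \<open>Induction on the size of the support. If one set of an admissible sequence contains the
  whole support, the others contribute the value at 0, and the term is at most
  \<open>\<theta> 0 * N x\<close>, strictly less than a positive \<open>N x\<close>. In all other
  terms only vectors of smaller support occur.\<close>

lemma T_norm_le:
  assumes N: "is_T_norm \<theta> Fs N" and N': "is_T_norm \<theta> Fs N'"
  shows "c00 x \<Longrightarrow> N x \<le> N' x"
proof (induction "card (supp x)" arbitrary: x rule: less_induct)
  case less
  note x = \<open>c00 x\<close>
  show ?case
  proof (rule ccontr)
    assume neg: "\<not> N x \<le> N' x"
    have "v \<le> max (N' x) (\<theta> 0 * N x)" if "v \<in> norm_set \<theta> Fs N x" for v
    proof -
      from that consider i where "v = \<bar>x i\<bar>"
        | n Es where "v = \<theta> n * (\<Sum>E\<leftarrow>Es. N (restr E x))" "admissible (Fs n) Es"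
        by (auto simp: norm_set_def)
      then show ?thesis
      proof cases
        case (1 i)
        then show ?thesis using T_norm_ge_coord[OF N' x, of i] by simp
      next
        case (2 n Es)
        show ?thesis
        proof (cases "\<exists>E\<in>set Es. supp x \<subseteq> E")
          case True
          then obtain as E bs where E: "Es = as @ E # bs" "supp x \<subseteq> E" by (metis split_list)
          have "restr E' x = (\<lambda>i. 0)" if "E' \<in> set as \<union> set bs" for E'
          proof
            fix i
            have "i \<notin> E' \<or> i \<notin> E"
              using that 2(2) unfolding E(1) admissible_def by (force simp: sorted_wrt_append)
            then show "restr E' x i = 0" using E(2) by (auto simp: restr_def supp_def)
          qed
          then have "(\<Sum>E\<leftarrow>as. N (restr E x)) = 0" "(\<Sum>E\<leftarrow>bs. N (restr E x)) = 0"
            using T_norm_zero[OF N] by (auto intro!: sum_list_map_eq_0)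
          then have "v = \<theta> n * N x" using 2(1) E by (simp add: restr_id)
          also have "\<dots> \<le> \<theta> 0 * N x"
            using theta_le[of n] T_norm_ge_coord[OF N x, of 0] by (intro mult_right_mono) auto
          finally show ?thesis by simp
        next
          case False
          have "N (restr E x) \<le> N' (restr E x)" if "E \<in> set Es" for E
          proof (rule less(1))
            have "supp x \<inter> E \<subset> supp x" using False that by blast
            then show "card (supp (restr E x)) < card (supp x)"
              unfolding supp_restr using x by (intro psubset_card_mono) (auto simp: c00_supp)
          qed (rule c00_restr[OF x])
          then have "(\<Sum>E\<leftarrow>Es. N (restr E x)) \<le> (\<Sum>E\<leftarrow>Es. N' (restr E x))"
            by (intro sum_list_mono) auto
          then have "v \<le> \<theta> n * (\<Sum>E\<leftarrow>Es. N' (restr E x))" using 2(1) theta_pos[of n] by simp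
          also have "\<dots> \<le> N' x" by (rule T_norm_node[OF N' x 2(2)])
          finally show ?thesis by simp
        qed
      qed
    qed
    then have "N x \<le> max (N' x) (\<theta> 0 * N x)" using N x unfolding is_T_norm_def by blast
    then have "N x \<le> \<theta> 0 * N x" using neg by auto
    moreover have "0 < N x" using neg T_norm_ge_coord[OF N' x, of 0] by linarith
    ultimately show False using theta0 by simp
  qed
qed

lemma tnorm_eq: "tnorm \<theta> Fs = Tn"
  unfolding tnorm_def
proof (rule the_equality[where P = "is_T_norm \<theta> Fs", OF is_T_norm_Tn])
  fix N assume N: "is_T_norm \<theta> Fs N"
  show "N = Tn"
  proof
    fix x
    show "N x = Tn x"
    proof (cases "c00 x")
      case True
      then show ?thesis
        using T_norm_le[OF N is_T_norm_Tn] T_norm_le[OF is_T_norm_Tn N] by (simp add: antisym)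
    next
      case False
      then show ?thesis using N is_T_norm_Tn unfolding is_T_norm_def by metis
    qed
  qed
qed

lemma c00_trunc_eq:
  assumes "c00 x"
  shows "\<exists>m0. \<forall>m\<ge>m0. trunc m x = x"
proof -
  obtain k where k: "\<forall>i\<in>supp x. i < k"
    using assms unfolding c00_supp finite_nat_set_iff_bounded by blast
  have "trunc m x = x" if "k \<le> m" for m
    unfolding trunc_def using that k by (intro restr_id) force
  then show ?thesis by blast
qed

lemma xnorm_c00:
  assumes "c00 x"
  shows "xnorm \<theta> Fs x = Tn x"
proof -
  obtain m0 where "\<forall>m\<ge>m0. trunc m x = x" using c00_trunc_eq[OF assms] by blast
  then have "(\<lambda>n. tnorm \<theta> Fs (trunc n x)) \<longlonglongrightarrow> Tn x"
    by (intro tendsto_eventually eventually_sequentiallyI[of m0]) (simp add: tnorm_eq)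
  then show ?thesis unfolding xnorm_def by (rule limI)
qed

lemma inX_c00:
  assumes "c00 x"
  shows "inX \<theta> Fs x"
proof -
  obtain m0 where "\<forall>m\<ge>m0. trunc m x = x" using c00_trunc_eq[OF assms] by blast
  then show ?thesis
    unfolding inX_def using T_norm_zero[OF is_T_norm_Tn]
      by (auto intro!: exI[of _ m0] simp: tnorm_eq)
qed

lemma closed_span_c00:
  assumes "c00 x" "supp x \<subseteq> M"
  shows "x \<in> closed_span \<theta> Fs M"
proof -
  have "xnorm \<theta> Fs (\<lambda>i. x i - x i) = 0"
    using xnorm_c00[of "\<lambda>i. 0"] T_norm_zero[OF is_T_norm_Tn] by (simp add: c00_def)
  then show ?thesis
    using assms inX_c00 unfolding closed_span_def supp_def by (auto intro!: exI[of _ x])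
qed

lemma Tn_scale:
  assumes x: "c00 x" and c: "0 < c"
  shows "Tn (\<lambda>i. c * x i) = c * Tn x"
proof (rule antisym)
  have cx: "c00 (\<lambda>i. c * x i)" using x c by (simp add: c00_def)
  show "Tn (\<lambda>i. c * x i) \<le> c * Tn x"
    using c ev_le_Tn[OF x] by (intro Tn_le[OF cx]) (simp add: ev_scale)
  have "Tn x \<le> Tn (\<lambda>i. c * x i) / c"
  proof (rule Tn_le[OF x])
    fix f assume "norming \<theta> Fs f"
    from ev_le_Tn[OF cx this] show "ev f x \<le> Tn (\<lambda>i. c * x i) / c"
      using c by (simp add: ev_scale field_simps)
  qed
  then show "c * Tn x \<le> Tn (\<lambda>i. c * x i)" using c by (simp add: field_simps)
qed

lemma Tn_lower:
  assumes x: "c00 x" and A: "A \<in> Fs n" "finite A"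
  shows "\<theta> n * (\<Sum>i\<in>A. \<bar>x i\<bar>) \<le> Tn x"
proof -
  define L where "L = sorted_list_of_set A"
  define egs where "egs = map (\<lambda>j::nat. ({j}, \<lambda>i. if i = j then 1 else (0::real))) L"
  have L: "set L = A" "sorted_wrt (<) L" "distinct L" using A by (auto simp: L_def)
  have "map fst egs = map (\<lambda>j. {j}) L" by (simp add: egs_def comp_def)
  then have "admissible (Fs n) (map fst egs)"
    using A L by (simp add: admissible_def sorted_wrt_map comp_def)
  then have "norming \<theta> Fs (\<lambda>i. \<theta> n * (\<Sum>(E, g)\<leftarrow>egs. g i))"
    by (rule norming.norming_node) (auto simp: egs_def supp_def norming.norming_unit)
  from ev_le_Tn[OF x this] have "\<theta> n * (\<Sum>(E, g)\<leftarrow>egs. ev g x) \<le> Tn x" unfolding ev_node .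
  moreover have "(\<Sum>(E, g)\<leftarrow>egs. ev g x) = (\<Sum>j\<leftarrow>L. \<bar>x j\<bar>)"
    unfolding egs_def by (simp add: comp_def ev_unit[OF x])
  moreover have "\<dots> = (\<Sum>i\<in>A. \<bar>x i\<bar>)" using L by (simp add: sum_list_distinct_conv_sum_set)
  ultimately show ?thesis by simp
qed

end

section \<open>Cutting functionals by weight\<close>

lemma sorted_wrt_dichotomy:
  assumes "sorted_wrt R xs" "p \<in> set xs" "q \<in> set xs"
  shows "p = q \<or> R p q \<or> R q p"
proof -
  obtain i j where "i < length xs" "j < length xs" "p = xs ! i" "q = xs ! j"
    using assms by (metis in_set_conv_nth)
  then show ?thesis
    using assms(1) sorted_wrt_iff_nth_less[of R xs] by (metis linorder_neqE_nat)
qed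

text \<open>Each set is tagged by its minimum, so admissibility puts the set of tags into
  \<open>F\<close>. Successive sets have distinct minima, which lets \<open>P\<close> recover a set
  from its tag.\<close>

lemma comp_fam_union:
  assumes adm: "admissible F (map fst egs)"
    and M: "\<And>p. p \<in> set egs \<Longrightarrow> M p \<in> G" "\<And>p. p \<in> set egs \<Longrightarrow> M p \<subseteq> fst p"
  shows "(\<Union>p\<in>set egs. M p) \<in> comp_fam F G"
proof -
  define T where "T = set (map Min (map fst egs))"
  have fn: "finite (fst p) \<and> fst p \<noteq> {}" if "p \<in> set egs" for p
    using adm that by (auto simp: admissible_def)
  have dich: "p = q \<or> (\<forall>a\<in>fst p. \<forall>b\<in>fst q. a < b) \<or> (\<forall>a\<in>fst q. \<forall>b\<in>fst p. a < b)"
    if "p \<in> set egs" "q \<in> set egs" for p q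
    using sorted_wrt_dichotomy[of "\<lambda>x y. \<forall>a\<in>fst x. \<forall>b\<in>fst y. a < b" egs p q] adm that
    by (auto simp: admissible_def sorted_wrt_map)
  have uniq: "p = q" if "p \<in> set egs" "q \<in> set egs" "Min (fst p) = Min (fst q)" for p q
  proof -
    have "Min (fst p) \<in> fst p" "Min (fst p) \<in> fst q"
      using fn[OF that(1)] fn[OF that(2)] that(3) Min_in by metis+
    then show ?thesis using dich[OF that(1,2)] by force
  qed
  have later: "a < Min (fst q)"
      if "p \<in> set egs" "q \<in> set egs" "Min (fst p) < Min (fst q)" "a \<in> fst p" for p q a
  proof -
    have "Min (fst p) \<in> fst p" "Min (fst q) \<in> fst q" using fn that by (auto intro: Min_in)
    then show ?thesis using dich[OF that(1,2)] that(3,4) by force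
  qed
  have "\<forall>t\<in>T. \<exists>p. p \<in> set egs \<and> Min (fst p) = t" by (auto simp: T_def)
  from bchoice[OF this] obtain P where P: "\<And>t. t \<in> T \<Longrightarrow> P t \<in> set egs \<and> Min (fst (P t)) = t"
    by blast
  have Pmin: "P (Min (fst p)) = p" "Min (fst p) \<in> T" if "p \<in> set egs" for p
  proof -
    show "Min (fst p) \<in> T" using that by (simp add: T_def)
    from P[OF this] show "P (Min (fst p)) = p" by (intro uniq that) simp_all
  qed
  have "M p \<subseteq> (\<Union>t\<in>T. M (P t))" if "p \<in> set egs" for p
    using Pmin[OF that]
      by (intro UN_upper[of "Min (fst p)" T "\<lambda>t. M (P t)", THEN order_trans[rotated]]) simp_all
  moreover have "M (P t) \<subseteq> (\<Union>p\<in>set egs. M p)" if "t \<in> T" for t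
    using P[OF that] by blast
  ultimately have eq: "(\<Union>p\<in>set egs. M p) = (\<Union>t\<in>T. M (P t))" by (intro antisym UN_least)
  show ?thesis
    unfolding comp_fam_def
  proof (intro CollectI bexI[of _ T] conjI exI[of _ "\<lambda>t. M (P t)"] ballI impI)
    show "T \<in> F" using adm by (simp add: T_def admissible_def)
    show "finite T" by (simp add: T_def)
    show "(\<Union>p\<in>set egs. M p) = (\<Union>t\<in>T. M (P t))" by (rule eq)
    fix t assume t: "t \<in> T"
    note Pt = P[OF t]
    show "M (P t) \<in> G" using Pt M(1) by simp
    show "M (P t) \<subseteq> {t..}"
    proof
      fix x assume "x \<in> M (P t)"
      then have "x \<in> fst (P t)" using M(2) Pt by blast
      then show "x \<in> {t..}" using Pt fn[of "P t"] Min_le[of "fst (P t)" x] by simp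
    qed
    show "M (P t) \<subseteq> {..<t'}" if "t' \<in> T" "t < t'" for t'
    proof
      fix x assume "x \<in> M (P t)"
      then have "x \<in> fst (P t)" using M(2) Pt by blast
      then show "x \<in> {..<t'}" using later[of "P t" "P t'" x] Pt P[OF that(1)] that(2) by simp
    qed
  qed
qed

definition sing :: "nat set set" where
  "sing = {A. \<exists>i. A \<subseteq> {i}}"

lemma rk_lt_sing: "rk_lt (BS (BS BZ)) sing"
proof -
  have "tails {m} (tails {n} sing) = {}" for m n
    by (force simp: tails_def sing_def)
  then show ?thesis by simp
qed

text \<open>A flag, a weight and a norming functional.\<close>
type_synonym piece = "bool \<times> real \<times> (nat \<Rightarrow> real)"

abbreviation fn :: "piece \<Rightarrow> nat \<Rightarrow> real" where "fn p \<equiv> snd (snd p)"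
abbreviation wt :: "piece \<Rightarrow> real" where "wt p \<equiv> fst (snd p)"

definition mins :: "piece list \<Rightarrow> nat set" where
  "mins ps = (\<lambda>p. Min (supp (fn p))) ` set ps"

lemma mins_concat: "mins (concat (map Ps egs)) = (\<Union>p\<in>set egs. mins (Ps p))"
  by (auto simp: mins_def)

lemma sorted_concat:
  assumes "sorted_wrt before (map fst egs)"
    "\<And>p. p \<in> set egs \<Longrightarrow> sorted_wrt before (map S (Ps p))"
    "\<And>p q. p \<in> set egs \<Longrightarrow> q \<in> set (Ps p) \<Longrightarrow> S q \<subseteq> fst p"
  shows "sorted_wrt before (map S (concat (map Ps egs)))"
  using assms
proof (induction egs)
  case (Cons p egs)
  have "a < b"
      if "q \<in> set (Ps p)" "p' \<in> set egs" "q' \<in> set (Ps p')" "a \<in> S q" "b \<in> S q'" for q p' q' a b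
    using Cons.prems(1) Cons.prems(3)[of p q] Cons.prems(3)[of p' q'] that by auto blast
  then show ?case using Cons by (auto simp: sorted_wrt_append)
qed simp

section \<open>Cutting a functional into pieces\<close>

context mixed_tsirelson
begin

text \<open>Contains the sets of first points of the pieces obtained when a functional of current
  weight \<open>v\<close> is cut at weight \<open>\<mu>\<close>, going down at most \<open>d\<close>
  nodes. The summand \<open>sing\<close> stands for a branch that ends here with at most one
  piece.\<close>

primrec fam :: "real \<Rightarrow> nat \<Rightarrow> real \<Rightarrow> nat set set" where
  "fam \<mu> 0 v = sing"
| "fam \<mu> (Suc d) v = sing \<union> (\<Union>n\<in>{n. \<mu> < v * \<theta> n}. comp_fam (Fs n) (fam \<mu> d (v * \<theta> n)))"

lemma sing_fam: "A \<in> sing \<Longrightarrow> A \<in> fam \<mu> d v"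
  by (cases d) auto

lemma finite_large_theta:
  assumes "0 < \<mu>" "0 < v"
  shows "finite {n. \<mu> < v * \<theta> n}"
proof -
  have "(\<lambda>n. v * \<theta> n) \<longlonglongrightarrow> v * 0" by (intro tendsto_mult_left theta_null)
  then have "eventually (\<lambda>n. v * \<theta> n < \<mu>) sequentially"
    using assms by (intro order_tendstoD) auto
  then obtain n0 where n0: "\<And>n. n \<ge> n0 \<Longrightarrow> v * \<theta> n < \<mu>" by (auto simp: eventually_sequentially)
  have "{n. \<mu> < v * \<theta> n} \<subseteq> {..<n0}"
  proof
    fix n assume "n \<in> {n. \<mu> < v * \<theta> n}"
    then show "n \<in> {..<n0}" using n0[of n] by (cases "n0 \<le> n") auto
  qed
  then show ?thesis by (rule finite_subset) simp
qed

text \<open>Since \<open>\<theta>\<close> is null, only finitely many \<open>n\<close> keep the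
  weight above \<open>\<mu>\<close>, so one of finitely many ordinals dominates the union. It is the
  product of the indices along a branch of weight above \<open>\<mu>\<close>; the leading exponents
  of such products are what \<open>gamma\<close> maximises.\<close>

lemma rk_lt_fam:
  assumes alpha: "\<And>n. rk_lt (BS (alpha n)) (Fs n)" and \<mu>: "0 < \<mu>"
  shows "\<mu> < v \<Longrightarrow> \<exists>ns. \<mu> < v * prod_list (map \<theta> ns) \<and> rk_lt (BS (oprodl alpha ns)) (fam \<mu> d v)"
proof (induction d arbitrary: v)
  case 0
  then show ?case by (intro exI[of _ "[]"]) (use rk_lt_sing in simp)
next
  case (Suc d)
  define I where "I = {n. \<mu> < v * \<theta> n}"
  have I: "finite I" unfolding I_def using Suc.prems \<mu> by (intro finite_large_theta) auto
  have "\<forall>n\<in>I. \<exists>ns. \<mu> < v * \<theta> n * prod_list (map \<theta> ns) \<and>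
      rk_lt (BS (oprodl alpha ns)) (fam \<mu> d (v * \<theta> n))"
    using Suc.IH by (simp add: I_def)
  from bchoice[OF this] obtain ns where ns: "\<And>n. n \<in> I \<Longrightarrow> \<mu> < v * \<theta> n * prod_list (map \<theta> (ns n))"
    "\<And>n. n \<in> I \<Longrightarrow> rk_lt (BS (oprodl alpha (ns n))) (fam \<mu> d (v * \<theta> n))"
    by blast
  define L where "L = insert [] ((\<lambda>n. n # ns n) ` I)"
  obtain l where l: "l \<in> L" "\<And>k. k \<in> L \<Longrightarrow> ole (oprodl alpha k) (oprodl alpha l)"
  proof -
    have "finite (oprodl alpha ` L)" "oprodl alpha ` L \<noteq> {}" using I by (auto simp: L_def)
    from finite_omax[OF this] that show ?thesis by blast
  qed
  have le: "ole (BS (oprodl alpha k)) (BS (oprodl alpha l))" if "k \<in> L" for k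
    using l(2)[OF that] by simp
  have "rk_lt (BS (oprodl alpha l)) (fam \<mu> (Suc d) v)"
    unfolding fam.simps
  proof (intro rk_lt_Un rk_lt_UN)
    show "rk_lt (BS (oprodl alpha l)) sing"
      by (rule rk_lt_mono[OF le[of "[]"]]) (use rk_lt_sing in \<open>auto simp: L_def\<close>)
    fix n assume n: "n \<in> {n. \<mu> < v * \<theta> n}"
    then have "rk_lt (BS (oprodl alpha (n # ns n))) (comp_fam (Fs n) (fam \<mu> d (v * \<theta> n)))"
      unfolding oprodl.simps by (intro rk_lt_comp alpha ns) (simp add: I_def)
    moreover have "n # ns n \<in> L" using n by (simp add: L_def I_def)
    ultimately show "rk_lt (BS (oprodl alpha l)) (comp_fam (Fs n) (fam \<mu> d (v * \<theta> n)))"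
      using rk_lt_mono[OF le] by blast
  qed (use I in \<open>simp add: I_def\<close>)
  moreover have "\<mu> < v * prod_list (map \<theta> l)"
    using l(1) ns(1) Suc.prems by (auto simp: L_def mult.assoc)
  ultimately show ?case by blast
qed

text \<open>The exception at the minimum of the support is made for coordinate functionals, whose
  only large value sits there. Thus a flagged piece can be large at a point only if its support
  starts at that point.\<close>

definition good_piece :: "real \<Rightarrow> real \<Rightarrow> piece \<Rightarrow> bool" where
  "good_piece \<eta> lam p \<longleftrightarrow> norming \<theta> Fs (fn p) \<and> supp (fn p) \<noteq> {} \<and> 0 \<le> wt p \<and> wt p \<le> 1
     \<and> (fst p \<longrightarrow> (\<forall>i. i \<noteq> Min (supp (fn p)) \<longrightarrow> wt p * fn p i \<le> \<eta>))
     \<and> (\<not> fst p \<longrightarrow> wt p \<le> lam)"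

definition pieces :: "real \<Rightarrow> real \<Rightarrow> real \<Rightarrow> (nat \<Rightarrow> real) \<Rightarrow> piece list \<Rightarrow> bool" where
  "pieces \<eta> lam v f ps \<longleftrightarrow> (\<forall>i. v * f i = (\<Sum>p\<leftarrow>ps. wt p * fn p i))
     \<and> (\<forall>p\<in>set ps. good_piece \<eta> lam p \<and> supp (fn p) \<subseteq> supp f)
     \<and> sorted_wrt before (map (\<lambda>p. supp (fn p)) ps)"

lemma piece_finite: "good_piece \<eta> lam p \<Longrightarrow> finite (supp (fn p)) \<and> supp (fn p) \<noteq> {}"
  by (simp add: good_piece_def finite_supp_norming)

lemma member_le_sum_list_map:
  "e \<in> set egs \<Longrightarrow> (\<And>e. e \<in> set egs \<Longrightarrow> 0 \<le> h e) \<Longrightarrow> h e \<le> (\<Sum>e\<leftarrow>egs. (h e :: real))"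
proof (induction egs)
  case (Cons a egs)
  have "0 \<le> (\<Sum>e\<leftarrow>egs. h e)" using Cons.prems(2) by (intro sum_list_nonneg) auto
  then show ?case using Cons by force
qed simp

lemma sum_list_concat_map:
  "(\<Sum>p\<leftarrow>concat (map Ps egs). h p) = (\<Sum>e\<leftarrow>egs. \<Sum>p\<leftarrow>Ps e. (h p :: real))"
  by (induction egs) auto

lemma mins_subset:
  "pieces \<eta> lam v f ps \<Longrightarrow> mins ps \<subseteq> supp f"
  unfolding mins_def pieces_def using piece_finite Min_in by blast

text \<open>Cutting a functional along its tree: descend while the accumulated weight exceeds
  \<open>lam\<close>. A branch ends in a coordinate, in a node whose next weight is at most \<open>\<eta>\<close>
  (both flagged True), or in a child whose weight lies between \<open>\<eta>\<close> and \<open>lam\<close>.\<close>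
lemma pieces_exist:
  assumes \<eta>: "0 < \<eta>" "\<eta> \<le> lam"
  shows "norming \<theta> Fs f \<Longrightarrow> lam < v \<Longrightarrow> v \<le> 1 \<Longrightarrow> v * \<theta> 0 ^ d \<le> lam \<Longrightarrow>
    \<exists>ps. pieces \<eta> lam v f ps \<and> mins ps \<in> fam \<eta> d v \<and> mins (filter fst ps) \<in> fam lam d v"
proof (induction d arbitrary: f v)
  \<comment> \<open>The number \<open>d\<close> bounds the depth, since every node multiplies the
    weight by at most \<open>\<theta> 0\<close>; with \<open>d = 0\<close> the two hypotheses on
    \<open>v\<close> contradict each other.\<close>
  case 0
  then show ?case by simp
next
  case (Suc d)
  have fin: "finite (supp f)" by (rule finite_supp_norming[OF Suc.prems(1)])
  have one: "\<exists>ps. pieces \<eta> lam v f ps \<and> mins ps \<in> fam \<eta> (Suc d) v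
      \<and> mins (filter fst ps) \<in> fam lam (Suc d) v"
    if "\<And>i. i \<noteq> Min (supp f) \<Longrightarrow> v * f i \<le> \<eta>"
  proof (cases "supp f = {}")
    case True
    then have "f = (\<lambda>i. 0)" by (auto simp: supp_def)
    then show ?thesis
      by (intro exI[of _ "[]"]) (auto simp: pieces_def mins_def sing_def)
  next
    case False
    then show ?thesis using that Suc.prems \<eta>
      by (intro exI[of _ "[(True, v, f)]"]) (auto simp: pieces_def good_piece_def mins_def sing_def)
  qed
  from Suc.prems(1) show ?case
  proof cases
    case norming_zero
    then show ?thesis using \<eta> by (intro one) simp
  next
    case (norming_unit j)
    then have "supp f = {j}" by (auto simp: supp_def)
    then show ?thesis using norming_unit \<eta> by (intro one) auto
  next
    case (norming_node n egs)
    have f01: "0 \<le> (\<Sum>(E, g)\<leftarrow>egs. g i) \<and> (\<Sum>(E, g)\<leftarrow>egs. g i) \<le> 1" for i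
      using norming_node norming_bounds
        by (intro sum_list_disjoint_le_1) (auto simp: admissible_def)
    have v: "0 < v" using Suc.prems \<eta> by simp
    show ?thesis
    proof (cases "v * \<theta> n \<le> \<eta>")
      case True
      have vf: "v * f i \<le> \<eta>" for i
      proof -
        have "v * f i = v * \<theta> n * (\<Sum>(E, g)\<leftarrow>egs. g i)" by (simp add: norming_node(1))
        also have "\<dots> \<le> v * \<theta> n" using f01[of i] v theta_pos[of n]
          by (intro mult_right_le_one_le) auto
        finally show ?thesis using True by simp
      qed
      show ?thesis by (rule one) (rule vf)
    next
      case False
      have gf: "supp (snd e) \<subseteq> supp f \<and> supp (snd e) \<subseteq> fst e \<and> norming \<theta> Fs (snd e)"
          if "e \<in> set egs" for e
      proof -
        have pos: "0 \<le> snd e i" if "e \<in> set egs" for e i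
          using that norming_node(3) norming_bounds[of "snd e" i] by auto
        have "snd e i \<le> (\<Sum>(E, g)\<leftarrow>egs. g i)" for i
          unfolding case_prod_unfold using that pos by (intro member_le_sum_list_map) auto
        have "f i \<noteq> 0" if "snd e i \<noteq> 0" for i
        proof -
          have "0 < (\<Sum>(E, g)\<leftarrow>egs. g i)"
            using \<open>snd e i \<le> (\<Sum>(E, g)\<leftarrow>egs. g i)\<close> pos[OF \<open>e \<in> set egs\<close>, of i] that by linarith
          then show ?thesis unfolding norming_node(1) using theta_pos[of n] by simp
        qed
        then have "supp (snd e) \<subseteq> supp f" by (auto simp: supp_def)
        then show ?thesis using bspec[OF norming_node(3) that] by (simp add: case_prod_unfold)
      qed
      \<comment> \<open>If the next weight exceeds \<open>lam\<close>, every child is cut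
        recursively. Otherwise each nonzero child becomes one unflagged piece, so no flagged minimum
        arises. This is why flagged minima lie in the family cut at \<open>lam\<close>, whereas all
        minima together need the family cut at \<open>\<eta>\<close>.\<close>
      have "\<exists>Ps. \<forall>e\<in>set egs. pieces \<eta> lam (v * \<theta> n) (snd e) (Ps e) \<and> mins (Ps e) \<in> fam \<eta> d (v * \<theta> n)
          \<and> (if lam < v * \<theta> n then mins (filter fst (Ps e)) \<in> fam lam d (v * \<theta> n) else filter fst (Ps e) = [])"
      proof (cases "lam < v * \<theta> n")
        case True
        have "\<exists>ps. pieces \<eta> lam (v * \<theta> n) (snd e) ps \<and> mins ps \<in> fam \<eta> d (v * \<theta> n)
          \<and> mins (filter fst ps) \<in> fam lam d (v * \<theta> n)" if "e \<in> set egs" for e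
        proof (rule Suc.IH)
          show "norming \<theta> Fs (snd e)" using gf that by blast
          show "v * \<theta> n \<le> 1" using v theta_lt_1[of n] theta_pos[of n] Suc.prems
            by (simp add: mult_le_one)
          have "v * \<theta> n * \<theta> 0 ^ d \<le> v * \<theta> 0 * \<theta> 0 ^ d"
            using v theta_le[of n] theta_pos[of 0] by (intro mult_right_mono mult_left_mono) auto
          then show "v * \<theta> n * \<theta> 0 ^ d \<le> lam" using Suc.prems by (simp add: mult.assoc)
        qed (rule True)
        then show ?thesis using True by (auto intro: bchoice)
      next
        case small: False
        define Ps where "Ps e = (if supp (snd e) = {} then [] else [(False, v * \<theta> n, snd e)])" for e :: "nat set \<times> (nat \<Rightarrow> real)"
        have "pieces \<eta> lam (v * \<theta> n) (snd e) (Ps e) \<and> mins (Ps e) \<in> fam \<eta> d (v * \<theta> n)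
            \<and> filter fst (Ps e) = []"
          if "e \<in> set egs" for e
        proof -
          have "v * \<theta> n \<le> 1" using v theta_lt_1[of n] theta_pos[of n] Suc.prems
            by (simp add: mult_le_one)
          then have "pieces \<eta> lam (v * \<theta> n) (snd e) (Ps e)"
            using gf[OF that] small v theta_pos[of n]
            by (auto simp: pieces_def good_piece_def Ps_def) (auto simp: supp_def)
          moreover have "mins (Ps e) \<in> sing" by (auto simp: mins_def sing_def Ps_def)
          ultimately show ?thesis using sing_fam by (simp add: Ps_def)
        qed
        then show ?thesis using small by (intro exI[of _ Ps]) simp
      qed
      then obtain Ps where Ps: "\<And>e. e \<in> set egs \<Longrightarrow> pieces \<eta> lam (v * \<theta> n) (snd e) (Ps e)"
        "\<And>e. e \<in> set egs \<Longrightarrow> mins (Ps e) \<in> fam \<eta> d (v * \<theta> n)"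
        "\<And>e. e \<in> set egs \<Longrightarrow> lam < v * \<theta> n \<Longrightarrow> mins (filter fst (Ps e)) \<in> fam lam d (v * \<theta> n)"
        "\<And>e. e \<in> set egs \<Longrightarrow> \<not> lam < v * \<theta> n \<Longrightarrow> filter fst (Ps e) = []"
        by (metis (no_types, lifting))
      define ps where "ps = concat (map Ps egs)"
      have sub: "mins (Ps e) \<subseteq> fst e" if "e \<in> set egs" for e
        using mins_subset[OF Ps(1)[OF that]] gf[OF that] by blast
      have "v * f i = (\<Sum>p\<leftarrow>ps. wt p * fn p i)" for i
      proof -
        have "v * f i = (\<Sum>e\<leftarrow>egs. v * \<theta> n * snd e i)"
          unfolding norming_node(1) by (simp add: sum_list_const_mult case_prod_unfold mult.assoc)
        also have "\<dots> = (\<Sum>e\<leftarrow>egs. \<Sum>p\<leftarrow>Ps e. wt p * fn p i)"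
          using Ps(1) by (intro arg_cong[of _ _ sum_list] map_cong refl) (simp add: pieces_def)
        finally show ?thesis by (simp add: ps_def sum_list_concat_map)
      qed
      moreover have "good_piece \<eta> lam p \<and> supp (fn p) \<subseteq> supp f" if "p \<in> set ps" for p
        using that Ps(1) gf unfolding ps_def pieces_def by fastforce
      moreover have "sorted_wrt before (map (\<lambda>p. supp (fn p)) ps)"
        unfolding ps_def
      proof (rule sorted_concat)
        show "sorted_wrt before (map fst egs)"
          using norming_node(2) by (simp add: admissible_def)
        show "sorted_wrt before (map (\<lambda>p. supp (fn p)) (Ps e))" if "e \<in> set egs" for e
          using Ps(1)[OF that] by (simp add: pieces_def)
        show "supp (fn q) \<subseteq> fst e" if "e \<in> set egs" "q \<in> set (Ps e)" for e q
          using Ps(1)[OF that(1)] that(2) gf[OF that(1)] unfolding pieces_def by blast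
      qed
      ultimately have "pieces \<eta> lam v f ps" unfolding pieces_def by blast
      moreover have "mins ps \<in> comp_fam (Fs n) (fam \<eta> d (v * \<theta> n))"
        unfolding ps_def mins_concat by (rule comp_fam_union[OF norming_node(2) Ps(2) sub])
      then have "mins ps \<in> fam \<eta> (Suc d) v" using False by auto
      moreover have "mins (filter fst ps) \<in> fam lam (Suc d) v"
      proof (cases "lam < v * \<theta> n")
        case True
        have "filter fst ps = concat (map (\<lambda>e. filter fst (Ps e)) egs)"
          by (simp add: ps_def filter_concat comp_def)
        moreover have "(\<Union>e\<in>set egs. mins (filter fst (Ps e))) \<in> comp_fam (Fs n) (fam lam d (v * \<theta> n))"
        proof (rule comp_fam_union[OF norming_node(2) Ps(3)[OF _ True]])
          fix e assume "e \<in> set egs"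
          from sub[OF this] show "mins (filter fst (Ps e)) \<subseteq> fst e" by (auto simp: mins_def)
        qed
        ultimately show ?thesis using True by (simp add: mins_concat) blast
      next
        case small: False
        then have "filter fst ps = []"
          using Ps(4) by (simp add: ps_def filter_concat)
        then show ?thesis by (simp add: mins_def sing_def)
      qed
      ultimately show ?thesis by blast
    qed
  qed
qed

end

section \<open>Layered vectors\<close>

lemma ev_add:
  assumes "c00 x" "c00 y" "\<And>i. 0 \<le> x i" "\<And>i. 0 \<le> y i"
  shows "ev f (\<lambda>i. x i + y i) = ev f x + ev f y"
proof -
  define S where "S = supp x \<union> supp y"
  have S: "finite S" "supp x \<subseteq> S" "supp y \<subseteq> S" "supp (\<lambda>i. x i + y i) \<subseteq> S"
    using assms by (auto simp: S_def c00_supp supp_def)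
  have "ev f (\<lambda>i. x i + y i) = (\<Sum>i\<in>S. f i * \<bar>x i + y i\<bar>)" by (rule ev_superset[OF S(1,4)])
  also have "\<dots> = (\<Sum>i\<in>S. f i * \<bar>x i\<bar> + f i * \<bar>y i\<bar>)"
    using assms(3,4) by (intro sum.cong refl) (simp add: algebra_simps)
  finally show ?thesis by (simp add: sum.distrib ev_superset[OF S(1,2)] ev_superset[OF S(1,3)])
qed

definition lincomb :: "(real \<times> 'c) list \<Rightarrow> ('c \<Rightarrow> nat \<Rightarrow> real) \<Rightarrow> nat \<Rightarrow> real" where
  "lincomb w v i = (\<Sum>(a, c)\<leftarrow>w. a * v c i)"

lemma lincomb_nonneg:
  "(\<And>a c. (a, c) \<in> set w \<Longrightarrow> 0 \<le> a) \<Longrightarrow> (\<And>a c i. (a, c) \<in> set w \<Longrightarrow> 0 \<le> v c i) \<Longrightarrow> 0 \<le> lincomb w v i"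
  unfolding lincomb_def by (intro sum_list_nonneg) auto

lemma supp_lincomb: "supp (lincomb w v) \<subseteq> (\<Union>(a, c)\<in>set w. supp (v c))"
proof
  fix i assume "i \<in> supp (lincomb w v)"
  then have "(\<Sum>(a, c)\<leftarrow>w. a * v c i) \<noteq> 0" by (simp add: supp_def lincomb_def)
  then have "\<exists>(a, c)\<in>set w. v c i \<noteq> 0" by (induction w) auto
  then show "i \<in> (\<Union>(a, c)\<in>set w. supp (v c))" by (auto simp: supp_def)
qed

lemma ev_lincomb:
  assumes "\<And>a c. (a, c) \<in> set w \<Longrightarrow> 0 \<le> a \<and> c00 (v c) \<and> (\<forall>i. 0 \<le> v c i)"
  shows "ev f (lincomb w v) = (\<Sum>(a, c)\<leftarrow>w. a * ev f (v c))"
  using assms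
proof (induction w)
  case Nil
  then show ?case by (simp add: ev_def lincomb_def)
next
  case (Cons p w)
  obtain a c where p: "p = (a, c)" by force
  have hyp: "0 \<le> a" "c00 (v c)" "\<And>i. 0 \<le> v c i" using Cons.prems p by auto
  have "finite (\<Union>(a, c)\<in>set w. supp (v c))" using Cons.prems by (auto simp: c00_supp)
  then have "c00 (lincomb w v)" unfolding c00_supp using supp_lincomb finite_subset by blast
  moreover have "0 \<le> lincomb w v i" for i using Cons.prems by (intro lincomb_nonneg) auto
  moreover have "lincomb (p # w) v = (\<lambda>i. a * v c i + lincomb w v i)"
    by (simp add: lincomb_def p fun_eq_iff)
  moreover have "c00 (\<lambda>i. a * v c i)" using hyp(2) by (simp add: c00_def)
  ultimately have "ev f (lincomb (p # w) v) = ev f (\<lambda>i. a * v c i) + ev f (lincomb w v)"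
    using hyp by (simp add: ev_add)
  moreover have "ev f (lincomb w v) = (\<Sum>(a, c)\<leftarrow>w. a * ev f (v c))"
    by (rule Cons.IH, rule Cons.prems) simp
  ultimately show ?case using hyp(1) by (simp add: p ev_scale)
qed

lemma ev_pieces:
  assumes "\<And>i. g i = (\<Sum>p\<leftarrow>ps. wt p * fn p i)"
  shows "ev g x = (\<Sum>p\<leftarrow>ps. wt p * ev (fn p) x)"
proof -
  have "(\<Sum>p\<leftarrow>ps. wt p * ev (fn p) x) = (\<Sum>i\<in>supp x. (\<Sum>p\<leftarrow>ps. wt p * fn p i) * \<bar>x i\<bar>)"
    by (induction ps) (auto simp: ev_def sum.distrib algebra_simps sum_distrib_left)
  then show ?thesis by (simp add: ev_def assms)
qed

lemma sum_list_mult_swap: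
  "(\<Sum>p\<leftarrow>ps. r p * (\<Sum>(a, c)\<leftarrow>w. a * s p c)) = (\<Sum>(a, c)\<leftarrow>w. a * (\<Sum>p\<leftarrow>ps. r p * (s p c :: real)))"
proof (induction w)
  case (Cons q w)
  obtain a c where q: "q = (a, c)" by force
  have "(\<Sum>p\<leftarrow>ps. r p * (\<Sum>(a, c)\<leftarrow>q # w. a * s p c))
      = (\<Sum>p\<leftarrow>ps. a * (r p * s p c) + r p * (\<Sum>(a, c)\<leftarrow>w. a * s p c))"
    by (simp add: q algebra_simps)
  also have "\<dots> = a * (\<Sum>p\<leftarrow>ps. r p * s p c) + (\<Sum>p\<leftarrow>ps. r p * (\<Sum>(a, c)\<leftarrow>w. a * s p c))"
    by (simp only: sum_list_addf sum_list_const_mult)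
  finally show ?case using Cons by (simp add: q)
qed simp

text \<open>A point, the vector attached to it, the level sets, and the right end of the block.\<close>
type_synonym compound = "nat \<times> (nat \<Rightarrow> real) \<times> (nat \<Rightarrow> nat set) \<times> nat"

text \<open>\<open>H n\<close> contains the sets of minima that arise after cutting on all levels
  before \<open>n\<close>, each at its fine threshold. The assumption \<open>small\<close> concerns
  the coarse threshold \<open>\<theta> (m n) / \<epsilon>\<close> applied to a sequence already cut
  on those levels. After \<open>D n\<close> nodes every weight has dropped to the coarse
  threshold.\<close>

locale tower = mixed_tsirelson +
  fixes m :: "nat \<Rightarrow> nat" and H :: "nat \<Rightarrow> nat set set" and \<delta> :: "nat \<Rightarrow> bord"
    and \<epsilon> :: real and D :: "nat \<Rightarrow> nat" and M :: "nat set"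
  assumes eps: "0 < \<epsilon>"
    and theta_m: "\<theta> (m n) \<le> \<epsilon> / 2"
    and D: "\<theta> 0 ^ D n \<le> \<theta> (m n) / \<epsilon>"
    and H0: "H 0 = sing"
    and H_Suc: "H (Suc n) = comp_fam (H n) (fam (\<theta> (m n) * min ((1/2)^n / 2) (1 / \<epsilon>)) (D n) 1)"
    and small: "rk_lt (opow omega (\<delta> n)) (comp_fam (H n) (fam (\<theta> (m n) / \<epsilon>) (D n) 1))"
    and M: "infinite M"
begin

definition "lam n = \<theta> (m n) / \<epsilon>"
text \<open>The first entry makes the errors summable; the second keeps the fine threshold
  \<open>\<theta> (m n) * slack n\<close> at or below the coarse one, \<open>lam n\<close>.\<close>

definition "slack n = min ((1/2)^n / 2) (1 / \<epsilon>)"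
text \<open>The second summand is the sum of the errors \<open>2^-j\<close> over all levels
  \<open>j \<ge> n\<close>.\<close>

definition "bound n = 2 / \<epsilon> + 2 * (1/2)^n"

primrec sumd :: "nat \<Rightarrow> nat \<Rightarrow> bord" where
  "sumd j 0 = BZ"
| "sumd j (Suc t) = oadd (sumd j t) (\<delta> (j - t))"

text \<open>This is omega to the power \<open>\<delta> j + ... + \<delta> n\<close>, the rank a
  family needs so that the level-\<open>j\<close> points of a vector layered from level
  \<open>n\<close> on can be chosen in it. As for composed families, inner levels stand on the
  left.\<close>

definition tau :: "nat \<Rightarrow> nat \<Rightarrow> bord" where
  "tau j n = opow omega (sumd j (Suc j - n))"

lemma tau_step: "n \<le> j \<Longrightarrow> tau j n = omul (tau j (Suc n)) (opow omega (\<delta> n))"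
  by (simp add: tau_def Suc_diff_le opow_oadd)

text \<open>The last clause bounds sums over \<open>H n\<close>-admissible sequences instead of
  single functionals, because after cuts on the earlier levels it is such a sequence of pieces that
  acts on the vector.\<close>

definition layered :: "nat \<Rightarrow> nat \<Rightarrow> nat \<Rightarrow> nat \<Rightarrow> (nat \<Rightarrow> real) \<Rightarrow> (nat \<Rightarrow> nat set) \<Rightarrow> bool" where
  "layered n k N h x P \<longleftrightarrow> (\<forall>i. 0 \<le> x i) \<and> supp x \<subseteq> M \<inter> {N<..h}
     \<and> (\<forall>j. n \<le> j \<and> j < k \<longrightarrow> P j \<subseteq> {N<..h} \<and> 1 / \<theta> (m j) \<le> (\<Sum>i\<in>P j. x i))
     \<and> (\<forall>gs. (\<forall>g\<in>set gs. norming \<theta> Fs g) \<longrightarrow> admissible (H n) (map supp gs) \<longrightarrow>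
          (\<Sum>g\<leftarrow>gs. ev g x) \<le> bound n)"

text \<open>The state \<open>B\<close> gives for each level \<open>j\<close> the family from which
  the level-\<open>j\<close> points of the remaining blocks must be chosen. A block is one point of
  level \<open>n\<close> together with the vector hanging on it.\<close>

definition lstep :: "nat \<Rightarrow> nat \<Rightarrow> (nat \<Rightarrow> nat set set) \<Rightarrow> compound \<Rightarrow> (nat \<Rightarrow> nat set set) \<Rightarrow> bool" where
  "lstep n k B c B' \<longleftrightarrow> (case c of (p, u, Q, h) \<Rightarrow> p \<in> M \<and> p \<le> h \<and> Q n = {p}
      \<and> layered (Suc n) k p h u Q
     \<and> B' = (\<lambda>j. tails (Q j) (B j)))"

definition lfin :: "nat \<Rightarrow> nat \<Rightarrow> (nat \<Rightarrow> nat set set) \<Rightarrow> bool" where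
  "lfin n k B \<longleftrightarrow> (\<forall>j. n \<le> j \<and> j < k \<longrightarrow> {} \<in> B j)"

lemma lgame: "block_game (lstep n k) (\<lambda>c. fst c) (\<lambda>c. snd (snd (snd c)))"
  by unfold_locales (auto simp: lstep_def)

definition cvec :: "nat \<Rightarrow> compound \<Rightarrow> nat \<Rightarrow> real" where
  "cvec n c i = (if i = fst c then 1 / \<theta> (m n) else 0) + fst (snd c) i"

definition level_ok :: "nat \<Rightarrow> nat \<Rightarrow> bool" where
  "level_ok k n \<longleftrightarrow> (\<forall>B N. (\<forall>j. n \<le> j \<and> j < k \<longrightarrow> rk_ge (tau j n) (B j)) \<longrightarrow>
     (\<exists>h x P. layered n k N h x P \<and> (\<forall>j. n \<le> j \<and> j < k \<longrightarrow> P j \<in> B j)))"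

lemma bound_nonneg: "0 \<le> bound n"
  using eps by (simp add: bound_def)

lemma layered_zero: "layered k k N N (\<lambda>i. 0) P"
  using bound_nonneg by (auto simp: layered_def supp_def ev_def sum_list_triv)

lemma layered_cong:
  assumes "layered n k N h x P" "h \<le> h'" "\<And>j. n \<le> j \<Longrightarrow> P' j = P j"
  shows "layered n k N h' x P'"
  using assms unfolding layered_def by (auto simp: subset_iff) (meson le_trans)+

lemma tau_self [simp]: "tau n (Suc n) = BS BZ"
  by (simp add: tau_def)

text \<open>A move spends \<open>tau j (Suc n)\<close> of the rank of \<open>B j\<close>: the
  attached vector is chosen with its level sets in rich parts, which leave
  \<open>omul (tau j (Suc n)) b\<close> for the other moves. On level \<open>n\<close> itself the
  cost is 1, paid for the point \<open>p\<close>.\<close>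

lemma win_lstep:
  assumes IH: "level_ok k (Suc n)" and n: "n < k"
  shows "(\<forall>j. n \<le> j \<and> j < k \<longrightarrow> rk_ge (omul (tau j (Suc n)) b) (B j)) \<Longrightarrow>
    block_game.win (lstep n k) (lfin n k) (\<lambda>c. fst c) b B"
proof (induction b arbitrary: B)
  case BZ
  interpret block_game "lstep n k" "lfin n k" "\<lambda>c. fst c" "\<lambda>c. snd (snd (snd c))" by (rule lgame)
  show ?case using BZ unfolding win.simps(1) by (simp add: lfin_def)
next
  case (BL f)
  interpret block_game "lstep n k" "lfin n k" "\<lambda>c. fst c" "\<lambda>c. snd (snd (snd c))" by (rule lgame)
  have "win (f i) B" for i by (rule BL.IH) (use BL.prems in auto)
  then show ?case by simp
next
  case (BS b)
  interpret block_game "lstep n k" "lfin n k" "\<lambda>c. fst c" "\<lambda>c. snd (snd (snd c))" by (rule lgame)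
  have "\<exists>c B'. N < fst c \<and> lstep n k B c B' \<and> win b B'" for N
  proof -
    have "rk_ge (BS b) (B n)" using BS.prems n by (auto dest: spec[of _ n])
    then obtain n0 where n0: "\<And>p. n0 \<le> p \<Longrightarrow> rk_ge b (tails {p} (B n))" by auto
    obtain p where p: "p \<in> M" "max N n0 < p" using M infinite_nat_iff_unbounded by blast
    have "\<forall>j. Suc n \<le> j \<and> j < k \<longrightarrow>
        rk_ge (tau j (Suc n)) (rich_part (omul (tau j (Suc n)) b) (B j))"
    proof (intro allI impI)
      fix j assume "Suc n \<le> j \<and> j < k"
      then have "rk_ge (oadd (omul (tau j (Suc n)) b) (tau j (Suc n))) (B j)"
        using BS.prems by simp
      then show "rk_ge (tau j (Suc n)) (rich_part (omul (tau j (Suc n)) b) (B j))"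
        by (rule rk_ge_rich_part)
    qed
    from IH[unfolded level_ok_def, rule_format, OF this[rule_format], of p]
    obtain h u Q where u: "layered (Suc n) k p h u Q"
      "\<And>j. Suc n \<le> j \<Longrightarrow> j < k \<Longrightarrow> Q j \<in> rich_part (omul (tau j (Suc n)) b) (B j)"
      by blast
    define c where "c = (p, u, Q(n := {p}), max h p)"
    define B' where "B' = (\<lambda>j. tails ((Q(n := {p})) j) (B j))"
    have "layered (Suc n) k p (max h p) u (Q(n := {p}))"
      by (rule layered_cong[OF u(1)]) auto
    then have "lstep n k B c B'" using p by (simp add: lstep_def c_def B'_def)
    moreover have "win b B'"
    proof (rule BS.IH, intro allI impI)
      fix j assume j: "n \<le> j \<and> j < k"
      show "rk_ge (omul (tau j (Suc n)) b) (B' j)"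
      proof (cases "j = n")
        case True
        then show ?thesis using n0[of p] p by (simp add: B'_def)
      next
        case False
        then show ?thesis using u(2)[of j] j by (simp add: B'_def rich_part_def)
      qed
    qed
    moreover have "N < fst c" using p by (simp add: c_def)
    ultimately show ?thesis by blast
  qed
  then show ?case by simp
qed

lemma combine_levels:
  fixes lo hi :: "'c \<Rightarrow> nat"
  assumes "block_game.successive lo hi N (map snd w)" "block_game step lo hi"
    "\<And>a c. (a, c) \<in> set w \<Longrightarrow> 0 \<le> a \<and> (\<forall>i. 0 \<le> v c i) \<and> Q c \<subseteq> {lo c..hi c} \<and> r \<le> (\<Sum>i\<in>Q c. v c i)"
  shows "r * sum_list (map fst w) \<le> (\<Sum>i\<in>(\<Union>c\<in>snd ` set w. Q c). lincomb w v i)"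
  using assms(1,3)
proof (induction w arbitrary: N)
  case (Cons p w)
  interpret block_game step undefined lo hi by (rule assms(2))
  obtain a c where p: "p = (a, c)" by force
  have hyp: "0 \<le> a" "\<And>i. 0 \<le> v c i" "Q c \<subseteq> {lo c..hi c}" "r \<le> (\<Sum>i\<in>Q c. v c i)"
    using Cons.prems(2)[of a c] p by auto
  define R where "R = (\<Union>c\<in>snd ` set w. Q c)"
  have suc: "successive (hi c) (map snd w)" using Cons.prems(1) p by simp
  have Qd: "Q d \<subseteq> {hi c<..seqend (hi c) (map snd w)}" if "d \<in> snd ` set w" for d
  proof -
    obtain b where "(b, d) \<in> set w" using \<open>d \<in> snd ` set w\<close> by force
    then have "Q d \<subseteq> {lo d..hi d}" using Cons.prems(2)[of b d] by simp
    moreover have "d \<in> set (map snd w)" using that by simp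
    from successive_bounds[OF suc this] have "hi c < lo d" "hi d \<le> seqend (hi c) (map snd w)"
      by auto
    ultimately show ?thesis by (auto simp: subset_iff)
  qed
  then have R: "R \<subseteq> {hi c<..seqend (hi c) (map snd w)}" by (auto simp: R_def)
  have fin: "finite (Q c)" "finite R" using hyp(3) R finite_subset by auto
  have disj: "Q c \<inter> R = {}" using hyp(3) R by force
  have IH: "r * sum_list (map fst w) \<le> (\<Sum>i\<in>R. lincomb w v i)"
    unfolding R_def by (rule Cons.IH[OF suc], rule Cons.prems(2)) simp
  have nn: "0 \<le> lincomb w v i" for i using Cons.prems(2) by (intro lincomb_nonneg) auto
  have lc: "lincomb (p # w) v i = a * v c i + lincomb w v i" for i
    by (simp add: lincomb_def p)
  have "r * sum_list (map fst (p # w)) = a * r + r * sum_list (map fst w)"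
    by (simp add: p algebra_simps)
  also have "\<dots> \<le> a * (\<Sum>i\<in>Q c. v c i) + (\<Sum>i\<in>R. lincomb w v i)"
    using IH hyp by (intro add_mono mult_left_mono) auto
  also have "\<dots> \<le> (\<Sum>i\<in>Q c. lincomb (p # w) v i) + (\<Sum>i\<in>R. lincomb (p # w) v i)"
    unfolding sum_distrib_left using nn hyp by (intro add_mono sum_mono) (auto simp: lc)
  also have "\<dots> = (\<Sum>i\<in>Q c \<union> R. lincomb (p # w) v i)"
    by (rule sum.union_disjoint[symmetric, OF fin disj])
  finally show ?case by (simp add: p R_def)
qed (simp add: lincomb_def)

text \<open>All functionals are cut from weight 1 and their pieces are put into one list. The minima
  of all pieces form a set in \<open>H (Suc n)\<close>, so the bound on an attached vector applies
  to the whole list at once; the flagged minima lie in the family for which the average is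
  small.\<close>

lemma pieces_list_exist:
  assumes gs: "\<And>g. g \<in> set gs \<Longrightarrow> norming \<theta> Fs g" "admissible (H n) (map supp gs)"
  shows "\<exists>ps. (\<forall>x. (\<Sum>g\<leftarrow>gs. ev g x) = (\<Sum>p\<leftarrow>ps. wt p * ev (fn p) x))
    \<and> (\<forall>p\<in>set ps. good_piece (\<theta> (m n) * slack n) (lam n) p)
    \<and> admissible (H (Suc n)) (map (\<lambda>p. supp (fn p)) ps)
    \<and> mins (filter fst ps) \<in> comp_fam (H n) (fam (lam n) (D n) 1)"
proof -
  define \<eta> where "\<eta> = \<theta> (m n) * slack n"
  have th: "0 < \<theta> (m n)" by (rule theta_pos)
  have "0 < slack n" "slack n \<le> 1 / \<epsilon>" using eps by (simp_all add: slack_def)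
  then have "0 < \<eta>" and "\<theta> (m n) * slack n \<le> \<theta> (m n) * (1 / \<epsilon>)"
    using th by (simp add: \<eta>_def, intro mult_left_mono, auto)
  then have \<eta>: "0 < \<eta>" "\<eta> \<le> lam n" by (simp_all add: \<eta>_def lam_def)
  have "\<theta> (m n) < \<epsilon>" using theta_m[of n] eps by linarith
  then have lam1: "lam n < 1" using eps by (simp add: lam_def)
  have "\<exists>ps. pieces \<eta> (lam n) 1 g ps \<and> mins ps \<in> fam \<eta> (D n) 1
      \<and> mins (filter fst ps) \<in> fam (lam n) (D n) 1"
    if "g \<in> set gs" for g
    using pieces_exist[OF \<eta> gs(1)[OF that] lam1, of "D n"] D[of n] by (simp add: lam_def)
  then obtain Ps where Ps: "\<And>g. g \<in> set gs \<Longrightarrow> pieces \<eta> (lam n) 1 g (Ps g)"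
    "\<And>g. g \<in> set gs \<Longrightarrow> mins (Ps g) \<in> fam \<eta> (D n) 1"
    "\<And>g. g \<in> set gs \<Longrightarrow> mins (filter fst (Ps g)) \<in> fam (lam n) (D n) 1"
    by metis
  define ps where "ps = concat (map Ps gs)"
  define egs where "egs = map (\<lambda>g. (supp g, g)) gs"
  have fst_egs: "map fst egs = map supp gs" by (simp add: egs_def comp_def)
  have ps_egs: "ps = concat (map (\<lambda>e. Ps (snd e)) egs)" by (simp add: ps_def egs_def comp_def)
  have e: "snd e \<in> set gs \<and> fst e = supp (snd e)" if "e \<in> set egs" for e
    using that by (auto simp: egs_def)
  have adm: "admissible (H n) (map fst egs)" using gs(2) by (simp add: fst_egs)
  have "(\<Sum>g\<leftarrow>gs. ev g x) = (\<Sum>p\<leftarrow>ps. wt p * ev (fn p) x)" for x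
  proof -
    have "ev g x = (\<Sum>p\<leftarrow>Ps g. wt p * ev (fn p) x)" if "g \<in> set gs" for g
      using Ps(1)[OF that] by (intro ev_pieces) (simp add: pieces_def)
    then have "(\<Sum>g\<leftarrow>gs. ev g x) = (\<Sum>g\<leftarrow>gs. \<Sum>p\<leftarrow>Ps g. wt p * ev (fn p) x)"
      by (intro arg_cong[of _ _ sum_list] map_cong refl)
    then show ?thesis by (simp add: ps_def sum_list_concat_map)
  qed
  moreover have good: "\<forall>p\<in>set ps. good_piece \<eta> (lam n) p"
    using Ps(1) by (auto simp: ps_def pieces_def)
  moreover have "admissible (H (Suc n)) (map (\<lambda>p. supp (fn p)) ps)"
    unfolding admissible_def
  proof (intro conjI ballI)
    fix E assume "E \<in> set (map (\<lambda>p. supp (fn p)) ps)"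
    then show "finite E" "E \<noteq> {}" using good piece_finite by auto
  next
    show "sorted_wrt before (map (\<lambda>p. supp (fn p)) ps)"
      unfolding ps_egs
    proof (rule sorted_concat)
      show "sorted_wrt before (map fst egs)" using adm by (simp add: admissible_def)
      show "sorted_wrt before (map (\<lambda>p. supp (fn p)) (Ps (snd p)))" if "p \<in> set egs" for p
        using Ps(1) e[OF that] by (simp add: pieces_def)
      show "supp (fn q) \<subseteq> fst p" if "p \<in> set egs" "q \<in> set (Ps (snd p))" for p q
        using Ps(1)[of "snd p"] e[OF that(1)] that(2) by (simp add: pieces_def)
    qed
    have "(\<Union>e\<in>set egs. mins (Ps (snd e))) \<in> comp_fam (H n) (fam \<eta> (D n) 1)"
    proof (rule comp_fam_union[OF adm])
      fix p assume "p \<in> set egs"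
      from e[OF this] show "mins (Ps (snd p)) \<in> fam \<eta> (D n) 1" "mins (Ps (snd p)) \<subseteq> fst p"
        using Ps(2) mins_subset[OF Ps(1)] by simp_all
    qed
    then have "mins ps \<in> H (Suc n)"
      by (simp add: H_Suc ps_egs mins_concat \<eta>_def slack_def)
    then show "set (map Min (map (\<lambda>p. supp (fn p)) ps)) \<in> H (Suc n)"
      by (simp add: mins_def image_image)
  qed
  moreover have "mins (filter fst ps) \<in> comp_fam (H n) (fam (lam n) (D n) 1)"
  proof -
    have "filter fst ps = concat (map (\<lambda>e. filter fst (Ps (snd e))) egs)"
      by (simp add: ps_egs filter_concat comp_def)
    moreover have "(\<Union>e\<in>set egs. mins (filter fst (Ps (snd e)))) \<in> comp_fam (H n) (fam (lam n) (D n) 1)"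
    proof (rule comp_fam_union[OF adm])
      fix p assume p: "p \<in> set egs"
      show "mins (filter fst (Ps (snd p))) \<in> fam (lam n) (D n) 1" using Ps(3) e[OF p] by simp
      have "mins (Ps (snd p)) \<subseteq> fst p" using mins_subset[OF Ps(1)] e[OF p] by simp
      then show "mins (filter fst (Ps (snd p))) \<subseteq> fst p" by (auto simp: mins_def)
    qed
    ultimately show ?thesis by (simp add: mins_concat)
  qed
  ultimately show ?thesis unfolding \<eta>_def by blast
qed

lemma bound_Suc: "bound n = bound (Suc n) + (1/2)^n"
  by (simp add: bound_def)

text \<open>If a flagged piece starts in \<open>{q..h}\<close>, the trivial bound is used.
  Otherwise, if an unflagged piece covers \<open>q\<close>, no flagged piece acts on the block: it
  would have to start after \<open>q\<close> inside it. All acting weights are then at most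
  \<open>lam n \<le> 1/2\<close>. In the remaining case only flagged pieces starting before
  \<open>q\<close> can reach \<open>q\<close>; they contribute at most \<open>slack n\<close>, and
  the bound for \<open>u\<close> is used unchanged.\<close>

lemma compound_estimate:
  assumes good: "\<And>p. p \<in> set ps \<Longrightarrow> good_piece (\<theta> (m n) * slack n) (lam n) p"
    and adm: "admissible (H (Suc n)) (map (\<lambda>p. supp (fn p)) ps)"
    and lay: "layered (Suc n) k q h u Q" and qh: "q \<le> h"
  shows "(\<Sum>p\<leftarrow>ps. wt p * fn p q) / \<theta> (m n) + (\<Sum>p\<leftarrow>ps. wt p * ev (fn p) u) \<le>
    (if mins (filter fst ps) \<inter> {q..h} = {} then bound (Suc n) + slack n
     else 1 / \<theta> (m n) + bound (Suc n))"
proof -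
  have th: "0 < \<theta> (m n)" by (rule theta_pos)
  have nfp: "norming \<theta> Fs (fn p)" "0 \<le> wt p" "wt p \<le> 1" if "p \<in> set ps" for p
    using good[OF that] by (auto simp: good_piece_def)
  have evp: "0 \<le> ev (fn p) u" "0 \<le> fn p q" "fn p q \<le> 1" if "p \<in> set ps" for p
    using ev_nonneg[OF nfp(1)[OF that]] norming_bounds[OF nfp(1)[OF that], of q] by auto
  have srt: "sorted_wrt before (map (\<lambda>p. supp (fn p)) ps)"
    using adm by (simp add: admissible_def)
  have qs: "q \<in> supp (fn p)" if "wt p * fn p q \<noteq> 0" for p using that by (simp add: supp_def)
  have U: "(\<Sum>p\<leftarrow>ps. ev (fn p) u) \<le> bound (Suc n)"
  proof -
    have "map supp (map fn ps) = map (\<lambda>p. supp (fn p)) ps" by (simp add: comp_def)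
    then have "admissible (H (Suc n)) (map supp (map fn ps))" using adm by (simp only:)
    moreover have "\<forall>g\<in>set (map fn ps). norming \<theta> Fs g" using nfp(1) by auto
    ultimately have "(\<Sum>g\<leftarrow>map fn ps. ev g u) \<le> bound (Suc n)"
      using lay unfolding layered_def by blast
    then show ?thesis by (simp add: comp_def)
  qed
  have W: "(\<Sum>p\<leftarrow>ps. wt p * ev (fn p) u) \<le> (\<Sum>p\<leftarrow>ps. ev (fn p) u)"
    using nfp evp by (intro sum_list_mono) (simp add: mult_left_le_one_le)
  have one: "(\<Sum>p\<leftarrow>ps. wt p * fn p q) \<le> 1"
    using nfp evp qs by (intro sum_list_disjoint_le[OF srt, where i = q]) (auto intro: mult_le_one)
  show ?thesis
  proof (cases "mins (filter fst ps) \<inter> {q..h} = {}")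
    case False
    have "(\<Sum>p\<leftarrow>ps. wt p * fn p q) / \<theta> (m n) \<le> 1 / \<theta> (m n)"
      using one th by (simp add: divide_right_mono)
    then show ?thesis using False U W by simp
  next
    case nohit: True
    have nomin: "Min (supp (fn p)) \<notin> {q..h}" if "p \<in> set ps" "fst p" for p
      using nohit that by (auto simp: mins_def)
    show ?thesis
    proof (cases "\<exists>p0\<in>set ps. \<not> fst p0 \<and> fn p0 q \<noteq> 0")
      case True
      then obtain p0 where p0: "p0 \<in> set ps" "\<not> fst p0" "q \<in> supp (fn p0)" by (auto simp: supp_def)
      have dich: "(\<forall>a\<in>supp (fn p). \<forall>b\<in>supp (fn p0). a < b) \<or> (\<forall>a\<in>supp (fn p0). \<forall>b\<in>supp (fn p). a < b)"
        if "p \<in> set ps" "fst p" for p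
        using sorted_wrt_dichotomy[of "\<lambda>x y. \<forall>a\<in>supp (fn x). \<forall>b\<in>supp (fn y). a < b" ps p p0]
          srt that p0 by (auto simp: sorted_wrt_map)
      have zero: "fn p q = 0 \<and> ev (fn p) u = 0" if p: "p \<in> set ps" "fst p" for p
      proof
        show "fn p q = 0"
        proof (rule ccontr)
          assume "fn p q \<noteq> 0"
          then have "q \<in> supp (fn p)" by (simp add: supp_def)
          then show False using dich[OF p] p0(3) by blast
        qed
        have "fn p i * \<bar>u i\<bar> = 0" if "i \<in> supp u" for i
        proof (rule ccontr)
          assume "fn p i * \<bar>u i\<bar> \<noteq> 0"
          then have i: "i \<in> supp (fn p)" by (simp add: supp_def)
          have iq: "q < i" "i \<le> h" using lay that unfolding layered_def by auto
          then have "\<forall>b\<in>supp (fn p). q < b" using dich[OF p] p0(3) i by (meson less_asym)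
          moreover have "Min (supp (fn p)) \<in> supp (fn p)" "Min (supp (fn p)) \<le> i"
            using piece_finite[OF good[OF p(1)]] i by auto
          ultimately have "Min (supp (fn p)) \<in> {q..h}" using iq
            by (meson atLeastAtMost_iff le_trans less_imp_le)
          then show False using nomin[OF p] by blast
        qed
        then show "ev (fn p) u = 0" unfolding ev_def by (rule sum.neutral[rule_format])
      qed
      have "(\<Sum>p\<leftarrow>ps. wt p * fn p q) \<le> lam n"
      proof (rule sum_list_disjoint_le[OF srt, where i = q])
        show "0 \<le> lam n" using th eps by (simp add: lam_def)
        fix p assume p: "p \<in> set ps"
        show "q \<in> supp (fn p)" if "wt p * fn p q \<noteq> 0" using qs[OF that] .
        show "wt p * fn p q \<le> lam n"
        proof (cases "fst p")
          case True
          then show ?thesis using zero[OF p] th eps by (simp add: lam_def)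
        next
          case False
          then have "wt p \<le> lam n" using good[OF p] by (simp add: good_piece_def)
          moreover have "wt p * fn p q \<le> wt p" using nfp[OF p] evp[OF p]
            by (simp add: mult_right_le_one_le)
          ultimately show ?thesis by simp
        qed
      qed
      then have "(\<Sum>p\<leftarrow>ps. wt p * fn p q) / \<theta> (m n) \<le> lam n / \<theta> (m n)"
        using th by (simp add: divide_right_mono)
      also have "\<dots> = 1 / \<epsilon>" using th by (simp add: lam_def)
      finally have 1: "(\<Sum>p\<leftarrow>ps. wt p * fn p q) / \<theta> (m n) \<le> 1 / \<epsilon>" .
      have "(\<Sum>p\<leftarrow>ps. wt p * ev (fn p) u) \<le> (\<Sum>p\<leftarrow>ps. lam n * ev (fn p) u)"
      proof (rule sum_list_mono)
        fix p assume p: "p \<in> set ps"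
        show "wt p * ev (fn p) u \<le> lam n * ev (fn p) u"
        proof (cases "fst p")
          case False
          then have "wt p \<le> lam n" using good[OF p] by (simp add: good_piece_def)
          then show ?thesis using evp[OF p] by (simp add: mult_right_mono)
        qed (use zero[OF p] in simp)
      qed
      also have "\<dots> = lam n * (\<Sum>p\<leftarrow>ps. ev (fn p) u)" by (rule sum_list_const_mult)
      also have "\<dots> \<le> 1/2 * bound (Suc n)"
      proof (rule mult_mono)
        show "lam n \<le> 1/2" using theta_m[of n] eps by (simp add: lam_def field_simps)
        show "0 \<le> (\<Sum>p\<leftarrow>ps. ev (fn p) u)" using evp(1) by (intro sum_list_nonneg) force
      qed (use U in auto)
      finally have 2: "(\<Sum>p\<leftarrow>ps. wt p * ev (fn p) u) \<le> 1/2 * bound (Suc n)" .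
      \<comment> \<open>This gives
        \<open>1 / \<epsilon> + bound (Suc n) / 2 \<le> bound (Suc n)\<close>, which stops the
        bounds from growing with the number of levels.\<close>
      have "1 / \<epsilon> \<le> 1/2 * bound (Suc n)" by (simp add: bound_def)
      moreover have "0 \<le> slack n" using eps by (simp add: slack_def)
      ultimately show ?thesis using 1 2 nohit by simp
    next
      case False
      have "(\<Sum>p\<leftarrow>ps. wt p * fn p q) \<le> \<theta> (m n) * slack n"
      proof (rule sum_list_disjoint_le[OF srt, where i = q])
        show es0: "0 \<le> \<theta> (m n) * slack n" using th eps by (simp add: slack_def)
        fix p assume p: "p \<in> set ps"
        show "q \<in> supp (fn p)" if "wt p * fn p q \<noteq> 0" using qs[OF that] .
        show "wt p * fn p q \<le> \<theta> (m n) * slack n"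
        proof (cases "fn p q = 0")
          case True
          then show ?thesis using es0 by simp
        next
          case nz: False
          then have t: "fst p" using False p by blast
          have "q \<in> supp (fn p)" using nz by (simp add: supp_def)
          have "q \<noteq> Min (supp (fn p))"
          proof
            assume "q = Min (supp (fn p))"
            then show False using nomin[OF p t] qh by auto
          qed
          then show ?thesis using good[OF p] t by (simp add: good_piece_def)
        qed
      qed
      then have "(\<Sum>p\<leftarrow>ps. wt p * fn p q) / \<theta> (m n) \<le> slack n" using th by (simp add: field_simps)
      then show ?thesis using nohit U W by simp
    qed
  qed
qed

text \<open>Blocks of total mass \<open>tol n\<close> may be charged with the trivial bound
  \<open>1 / \<theta> (m n) + bound (Suc n)\<close> at a cost of \<open>2^-n / 2\<close>; the other
  half of the error \<open>2^-n\<close> belongs to \<open>slack n\<close>.\<close>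

definition tol :: "nat \<Rightarrow> real" where
  "tol n = (1/2)^n / 2 / (1 / \<theta> (m n) + bound (Suc n))"

lemma tol_pos: "0 < tol n"
  using theta_pos[of "m n"] bound_nonneg[of "Suc n"] by (simp add: tol_def add_pos_nonneg)

lemma level_step:
  assumes IH: "level_ok k (Suc n)" and n: "n < k"
  shows "level_ok k n"
  unfolding level_ok_def
proof (intro allI impI)
  fix B :: "nat \<Rightarrow> nat set set" and N
  assume B: "\<forall>j. n \<le> j \<and> j < k \<longrightarrow> rk_ge (tau j n) (B j)"
  define lo where "lo = (\<lambda>c :: compound. fst c)"
  define hi where "hi = (\<lambda>c :: compound. snd (snd (snd c)))"
  have game: "block_game (lstep n k) lo hi" unfolding lo_def hi_def by (rule lgame)
  interpret block_game "lstep n k" "lfin n k" lo hi by (rule game)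
  have "\<forall>j. n \<le> j \<and> j < k \<longrightarrow> rk_ge (omul (tau j (Suc n)) (opow omega (\<delta> n))) (B j)"
    using B by (simp add: tau_step)
  \<comment> \<open>The summand \<open>BZ\<close> says that no rank has to be left once the average
    is complete.\<close>
  from win_lstep[OF IH n this] have "win (oadd BZ (opow omega (\<delta> n))) B" by (simp add: lo_def)
  from small_average[OF tol_pos small this, of N n]
  obtain w where w: "avg BZ B N 1 w"
    "\<And>A. A \<in> comp_fam (H n) (fam (\<theta> (m n) / \<epsilon>) (D n) 1) \<Longrightarrow> mass w A \<le> tol n"
    by blast
  from w(1) obtain B' where B': "path B (map snd w) B'" "lfin n k B'" by (auto simp: avg_def)
  have suc: "successive N (map snd w)" and sum1: "sum_list (map fst w) = 1"
    and a0: "\<And>a c. (a, c) \<in> set w \<Longrightarrow> 0 \<le> a"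
    using w(1) by (auto simp: avg_def)
  define Qc where "Qc = (\<lambda>c :: compound. fst (snd (snd c)))"
  define uc where "uc = (\<lambda>c :: compound. fst (snd c))"
  have path_step: "\<exists>B1 B2. lstep n k B1 c B2" if "path B0 cs B3" "c \<in> set cs" for B0 B3 c cs
    using that by (induction cs arbitrary: B0) auto
  have cst: "lo c \<in> M" "lo c \<le> hi c" "Qc c n = {lo c}" "layered (Suc n) k (lo c) (hi c) (uc c) (Qc c)"
    if "c \<in> snd ` set w" for c
    using path_step[OF B'(1), of c] that by (auto simp: lstep_def lo_def hi_def Qc_def uc_def)
  have sb: "N < lo c" "hi c \<le> seqend N (map snd w)" if "c \<in> snd ` set w" for c
    using successive_bounds[OF suc, of c] that by auto
  define v where "v = cvec n"
  define x where "x = lincomb w v"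
  define P where "P = (\<lambda>j. \<Union>c\<in>snd ` set w. Qc c j)"
  define h where "h = seqend N (map snd w)"
  have th: "0 < \<theta> (m n)" by (rule theta_pos)
  have veq: "v c i = (if i = lo c then 1 / \<theta> (m n) else 0) + uc c i" for c i
    by (simp add: v_def cvec_def lo_def uc_def)
  have u0: "0 \<le> uc c i" "supp (uc c) \<subseteq> M \<inter> {lo c<..hi c}" if "c \<in> snd ` set w" for c i
    using cst(4)[OF that] by (auto simp: layered_def)
  have v0: "0 \<le> v c i" if "c \<in> snd ` set w" for c i
    using u0(1)[OF that, of i] th by (simp add: veq)
  have suppv: "supp (v c) \<subseteq> M \<inter> {lo c..hi c}" if "c \<in> snd ` set w" for c
  proof
    fix i assume "i \<in> supp (v c)"
    then have "i = lo c \<or> i \<in> supp (uc c)" by (auto simp: supp_def veq split: if_splits)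
    then show "i \<in> M \<inter> {lo c..hi c}" using u0(2)[OF that] cst(1,2)[OF that] by auto
  qed
  have c00v: "c00 (v c)" if "c \<in> snd ` set w" for c
    unfolding c00_supp by (rule finite_subset[OF suppv[OF that]]) simp
  have c00u: "c00 (uc c)" if "c \<in> snd ` set w" for c
    unfolding c00_supp by (rule finite_subset[OF u0(2)[OF that]]) simp
  have inw: "c \<in> snd ` set w" if "(a, c) \<in> set w" for a c using that by force
  have x0: "0 \<le> x i" for i
    unfolding x_def using a0 v0 inw by (intro lincomb_nonneg) auto
  have suppx: "supp x \<subseteq> M \<inter> {N<..h}"
  proof
    fix i assume "i \<in> supp x"
    then obtain a c where ac: "(a, c) \<in> set w" and "i \<in> supp (v c)"
      using supp_lincomb[of w v] unfolding x_def by auto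
    then show "i \<in> M \<inter> {N<..h}"
      using suppv[OF inw[OF ac]] sb[OF inw[OF ac]] unfolding h_def by auto
  qed
  have Qin: "Qc c j \<subseteq> {lo c..hi c}" "1 / \<theta> (m j) \<le> (\<Sum>i\<in>Qc c j. v c i)"
    if "c \<in> snd ` set w" "n \<le> j" "j < k" for c j
  proof -
    have "Qc c j \<subseteq> {lo c..hi c} \<and> 1 / \<theta> (m j) \<le> (\<Sum>i\<in>Qc c j. v c i)"
    proof (cases "j = n")
      case True
      then show ?thesis using cst(2,3)[OF that(1)] u0(1)[OF that(1)] by (simp add: veq)
    next
      case False
      then have "Qc c j \<subseteq> {lo c<..hi c} \<and> 1 / \<theta> (m j) \<le> (\<Sum>i\<in>Qc c j. uc c i)"
        using cst(4)[OF that(1)] that by (simp add: layered_def)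
      moreover have "(\<Sum>i\<in>Qc c j. uc c i) \<le> (\<Sum>i\<in>Qc c j. v c i)"
        using th by (intro sum_mono) (simp add: veq)
      ultimately show ?thesis by force
    qed
    then show "Qc c j \<subseteq> {lo c..hi c}" "1 / \<theta> (m j) \<le> (\<Sum>i\<in>Qc c j. v c i)" by auto
  qed
  have Pmass: "1 / \<theta> (m j) \<le> (\<Sum>i\<in>P j. x i)" if "n \<le> j" "j < k" for j
  proof -
    have "1 / \<theta> (m j) * sum_list (map fst w) \<le> (\<Sum>i\<in>(\<Union>c\<in>snd ` set w. Qc c j). lincomb w v i)"
    proof (rule combine_levels[OF suc game])
      fix a c assume ac: "(a, c) \<in> set w"
      show "0 \<le> a \<and> (\<forall>i. 0 \<le> v c i) \<and> Qc c j \<subseteq> {lo c..hi c} \<and> 1 / \<theta> (m j) \<le> (\<Sum>i\<in>Qc c j. v c i)"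
        using a0[OF ac] v0[OF inw[OF ac]] Qin[OF inw[OF ac] that] by simp
    qed
    then show ?thesis by (simp add: sum1 P_def x_def)
  qed
  have Pin: "P j \<subseteq> {N<..h}" if "n \<le> j" "j < k" for j
  proof
    fix i assume "i \<in> P j"
    then obtain c where c: "c \<in> snd ` set w" "i \<in> Qc c j" unfolding P_def by blast
    then have "i \<in> {lo c..hi c}" using Qin(1)[OF c(1) that] by blast
    then show "i \<in> {N<..h}" using sb[OF c(1)] by (simp add: h_def)
  qed
  have PB: "P j \<in> B j" if "n \<le> j" "j < k" for j
  proof -
    \<comment> \<open>The moves are unwound backwards: each replaced the family of level
      \<open>j\<close> by its tails above \<open>Q j\<close>, and the final state still contains
      \<open>{}\<close>.\<close>
    have "(\<Union>c\<in>set cs. Qc c j) \<in> B0 j" if "path B0 cs B'" for cs B0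
      using that
    proof (induction cs arbitrary: B0)
      case Nil
      then show ?case using B'(2) \<open>n \<le> j\<close> \<open>j < k\<close> by (simp add: lfin_def)
    next
      case (Cons c cs)
      then obtain B1 where B1: "lstep n k B0 c B1" "path B1 cs B'" by auto
      have "(\<Union>c\<in>set cs. Qc c j) \<in> B1 j" by (rule Cons.IH[OF B1(2)])
      then show ?case using B1(1) by (auto simp: lstep_def Qc_def tails_def)
    qed
    from this[OF B'(1)] show ?thesis by (simp add: P_def)
  qed
  have est: "(\<Sum>g\<leftarrow>gs. ev g x) \<le> bound n"
    if gs: "\<forall>g\<in>set gs. norming \<theta> Fs g" "admissible (H n) (map supp gs)" for gs
  proof -
    from pieces_list_exist[of gs n] gs obtain ps where
      ps: "\<And>x. (\<Sum>g\<leftarrow>gs. ev g x) = (\<Sum>p\<leftarrow>ps. wt p * ev (fn p) x)"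
      "\<And>p. p \<in> set ps \<Longrightarrow> good_piece (\<theta> (m n) * slack n) (lam n) p"
      "admissible (H (Suc n)) (map (\<lambda>p. supp (fn p)) ps)"
      "mins (filter fst ps) \<in> comp_fam (H n) (fam (lam n) (D n) 1)"
      by blast
    define Z where "Z = mins (filter fst ps)"
    define b where "b = bound (Suc n) + slack n"
    define K where "K = 1 / \<theta> (m n) + bound (Suc n)"
    have K0: "0 < K" unfolding K_def using th bound_nonneg by (simp add: add_pos_nonneg)
    have b0: "0 \<le> b" using bound_nonneg[of "Suc n"] eps by (simp add: b_def slack_def)
    have T: "(\<Sum>p\<leftarrow>ps. wt p * ev (fn p) (v c)) \<le> (if hits c Z then K else b)" if c: "c \<in> snd ` set w" for c
    proof -
      have "ev f (v c) = f (lo c) / \<theta> (m n) + ev f (uc c)" for f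
      proof -
        have vc: "v c = (\<lambda>i. 1 / \<theta> (m n) * (if i = lo c then 1 else 0) + uc c i)"
          by (auto simp: veq fun_eq_iff)
        have "supp (\<lambda>i. 1 / \<theta> (m n) * (if i = lo c then 1 else 0)) = {lo c}"
          using th by (auto simp: supp_def)
        then have "c00 (\<lambda>i. 1 / \<theta> (m n) * (if i = lo c then 1 else 0))"
          "ev f (\<lambda>i. 1 / \<theta> (m n) * (if i = lo c then 1 else 0)) = f (lo c) / \<theta> (m n)"
          using th by (simp_all add: c00_supp ev_def)
        then show ?thesis unfolding vc using c00u[OF c] u0(1)[OF c] th by (simp add: ev_add)
      qed
      then have "(\<Sum>p\<leftarrow>ps. wt p * ev (fn p) (v c)) =
          (\<Sum>p\<leftarrow>ps. wt p * fn p (lo c)) / \<theta> (m n) + (\<Sum>p\<leftarrow>ps. wt p * ev (fn p) (uc c))"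
        by (induction ps) (auto simp: algebra_simps add_divide_distrib)
      also have "\<dots> \<le> (if hits c Z then K else b)"
        using compound_estimate[OF ps(2,3) cst(4)[OF c] cst(2)[OF c]]
        by (simp add: hits_def Z_def K_def b_def split: if_splits)
      finally show ?thesis .
    qed
    have "(\<Sum>g\<leftarrow>gs. ev g x) = (\<Sum>p\<leftarrow>ps. wt p * (\<Sum>(a, c)\<leftarrow>w. a * ev (fn p) (v c)))"
      unfolding ps(1) x_def using a0 c00v v0 inw
      by (intro arg_cong[of _ _ sum_list] map_cong refl) (simp add: ev_lincomb)
    also have "\<dots> = (\<Sum>(a, c)\<leftarrow>w. a * (\<Sum>p\<leftarrow>ps. wt p * ev (fn p) (v c)))"
      by (rule sum_list_mult_swap)
    \<comment> \<open>Every block is charged \<open>b\<close>, and a block that meets a flagged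
      minimum is charged \<open>K\<close> in addition; the total of these extra charges is
      \<open>K\<close> times the mass of \<open>Z\<close>.\<close>
    also have "\<dots> \<le> (\<Sum>(a, c)\<leftarrow>w. b * a + K * (if hits c Z then a else 0))"
    proof (rule sum_list_mono, clarify)
      fix a c assume ac: "(a, c) \<in> set w"
      have "a * (\<Sum>p\<leftarrow>ps. wt p * ev (fn p) (v c)) \<le> a * (if hits c Z then K else b)"
        by (rule mult_left_mono[OF T[OF inw[OF ac]] a0[OF ac]])
      also have "\<dots> \<le> b * a + K * (if hits c Z then a else 0)"
        using a0[OF ac] b0 by (simp add: algebra_simps)
      finally show "a * (\<Sum>p\<leftarrow>ps. wt p * ev (fn p) (v c)) \<le> b * a + K * (if hits c Z then a else 0)" .
    qed
    also have "\<dots> = b * sum_list (map fst w) + K * mass w Z"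
      unfolding mass_def by (induction w) (auto simp: algebra_simps)
    also have "\<dots> \<le> b + K * tol n"
      using w(2)[OF ps(4)[unfolded lam_def]] K0 by (simp add: sum1 Z_def)
    also have "K * tol n = (1/2)^n / 2"
    proof -
      have "tol n = (1/2)^n / 2 / K" by (simp only: tol_def K_def)
      then show ?thesis using K0 by simp
    qed
    also have "b + (1/2)^n / 2 \<le> bound n" unfolding b_def bound_Suc[of n]
      by (simp add: slack_def min_def)
    finally show ?thesis .
  qed
  have "layered n k N h x P"
    unfolding layered_def using x0 suppx Pin Pmass est by blast
  then show "\<exists>h x P. layered n k N h x P \<and> (\<forall>j. n \<le> j \<and> j < k \<longrightarrow> P j \<in> B j)"
    using PB by blast
qed

text \<open>Runs downward from \<open>n = k\<close>, where the zero vector carries no level and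
  places no demand on the families.\<close>

theorem level_all: "n \<le> k \<Longrightarrow> level_ok k n"
proof (induction n rule: inc_induct)
  case base
  have "layered k k N N (\<lambda>i. 0) (\<lambda>j. {}) \<and> (\<forall>j. k \<le> j \<and> j < k \<longrightarrow> {} \<in> B j)"
    for N and B :: "nat \<Rightarrow> nat set set"
    by (intro conjI layered_zero allI impI) linarith
  then show ?case unfolding level_ok_def by (intro allI impI exI)
next
  case (step n)
  then show ?case by (simp add: level_step)
qed

end

lemma rk_ge_INT:
  "finite I \<Longrightarrow> rk_ge b F0 \<Longrightarrow> (\<And>i. i \<in> I \<Longrightarrow> rk_ge b (F i)) \<Longrightarrow> rk_ge b (F0 \<inter> (\<Inter>i\<in>I. F i))"
proof (induction rule: finite_induct)
  case (insert i I)
  then have "rk_ge b (F0 \<inter> (\<Inter>i\<in>I. F i))" "rk_ge b (F i)" by simp_all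
  then have "rk_ge b (F i \<inter> (F0 \<inter> (\<Inter>i\<in>I. F i)))" using rk_ge_Int by blast
  then show ?case by (simp add: Int_left_commute)
qed simp

section \<open>The spreading sequence\<close>

type_synonym layer = "(nat \<Rightarrow> real) \<times> (nat \<Rightarrow> nat set) \<times> nat"

text \<open>The assumption \<open>rk_ge_Fs\<close> stores \<open>opow omega (\<beta> n)\<close>
  copies of \<open>tau n 0\<close>. One copy pays for the level-\<open>n\<close> points of one
  vector, and the ranking of \<open>S n\<close> counts down the copies while a set of indices is
  being built.\<close>

locale tower_seq = tower + mixed_tsirelson_nontrivial +
  fixes S :: "nat \<Rightarrow> nat set set" and \<beta> :: "nat \<Rightarrow> bord"
  assumes hered: "hereditary (Fs n)"
    and rk_ge_Fs: "rk_ge (omul (tau n 0) (opow omega (\<beta> n))) (Fs (m n))"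
    and rk_lt_S: "rk_lt (BS (opow omega (\<beta> n))) (S n)"
begin

definition rank :: "nat \<Rightarrow> nat set \<Rightarrow> bord" where
  "rank n = (SOME r. ole (r {}) (opow omega (\<beta> n)) \<and> (\<forall>A k. finite A \<longrightarrow> (\<forall>a\<in>A. a < k) \<longrightarrow>
           tails (insert k A) (S n) \<noteq> {} \<longrightarrow> olt (r (insert k A)) (r A)))"

lemma rank: "ole (rank n {}) (opow omega (\<beta> n))"
  "finite A \<Longrightarrow> (\<And>a. a \<in> A \<Longrightarrow> a < k) \<Longrightarrow> tails (insert k A) (S n) \<noteq> {} \<Longrightarrow>
    olt (rank n (insert k A)) (rank n A)"
  using someI_ex[OF rk_lt_ranking[OF rk_lt_S[of n]]] by (auto simp: rank_def)

definition prev :: "(nat \<Rightarrow> layer) \<Rightarrow> nat \<Rightarrow> nat" where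
  "prev f k = (case k of 0 \<Rightarrow> 0 | Suc i \<Rightarrow> snd (snd (f i)))"

definition lev :: "layer \<Rightarrow> nat \<Rightarrow> nat set" where
  "lev l = fst (snd l)"

text \<open>The reserve of rank is demanded for all \<open>K\<close> at once, since it is not known
  in advance which vectors will be combined. The restriction \<open>n \<le> k\<close> reflects that
  the vector with index \<open>k\<close> carries the levels from 0 to \<open>k\<close>.\<close>

definition good_layer :: "(nat \<Rightarrow> layer) \<Rightarrow> nat \<Rightarrow> layer \<Rightarrow> bool" where
  "good_layer f k l \<longleftrightarrow> prev f k \<le> snd (snd l)
      \<and> layered 0 (Suc k) (prev f k) (snd (snd l)) (fst l) (lev l)
     \<and> (\<forall>n K. K \<subseteq> {n..<k} \<longrightarrow> n \<le> k \<longrightarrow> tails (insert k K) (S n) \<noteq> {} \<longrightarrow>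
          rk_ge (omul (tau n 0) (rank n (insert k K))) (tails ((\<Union>i\<in>K. lev (f i) n) \<union> lev l n) (Fs (m n))))"

lemma good_layer_bounds:
  assumes "\<And>i. i < k \<Longrightarrow> good_layer f i (f i)" "i < k" "n \<le> i"
  shows "lev (f i) n \<subseteq> {prev f i<..snd (snd (f i))}" "snd (snd (f i)) \<le> prev f k"
proof -
  show "lev (f i) n \<subseteq> {prev f i<..snd (snd (f i))}"
    using assms(1)[OF assms(2)] assms(3) by (simp add: good_layer_def layered_def)
  show "snd (snd (f i)) \<le> prev f k"
    using assms(2,1)
  proof (induction k)
    case (Suc k)
    show ?case
    proof (cases "i = k")
      case False
      then have "snd (snd (f i)) \<le> prev f k" using Suc by simp
      also have "\<dots> \<le> snd (snd (f k))" using Suc.prems(2)[of k] by (simp add: good_layer_def)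
      finally show ?thesis by (simp add: prev_def)
    qed (simp add: prev_def)
  qed simp
qed

text \<open>Adding \<open>k\<close> to \<open>K\<close> lowers the label of \<open>K\<close> by at
  least one and so frees a copy of \<open>tau n 0\<close> for the new level-\<open>n\<close> points.
  For each \<open>n\<close> only finitely many \<open>K\<close> impose a condition, and the
  intersection of the corresponding rich parts keeps rank \<open>tau n 0\<close>.\<close>

lemma good_layer_exists:
  assumes prem: "\<And>i. i < k \<Longrightarrow> good_layer f i (f i)"
  shows "\<exists>l. good_layer f k l"
proof -
  define U where "U n K = (\<Union>i\<in>K. lev (f i) n)" for n K
  define V where "V n = {K. K \<subseteq> {n..<k} \<and> tails (insert k K) (S n) \<noteq> {}}" for n
  define B where "B n = Fs (m n) \<inter> (\<Inter>K\<in>V n. rich_part (omul (tau n 0) (rank n (insert k K))) (tails (U n K) (Fs (m n))))" for n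
  have bigB: "rk_ge (tau n 0) (B n)" for n
    unfolding B_def
  proof (rule rk_ge_INT)
    show "finite (V n)" by (rule finite_subset[of _ "Pow {n..<k}"]) (auto simp: V_def)
    have "ole (omul (tau n 0) (BS BZ)) (omul (tau n 0) (opow omega (\<beta> n)))"
      using wpow_pos[of "\<beta> n"] by (intro ole_omul_right) (simp add: olt_def)
    then show "rk_ge (tau n 0) (Fs (m n))"
      using rk_ge_antimono[OF _ rk_ge_Fs hered] by simp
    fix K assume K: "K \<in> V n"
    then have Kk: "K \<subseteq> {n..<k}" and ne: "tails (insert k K) (S n) \<noteq> {}" by (auto simp: V_def)
    have finK: "finite K" by (rule finite_subset[OF Kk]) simp
    have "rk_ge (omul (tau n 0) (rank n K)) (tails (U n K) (Fs (m n)))"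
    proof (cases "K = {}")
      case True
      have "ole (omul (tau n 0) (rank n {})) (omul (tau n 0) (opow omega (\<beta> n)))"
        by (rule ole_omul_right[OF rank(1)])
      from rk_ge_antimono[OF this rk_ge_Fs hered] True show ?thesis by (simp add: U_def)
    next
      case False
      define k1 where "k1 = Max K"
      define K' where "K' = K - {k1}"
      have k1: "k1 \<in> K" "\<And>i. i \<in> K \<Longrightarrow> i \<le> k1" using finK False by (auto simp: k1_def)
      have K'in: "i \<in> {n..<k1}" if "i \<in> K'" for i
      proof -
        have "i \<in> K" "i \<noteq> k1" "i \<in> {n..<k}" using that Kk by (auto simp: K'_def)
        then show ?thesis using k1(2)[of i] by simp
      qed
      then have "K' \<subseteq> {n..<k1}" by (rule subsetI)
      moreover have "K = insert k1 K'" "k1 \<in> {n..<k}" using k1(1) Kk by (auto simp: K'_def)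
      ultimately have KK: "K = insert k1 K'" "K' \<subseteq> {n..<k1}" "n \<le> k1" "k1 < k" by simp_all
      obtain C where "C \<in> tails (insert k K) (S n)" using ne by blast
      then have "insert k C \<in> tails K (S n)"
        using Kk by (auto simp: tails_def)
      then have "tails (insert k1 K') (S n) \<noteq> {}" using KK by auto
      then have "rk_ge (omul (tau n 0) (rank n (insert k1 K')))
          (tails ((\<Union>i\<in>K'. lev (f i) n) \<union> lev (f k1) n) (Fs (m n)))"
        using prem[OF \<open>k1 < k\<close>] KK by (simp add: good_layer_def)
      moreover have "(\<Union>i\<in>K'. lev (f i) n) \<union> lev (f k1) n = U n K" by (auto simp: U_def KK(1))
      ultimately show ?thesis using KK(1) by simp
    qed
    moreover have "ole (BS (rank n (insert k K))) (rank n K)"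
      using rank(2)[of K k n] finK Kk ne by (force simp: olt_def)
    then have "ole (oadd (omul (tau n 0) (rank n (insert k K))) (tau n 0)) (omul (tau n 0) (rank n K))"
      using ole_omul_right by fastforce
    ultimately have "rk_ge (oadd (omul (tau n 0) (rank n (insert k K))) (tau n 0)) (tails (U n K) (Fs (m n)))"
      using rk_ge_antimono hereditary_tails[OF hered] by blast
    then show "rk_ge (tau n 0) (rich_part (omul (tau n 0) (rank n (insert k K))) (tails (U n K) (Fs (m n))))"
      by (rule rk_ge_rich_part)
  qed
  from level_all[of 0 "Suc k", unfolded level_ok_def, rule_format, of B "prev f k"] bigB
  obtain h x P where hx: "layered 0 (Suc k) (prev f k) h x P" "\<And>n. n < Suc k \<Longrightarrow> P n \<in> B n" by auto
  define l where "l = (x, P, max h (prev f k))"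
  have "rk_ge (omul (tau n 0) (rank n (insert k K))) (tails ((\<Union>i\<in>K. lev (f i) n) \<union> lev l n) (Fs (m n)))"
    if K: "K \<subseteq> {n..<k}" "n \<le> k" "tails (insert k K) (S n) \<noteq> {}" for n K
  proof -
    have "K \<in> V n" using K by (simp add: V_def)
    then have "P n \<in> rich_part (omul (tau n 0) (rank n (insert k K))) (tails (U n K) (Fs (m n)))"
      using hx(2)[of n] K by (auto simp: B_def)
    then have "rk_ge (omul (tau n 0) (rank n (insert k K))) (tails (P n) (tails (U n K) (Fs (m n))))"
      by (simp add: rich_part_def)
    moreover have "tails (P n) (tails (U n K) (Fs (m n))) = tails (U n K \<union> P n) (Fs (m n))"
    proof (rule tails_tails)
      fix a b assume ab: "a \<in> U n K" "b \<in> P n"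
      then obtain i where i: "i \<in> K" "a \<in> lev (f i) n" by (auto simp: U_def)
      then have ik: "i < k" "n \<le> i" using K by auto
      have "a \<le> prev f k"
        using good_layer_bounds[OF prem ik] i(2) by force
      moreover have "P n \<subseteq> {prev f k<..h}" using hx(1) K(2) by (simp add: layered_def)
      then have "prev f k < b" using ab(2) by auto
      ultimately show "a < b" by simp
    qed
    ultimately show ?thesis by (simp add: U_def lev_def l_def)
  qed
  moreover have "layered 0 (Suc k) (prev f k) (max h (prev f k)) x P"
    by (rule layered_cong[OF hx(1)]) auto
  ultimately have "good_layer f k l" by (simp add: good_layer_def l_def lev_def)
  then show ?thesis ..
qed

lemma good_layers: "\<exists>f. \<forall>k. good_layer f k (f k)"
proof (rule dependent_wellorder_choice)
  fix r and f g :: "nat \<Rightarrow> layer" and k :: nat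
  assume fg: "\<And>y. y < k \<Longrightarrow> f y = g y"
  have "prev f k = prev g k" using fg by (auto simp: prev_def split: nat.split)
  moreover have "(\<Union>i\<in>K. lev (f i) n) = (\<Union>i\<in>K. lev (g i) n)" if "K \<subseteq> {n..<k}" for K n
    using that fg by (intro SUP_cong refl) auto
  ultimately show "good_layer f k r = good_layer g k r" by (simp add: good_layer_def)
qed (rule good_layer_exists)

theorem spreading_sequence:
  "\<exists>xs. (\<forall>k. c00 (xs k) \<and> supp (xs k) \<subseteq> M \<and> Tn (xs k) = 1) \<and>
    (\<forall>n K a. K \<in> S n \<longrightarrow> finite K \<longrightarrow> (\<forall>k\<in>K. n \<le> k) \<longrightarrow>
      (\<Sum>k\<in>K. \<bar>a k\<bar>) / bound 0 \<le> Tn (\<lambda>i. \<Sum>k\<in>K. a k * xs k i))"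
proof -
  obtain f where f: "\<And>k. good_layer f k (f k)" using good_layers by blast
  define u where "u k = fst (f k)" for k
  define P where "P k = lev (f k)" for k
  have lay: "layered 0 (Suc k) (prev f k) (snd (snd (f k))) (u k) (P k)" for k
    using f[of k] by (simp add: good_layer_def u_def P_def)
  have u0: "0 \<le> u k i" for k i using lay[of k] by (simp add: layered_def)
  have suppu: "supp (u k) \<subseteq> M \<inter> {prev f k<..snd (snd (f k))}" for k
    using lay[of k] by (simp add: layered_def)
  have Pin: "P k n \<subseteq> {prev f k<..snd (snd (f k))}" "1 / \<theta> (m n) \<le> (\<Sum>i\<in>P k n. u k i)"
      if "n \<le> k" for n k
    using lay[of k] that by (simp_all add: layered_def)
  have c00u: "c00 (u k)" for k
    unfolding c00_supp by (rule finite_subset[OF suppu]) simp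
  have order: "snd (snd (f i)) \<le> prev f k" if "i < k" for i k
    using good_layer_bounds(2)[OF f that, of 0] by simp
  have disj: "{prev f i<..snd (snd (f i))} \<inter> {prev f k<..snd (snd (f k))} = {}" if "i \<noteq> k" for i k
    using that order[of i k] order[of k i] by (cases "i < k") auto
  have upper: "Tn (u k) \<le> bound 0" for k
  proof (rule Tn_le[OF c00u])
    fix g assume g: "norming \<theta> Fs g"
    show "ev g (u k) \<le> bound 0"
    proof (cases "supp g = {}")
      case True
      then have "ev g (u k) = 0" by (simp add: ev_def supp_def)
      then show ?thesis using bound_nonneg by simp
    next
      case False
      \<comment> \<open>Because \<open>H 0 = sing\<close>, a single functional counts as an
        admissible sequence, and \<open>bound 0\<close> bounds the norm.\<close>
      then have "admissible (H 0) (map supp [g])"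
        using finite_supp_norming[OF g] by (simp add: admissible_def H0 sing_def)
      then have "(\<Sum>g\<leftarrow>[g]. ev g (u k)) \<le> bound 0"
        using lay[of k] g unfolding layered_def
          by (metis empty_iff insert_iff list.set(1) list.simps(15))
      then show ?thesis by simp
    qed
  qed
  have b0: "0 < bound 0" using eps by (simp add: bound_def add_pos_pos)
  have pos: "0 < Tn (u k)" for k
  proof -
    have "0 < (\<Sum>i\<in>P k 0. u k i)" using Pin(2)[of 0 k] theta_pos[of "m 0"]
      by (meson divide_pos_pos le0 order_less_le_trans zero_less_one)
    then obtain i where "u k i \<noteq> 0" by (metis less_irrefl sum.neutral)
    then have "0 < \<bar>u k i\<bar>" by simp
    also have "\<dots> \<le> Tn (u k)" by (rule T_norm_ge_coord[OF is_T_norm_Tn c00u])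
    finally show ?thesis .
  qed
  define xs where "xs k = (\<lambda>i. 1 / Tn (u k) * u k i)" for k
  have "c00 (xs k) \<and> supp (xs k) \<subseteq> M \<and> Tn (xs k) = 1" for k
  proof (intro conjI)
    have "supp (xs k) \<subseteq> supp (u k)" by (auto simp: supp_def xs_def)
    then show "c00 (xs k)" "supp (xs k) \<subseteq> M"
      using c00u[of k] suppu[of k] finite_subset by (auto simp: c00_supp)
    show "Tn (xs k) = 1" unfolding xs_def using pos[of k] by (subst Tn_scale[OF c00u]) auto
  qed
  moreover have "(\<Sum>k\<in>K. \<bar>a k\<bar>) / bound 0 \<le> Tn (\<lambda>i. \<Sum>k\<in>K. a k * xs k i)"
    if K: "K \<in> S n" "finite K" "\<forall>k\<in>K. n \<le> k" for n K a
  proof -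
    define y where "y = (\<lambda>i. \<Sum>k\<in>K. a k * xs k i)"
    define A where "A = (\<Union>k\<in>K. P k n)"
    have finP: "finite (P k n)" if "k \<in> K" for k
      by (rule finite_subset[OF Pin(1)]) (use K(3) that in auto)
    have th: "0 < \<theta> (m n)" by (rule theta_pos)
    have "c00 (xs k)" for k using c00u[of k] by (simp add: c00_def xs_def)
    then have c00y: "c00 y" unfolding y_def by (intro c00_sum K(2))
    \<comment> \<open>The reserve condition is read off at the last index of \<open>K\<close>.
      Whatever rank is left there, \<open>{}\<close> belongs to the tails above \<open>A\<close>,
      and this is membership of \<open>A\<close> itself.\<close>
    have "A \<in> Fs (m n)"
    proof (cases "K = {}")
      case True
      have "{} \<in> Fs (m n)" by (rule rk_ge_imp_empty_mem[OF rk_ge_Fs hered])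
      then show ?thesis using True by (simp add: A_def)
    next
      case False
      define k1 where "k1 = Max K"
      have k1: "k1 \<in> K" "\<And>i. i \<in> K \<Longrightarrow> i \<le> k1" using K(2) False by (auto simp: k1_def)
      have "i \<in> {n..<k1}" if "i \<in> K - {k1}" for i
        using that K(3) k1(2)[of i] by simp
      then have "K - {k1} \<subseteq> {n..<k1}" by (rule subsetI)
      moreover have "insert k1 (K - {k1}) = K" "n \<le> k1" using K(3) k1(1) by auto
      ultimately have KK: "insert k1 (K - {k1}) = K" "K - {k1} \<subseteq> {n..<k1}" "n \<le> k1"
        by simp_all
      moreover have "{} \<in> tails (insert k1 (K - {k1})) (S n)" using K(1) KK(1)
        by (simp add: tails_def)
      ultimately have "rk_ge (omul (tau n 0) (rank n (insert k1 (K - {k1}))))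
          (tails ((\<Union>i\<in>K - {k1}. lev (f i) n) \<union> lev (f k1) n) (Fs (m n)))"
        using f[of k1] unfolding good_layer_def by blast
      moreover have "(\<Union>i\<in>K - {k1}. lev (f i) n) \<union> lev (f k1) n = A"
        using k1(1) by (auto simp: A_def P_def)
      ultimately have "{} \<in> tails A (Fs (m n))"
        using rk_ge_imp_empty_mem[OF _ hereditary_tails[OF hered]] by auto
      then show ?thesis by (simp add: tails_def)
    qed
    moreover have "finite A" using K(2) finP by (simp add: A_def)
    ultimately have low: "\<theta> (m n) * (\<Sum>i\<in>A. \<bar>y i\<bar>) \<le> Tn y" by (rule Tn_lower[OF c00y])
    have "(\<Sum>k\<in>K. \<bar>a k\<bar>) / bound 0 / \<theta> (m n) \<le> (\<Sum>i\<in>A. \<bar>y i\<bar>)"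
    proof -
      have "(\<Sum>i\<in>A. \<bar>y i\<bar>) = (\<Sum>k\<in>K. \<Sum>i\<in>P k n. \<bar>y i\<bar>)"
        unfolding A_def
      proof (rule sum.UNION_disjoint)
        show "\<forall>i\<in>K. \<forall>j\<in>K. i \<noteq> j \<longrightarrow> P i n \<inter> P j n = {}"
        proof (intro ballI impI)
          fix i j assume "i \<in> K" "j \<in> K" "i \<noteq> j"
          then show "P i n \<inter> P j n = {}"
            using Pin(1)[of n i] Pin(1)[of n j] disj[of i j] K(3) by blast
        qed
      qed (use K(2) finP in auto)
      moreover have "\<bar>a k\<bar> / bound 0 / \<theta> (m n) \<le> (\<Sum>i\<in>P k n. \<bar>y i\<bar>)" if k: "k \<in> K" for k
      proof -
        have "y i = a k * xs k i" if i: "i \<in> P k n" for i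
        proof -
          have "a j * xs j i = 0" if "j \<in> K - {k}" for j
          proof -
            have "i \<notin> {prev f j<..snd (snd (f j))}"
              using disj[of j k] Pin(1)[of n k] K(3) k i that by blast
            then have "u j i = 0" using suppu[of j] by (auto simp: supp_def)
            then show ?thesis by (simp add: xs_def)
          qed
          then have "(\<Sum>j\<in>K - {k}. a j * xs j i) = 0" by (rule sum.neutral[rule_format])
          then show ?thesis unfolding y_def using sum.remove[OF K(2) k, of "\<lambda>j. a j * xs j i"]
            by simp
        qed
        then have "(\<Sum>i\<in>P k n. \<bar>y i\<bar>) = \<bar>a k\<bar> / Tn (u k) * (\<Sum>i\<in>P k n. u k i)"
          using u0 pos[of k] by (simp add: xs_def sum_distrib_left abs_mult abs_of_nonneg)
        \<comment> \<open>Normalising divides by at most \<open>bound 0\<close>, and the factor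
          \<open>1 / \<theta> (m n)\<close> of the level mass cancels the weight paid in
          \<open>low\<close>; hence the constant does not depend on \<open>n\<close>.\<close>
        moreover have "\<bar>a k\<bar> / bound 0 * (1 / \<theta> (m n)) \<le> \<bar>a k\<bar> / Tn (u k) * (\<Sum>i\<in>P k n. u k i)"
        proof (rule mult_mono)
          show "\<bar>a k\<bar> / bound 0 \<le> \<bar>a k\<bar> / Tn (u k)"
            using upper[of k] pos[of k] b0 by (intro divide_left_mono) auto
          show "1 / \<theta> (m n) \<le> (\<Sum>i\<in>P k n. u k i)" using Pin(2) K(3) k by blast
        qed (use pos[of k] th in auto)
        ultimately show ?thesis by simp
      qed
      ultimately show ?thesis
        by (simp add: sum_divide_distrib sum_mono)
    qed
    then have "\<theta> (m n) * ((\<Sum>k\<in>K. \<bar>a k\<bar>) / bound 0 / \<theta> (m n)) \<le> \<theta> (m n) * (\<Sum>i\<in>A. \<bar>y i\<bar>)"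
      using th by (intro mult_left_mono) simp_all
    then show ?thesis using low th unfolding y_def[symmetric] by simp
  qed
  ultimately show ?thesis by blast
qed

end

section \<open>Schreier families and the choice of levels\<close>

lemma oeq_sym: "oeq a b \<Longrightarrow> oeq b a"
  by (simp add: oeq_def)

lemma oeq_trans: "oeq a b \<Longrightarrow> oeq b c \<Longrightarrow> oeq a c"
  by (meson oeq_def ole_trans)

lemma oeq_BS: "oeq (BS a) (BS b) \<longleftrightarrow> oeq a b"
  by (simp add: oeq_def)

lemma is_limit_cong: "oeq b b' \<Longrightarrow> is_limit b \<Longrightarrow> is_limit b'"
  unfolding is_limit_def using oeq_trans by blast

lemma schreier_cong:
  assumes sq: "valid_seq sq" and b: "oeq b b'" and F: "schreier sq b F"
  shows "schreier sq b' F"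
  using F
proof cases
  case sch_zero
  then show ?thesis using oeq_trans[OF oeq_sym[OF b]] schreier.sch_zero by blast
next
  case (sch_suc c Es)
  show ?thesis
    unfolding sch_suc(1)
    by (rule schreier.sch_suc[OF oeq_trans[OF oeq_sym[OF b] sch_suc(2)] sch_suc(3,4)])
next
  case (sch_lim n)
  have "sq b = sq b'" using sq b by (simp add: valid_seq_def)
  then show ?thesis using schreier.sch_lim[OF is_limit_cong[OF b sch_lim(1)], of F n sq] sch_lim
    by simp
qed

lemma schreier_finite: "schreier sq b F \<Longrightarrow> finite F"
  by (induction rule: schreier.induct) auto

lemma rk_lt_ofnat: "(\<And>B. B \<in> G \<Longrightarrow> finite B \<and> card B < k) \<Longrightarrow> rk_lt (ofnat k) G"
proof (induction k arbitrary: G)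
  case (Suc k)
  have "rk_lt (ofnat k) (tails {n} G)" for n
  proof (rule Suc.IH)
    fix B assume B: "B \<in> tails {n} G"
    then have "insert n B \<in> G" "n \<notin> B" by (auto simp: tails_def)
    then show "finite B \<and> card B < k" using Suc.prems[of "insert n B"] by auto
  qed
  then show ?case by simp
qed auto

text \<open>In the shifted indexing a set with minimum \<open>n\<close> has at most
  \<open>n + 1\<close> elements, so at most \<open>n\<close> remain after the minimum is
  removed.\<close>

lemma rk_lt_schreier1: "rk_lt (BS omega) schreier1"
proof -
  have "rk_lt (ofnat (Suc n)) (tails {n} schreier1)" for n
  proof (rule rk_lt_ofnat)
    fix B assume "B \<in> tails {n} schreier1"
    then have B: "insert n B \<in> schreier1" "\<forall>b\<in>B. n < b" by (auto simp: tails_def)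
    then have "finite B" "n \<notin> B" by (auto simp: schreier1_def)
    moreover from this B(2) have "Min (insert n B) = n" by (intro Min_eqI) (auto intro: less_imp_le)
    ultimately show "finite B \<and> card B < Suc n" using B(1) by (simp add: schreier1_def)
  qed
  then have "\<exists>k. rk_lt (ofnat k) (tails {n} schreier1)" for n by (rule exI)
  then show ?thesis unfolding omega_def rk_lt.simps ..
qed

lemma schreier_zero_subset:
  assumes "oeq b BZ"
  shows "{F. schreier sq b F} \<subseteq> sing"
proof
  fix F assume "F \<in> {F. schreier sq b F}"
  then have "schreier sq b F" by simp
  then show "F \<in> sing"
  proof cases
    case sch_zero
    have "\<exists>i. F \<subseteq> {i}"
    proof (cases "F = {}")
      case False
      then obtain i where "i \<in> F" by blast
      then have "F \<subseteq> {i}" using sch_zero(2,3) by (auto simp: card_le_Suc0_iff_eq)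
      then show ?thesis ..
    qed simp
    then show ?thesis by (simp add: sing_def)
  next
    case (sch_suc c Es)
    have "oeq (BS c) BZ" by (rule oeq_trans[OF oeq_sym[OF sch_suc(2)] assms])
    then show ?thesis by (simp add: oeq_def)
  next
    case (sch_lim n)
    then show ?thesis using assms by (simp add: is_limit_def)
  qed
qed

lemma schreier_suc_subset:
  assumes sq: "valid_seq sq" and "oeq x (BS b)"
  shows "{F. schreier sq x F} \<subseteq> comp_fam schreier1 {F. schreier sq b F}"
proof
  fix F assume "F \<in> {F. schreier sq x F}"
  then have "schreier sq x F" by simp
  then show "F \<in> comp_fam schreier1 {F. schreier sq b F}"
  proof cases
    case sch_zero
    have "oeq (BS b) BZ" by (rule oeq_trans[OF oeq_sym[OF assms(2)] sch_zero(1)])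
    then show ?thesis by (simp add: oeq_def)
  next
    case (sch_suc c Es)
    have "oeq (BS c) (BS b)" by (rule oeq_trans[OF oeq_sym[OF sch_suc(2)] assms(2)])
    then have cb: "oeq c b" by (simp add: oeq_BS)
    define egs where "egs = map (\<lambda>E. (E, ())) Es"
    have "map fst egs = Es" by (simp add: egs_def comp_def)
    then have "(\<Union>p\<in>set egs. fst p) \<in> comp_fam schreier1 {F. schreier sq b F}"
      using sch_suc(3,4) schreier_cong[OF sq cb]
      by (intro comp_fam_union) (auto simp: egs_def)
    moreover have "(\<Union>p\<in>set egs. fst p) = F" unfolding sch_suc(1) by (auto simp: egs_def)
    ultimately show ?thesis by simp
  next
    case (sch_lim n)
    then show ?thesis using assms by (auto simp: is_limit_def)
  qed
qed

text \<open>Once the least element \<open>k\<close> is known, only the families with index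
  \<open>n \<le> k\<close> are possible, and their finite union keeps the rank bound.\<close>

lemma rk_lt_schreier_limit:
  assumes lim: "is_limit x"
    and IH: "\<And>n. rk_lt (BS (opow omega (sq x n))) {F. schreier sq (sq x n) F}"
    and le: "\<And>n. ole (sq x n) x"
  shows "rk_lt (BS (opow omega x)) {F. schreier sq x F}"
  unfolding rk_lt.simps
proof
  fix k
  have "tails {k} {F. schreier sq x F} \<subseteq> (\<Union>n\<in>{..k}. tails {k} {F. schreier sq (sq x n) F})"
  proof
    fix B assume B: "B \<in> tails {k} {F. schreier sq x F}"
    then have "schreier sq x (insert k B)" by (simp add: tails_def)
    then obtain n where "\<forall>y\<in>insert k B. n \<le> y" "schreier sq (sq x n) (insert k B)"
      using lim by cases (auto simp: is_limit_def)
    then show "B \<in> (\<Union>n\<in>{..k}. tails {k} {F. schreier sq (sq x n) F})"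
      using B by (auto simp: tails_def)
  qed
  moreover have "rk_lt (opow omega x) (\<Union>n\<in>{..k}. tails {k} {F. schreier sq (sq x n) F})"
  proof (rule rk_lt_UN)
    fix n
    have "rk_lt (opow omega (sq x n)) (tails {k} {F. schreier sq (sq x n) F})"
      using IH[of n] by simp
    then show "rk_lt (opow omega x) (tails {k} {F. schreier sq (sq x n) F})"
      by (rule rk_lt_mono[OF ole_wpow[OF le]])
  qed simp
  ultimately show "rk_lt (opow omega x) (tails {k} {F. schreier sq x F})"
    using rk_lt_antimono by blast
qed

lemma valid_seq_below:
  assumes "valid_seq sq" "is_limit x"
  shows "olt (sq x n) x"
proof -
  have "olt (sq x n) (sq x (Suc n))" "oeq (BL (sq x)) x"
    using assms by (auto simp: valid_seq_def)
  moreover have "ole (sq x (Suc n)) (BL (sq x))" by (rule ole_cocone) (rule ole_refl)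
  ultimately show ?thesis unfolding oeq_def by (meson olt_ole_trans)
qed

text \<open>The induction runs over a tree \<open>b\<close> above \<open>x\<close>, not over
  \<open>x\<close>: the trees \<open>sq x n\<close> are smaller as ordinals but need not be subtrees
  of \<open>x\<close>. The hypothesis \<open>ole x b\<close> makes the induction available for
  them.\<close>

lemma rk_lt_schreier:
  assumes sq: "valid_seq sq"
  shows "ole x b \<Longrightarrow> rk_lt (BS (opow omega x)) {F. schreier sq x F}"
proof (induction b arbitrary: x)
  case BZ
  then have "oeq x BZ" by (simp add: oeq_def ole_zero)
  then have "rk_lt (BS (BS BZ)) {F. schreier sq x F}"
    by (rule rk_lt_antimono[OF rk_lt_sing schreier_zero_subset])
  moreover have "ole (BS (BS BZ)) (BS (opow omega x))" using wpow_pos[of x] by (simp add: olt_def)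
  ultimately show ?case using rk_lt_mono by blast
next
  case (BS b)
  show ?case
  proof (cases "ole x b")
    case False
    then have x: "oeq x (BS b)" using BS.prems ole_total[of x b] by (simp add: oeq_def)
    have "rk_lt (BS (omul (opow omega b) omega)) (comp_fam schreier1 {F. schreier sq b F})"
      by (rule rk_lt_comp[OF BS.IH[OF ole_refl] rk_lt_schreier1])
    then have "rk_lt (BS (opow omega (BS b))) {F. schreier sq x F}"
      unfolding opow.simps by (rule rk_lt_antimono[OF _ schreier_suc_subset[OF sq x]])
    moreover have "ole (BS (opow omega (BS b))) (BS (opow omega x))"
      using x ole_wpow[of "BS b" x] by (simp add: oeq_def)
    ultimately show ?thesis using rk_lt_mono by blast
  qed (rule BS.IH)
next
  case (BL f)
  show ?case
  proof (cases "\<exists>k. ole x (f k)")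
    case True
    then show ?thesis using BL.IH by blast
  next
    case False
    have lim: "is_limit x"
      unfolding is_limit_def
    proof (intro conjI notI)
      assume "oeq x BZ"
      then have "ole x BZ" by (simp add: oeq_def)
      then have "ole x (f 0)" by (rule ole_trans) (rule ole_zero)
      then show False using False by blast
    next
      assume "\<exists>c. oeq x (BS c)"
      then obtain c where c: "ole x (BS c)" "ole (BS c) x" by (auto simp: oeq_def)
      from ole_trans[OF c(2) BL.prems] obtain k where "ole (BS c) (f k)" by (auto simp: ole_BS_BL)
      from ole_trans[OF c(1) this] show False using False by blast
    qed
    show ?thesis
    proof (rule rk_lt_schreier_limit[where sq = sq, OF lim])
      fix n
      have below: "olt (sq x n) x" by (rule valid_seq_below[OF sq lim])
      then show "ole (sq x n) x" by (rule olt_imp_ole)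
      from olt_ole_trans[OF below BL.prems] obtain k where "olt (sq x n) (f k)"
        by (auto simp: olt_def ole_BS_BL)
      then show "rk_lt (BS (opow omega (sq x n))) {F. schreier sq (sq x n) F}"
        using BL.IH[OF rangeI olt_imp_ole] by blast
    qed
  qed
qed

section \<open>Products of indices and the choice of a level\<close>

lemma omul_pos: "olt BZ a \<Longrightarrow> olt BZ b \<Longrightarrow> olt BZ (omul a b)"
  using olt_omul_right[of a BZ b] by simp

lemma oprodl_pos: "(\<And>n. olt BZ (alpha n)) \<Longrightarrow> olt BZ (oprodl alpha ns)"
  by (induction ns) (auto intro: omul_pos)

text \<open>A crude bound for products along arbitrary branches. It serves the fine thresholds,
  below the range of weights that \<open>gamma\<close> controls.\<close>

lemma oprodl_bounded:
  assumes x: "olt BZ x" and alpha: "\<And>n. olt (alpha n) (opow omega (opow omega x))"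
  shows "\<exists>e. olt e (opow omega x) \<and> ole (oprodl alpha ns) (opow omega e)"
proof (induction ns)
  case Nil
  show ?case by (rule exI[of _ BZ]) (simp add: wpow_pos)
next
  case (Cons n ns)
  then obtain e where e: "olt e (opow omega x)" "ole (oprodl alpha ns) (opow omega e)" by blast
  obtain e' where e': "olt e' (opow omega x)" "ole (alpha n) (opow omega e')"
    using bounded_below_wwpow[OF x alpha] by blast
  have "ole (oprodl alpha (n # ns)) (opow omega (oadd e e'))"
    unfolding oprodl.simps opow_oadd by (rule ole_omul[OF e(2) e'(2)])
  then show ?case using oadd_lt_wpow[OF e(1) e'(1)] by blast
qed

context mixed_tsirelson
begin

lemma prod_theta_bounds:
  "0 < prod_list (map \<theta> ns)" "prod_list (map \<theta> ns) \<le> \<theta> 0 ^ length ns"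
  "n \<in> set ns \<Longrightarrow> prod_list (map \<theta> ns) \<le> \<theta> n"
proof -
  show pos: "0 < prod_list (map \<theta> ns)" for ns using theta_pos by (induction ns) auto
  show "prod_list (map \<theta> ns) \<le> \<theta> 0 ^ length ns"
  proof (induction ns)
    case (Cons n ns)
    then show ?case using theta_le[of n] theta_pos[of n] pos[of ns] theta_pos[of 0]
      by (simp add: mult_mono less_imp_le)
  qed simp
  have le1: "prod_list (map \<theta> ns) \<le> 1" for ns
    using theta_lt_1 pos theta_pos by (induction ns) (auto intro!: mult_le_one simp: less_imp_le)
  show "n \<in> set ns \<Longrightarrow> prod_list (map \<theta> ns) \<le> \<theta> n"
  proof (induction ns)
    case (Cons k ns)
    show ?case
    proof (cases "n = k")
      case True
      then show ?thesis using le1[of ns] theta_pos[of k] by (simp add: mult_left_le)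
    next
      case False
      then have "prod_list (map \<theta> ns) \<le> \<theta> n" using Cons by simp
      moreover have "\<theta> k * prod_list (map \<theta> ns) \<le> prod_list (map \<theta> ns)"
        using theta_lt_1[of k] theta_pos[of k] pos[of ns] by (simp add: mult_left_le_one_le)
      ultimately show ?thesis by simp
    qed
  qed simp
qed

text \<open>Every entry of such a list satisfies \<open>\<theta> n > \<mu>\<close>, and powers of
  \<open>\<theta> 0\<close> bound the length. The maximum in \<open>gamma\<close> is therefore taken
  over a finite set and is attained.\<close>

lemma finite_heavy_lists:
  assumes "0 < \<mu>"
  shows "finite {ns. \<mu> < prod_list (map \<theta> ns)}"
proof -
  define I where "I = {n. \<mu> < 1 * \<theta> n}"
  have I: "finite I" unfolding I_def using assms by (intro finite_large_theta) simp_all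
  obtain L where L: "\<theta> 0 ^ L < \<mu>" using real_arch_pow_inv[OF assms theta0] by blast
  have "{ns. \<mu> < prod_list (map \<theta> ns)} \<subseteq> {ns. set ns \<subseteq> I \<and> length ns \<le> L}"
  proof
    fix ns assume "ns \<in> {ns. \<mu> < prod_list (map \<theta> ns)}"
    then have ns: "\<mu> < prod_list (map \<theta> ns)" by simp
    have "set ns \<subseteq> I"
      using ns prod_theta_bounds(3)[of _ ns] by (fastforce simp: I_def)
    moreover have "length ns \<le> L"
    proof (rule ccontr)
      assume "\<not> length ns \<le> L"
      then have "\<theta> 0 ^ length ns \<le> \<theta> 0 ^ L"
        using theta0 theta_pos[of 0] by (intro power_decreasing) auto
      then show False using L ns prod_theta_bounds(2)[of ns] by linarith
    qed
    ultimately show "ns \<in> {ns. set ns \<subseteq> I \<and> length ns \<le> L}" by simp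
  qed
  then show ?thesis using finite_lists_length_le[OF I] finite_subset by blast
qed

text \<open>The empty list is excluded in \<open>gamma\<close> but may come from a cut; its product
  is 1, which lies below any power of omega with nonzero exponent.\<close>

lemma oprodl_lt_gamma:
  assumes alpha: "\<And>n. olt BZ (alpha n)" and eps: "0 < \<epsilon>"
    and ns: "\<theta> m < \<epsilon> * prod_list (map \<theta> ns)"
  shows "olt (oprodl alpha ns) (opow omega (BS (gamma \<theta> alpha \<epsilon> m)))"
proof (cases "ns = []")
  case True
  have "olt BZ (BS (gamma \<theta> alpha \<epsilon> m))" by (simp add: ole_zero)
  from one_lt_wpow[OF this] True show ?thesis by simp
next
  case False
  define X where "X = {lead (oprodl alpha ns) | ns. ns \<noteq> [] \<and> \<epsilon> * prod_list (map \<theta> ns) > \<theta> m}"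
  have "finite {ns. \<theta> m / \<epsilon> < prod_list (map \<theta> ns)}"
    using eps theta_pos[of m] by (intro finite_heavy_lists) simp
  then have "finite ((\<lambda>ns. lead (oprodl alpha ns)) ` {ns. \<theta> m / \<epsilon> < prod_list (map \<theta> ns)})" by simp
  then have "finite X" by (rule rev_finite_subset) (use eps in \<open>auto simp: X_def field_simps\<close>)
  moreover have "lead (oprodl alpha ns) \<in> X" using False ns by (auto simp: X_def)
  ultimately have "ole (lead (oprodl alpha ns)) (gamma \<theta> alpha \<epsilon> m)"
    unfolding gamma_def X_def[symmetric] by (rule omax_spec)
  then have "ole (opow omega (BS (lead (oprodl alpha ns)))) (opow omega (BS (gamma \<theta> alpha \<epsilon> m)))"
    by (intro ole_wpow) simp
  then show ?thesis by (rule olt_ole_trans[OF lead_spec(2)[OF oprodl_pos[OF alpha]]])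
qed

text \<open>Adding such a \<open>c\<close> to the slack in the dagger condition forces the index it
  supplies past the first \<open>k\<close> ones.\<close>

lemma bounded_initial_leads:
  assumes "\<And>n. olt (lead (alpha n)) (opow omega \<xi>)"
  shows "\<exists>c. olt c (opow omega \<xi>) \<and> (\<forall>i<(k::nat). ole (lead (alpha i)) c)"
proof (induction k)
  case 0
  show ?case by (rule exI[of _ BZ]) (simp add: wpow_pos)
next
  case (Suc k)
  then obtain c where c: "olt c (opow omega \<xi>)" "\<And>i. i < k \<Longrightarrow> ole (lead (alpha i)) c" by blast
  have "ole (lead (alpha i)) (oadd c (lead (alpha k)))" if "i < Suc k" for i
  proof (cases "i = k")
    case False
    then show ?thesis using c(2)[of i] that ole_trans[OF _ ole_oadd_self] by simp
  qed (simp add: ole_oadd_self2)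
  then show ?case using oadd_lt_wpow[OF c(1) assms] by blast
qed

text \<open>Here \<open>e\<close> bounds the order of the family \<open>H\<close> of cuts on earlier
  levels, \<open>s\<close> is the sum of the exponents of the averages already fixed, and
  \<open>b\<close> is the exponent of the Schreier family that the new level has to serve.\<close>

lemma level_exists:
  assumes xi: "olt BZ \<xi>" and eps: "0 < \<epsilon>"
    and alpha_pos: "\<And>n. olt BZ (alpha n)"
    and alpha_lt: "\<And>n. olt (alpha n) (opow omega (opow omega \<xi>))"
    and alpha_rk_lt: "\<And>n. rk_lt (BS (alpha n)) (Fs n)" and alpha_rk_ge: "\<And>n. rk_ge (alpha n) (Fs n)"
    and hered: "\<And>n. hereditary (Fs n)"
    and dagger: "\<And>\<beta>. olt \<beta> (opow omega \<xi>) \<Longrightarrow>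
        \<exists>m. olt (oadd (oadd (gamma \<theta> alpha \<epsilon> m) (BS (BS BZ))) \<beta>) (lead (alpha m))"
    and e: "olt e (opow omega \<xi>)" and s: "olt s (opow omega \<xi>)" and b: "olt b (opow omega \<xi>)"
    and H: "rk_lt (BS (opow omega e)) H" and r: "0 < r"
  shows "\<exists>m D \<delta> e'. \<theta> m \<le> \<epsilon> / 2 \<and> \<theta> 0 ^ D \<le> \<theta> m / \<epsilon> \<and> olt \<delta> (opow omega \<xi>) \<and>
      rk_lt (opow omega \<delta>) (comp_fam H (fam (\<theta> m / \<epsilon>) D 1)) \<and> olt e' (opow omega \<xi>) \<and>
      rk_lt (BS (opow omega e')) (comp_fam H (fam (\<theta> m * min r (1 / \<epsilon>)) D 1)) \<and>
      rk_ge (opow omega (oadd (oadd \<delta> s) b)) (Fs m)"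
proof -
  have one: "olt (BS BZ) (opow omega \<xi>)" by (rule one_lt_wpow[OF xi])
  have lead_le: "ole (opow omega (lead (alpha n))) (alpha n)" for n
    by (rule lead_spec(1)[OF alpha_pos])
  have lead_lt: "olt (lead (alpha n)) (opow omega \<xi>)" for n
    using ole_olt_trans[OF lead_le alpha_lt] by (simp only: olt_wpow_iff)
  have "eventually (\<lambda>n. \<theta> n < \<epsilon> / 2) sequentially"
    using theta_null eps by (intro order_tendstoD) auto
  then obtain n0 where n0: "\<And>n. n0 \<le> n \<Longrightarrow> \<theta> n < \<epsilon> / 2"
    unfolding eventually_sequentially by blast
  obtain c where c: "olt c (opow omega \<xi>)" "\<And>i. i < n0 \<Longrightarrow> ole (lead (alpha i)) c"
    using bounded_initial_leads[where k = n0 and alpha = alpha, OF lead_lt] by (elim exE conjE) auto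
  \<comment> \<open>The slack reserves room in \<open>lead (alpha m)\<close> for \<open>H\<close>
    and a strictness summand, for the averages of the coarser levels, and for the Schreier family;
    \<open>c\<close> is added to make \<open>\<theta> m\<close> small.\<close>
  define \<beta>0 where "\<beta>0 = oadd (oadd e (BS BZ)) (oadd s b)"
  have "olt (oadd \<beta>0 c) (opow omega \<xi>)"
    unfolding \<beta>0_def by (intro oadd_lt_wpow e one s b c(1))
  from dagger[OF this] obtain m where
    m: "olt (oadd (oadd (gamma \<theta> alpha \<epsilon> m) (BS (BS BZ))) (oadd \<beta>0 c)) (lead (alpha m))" by blast
  define g where "g = gamma \<theta> alpha \<epsilon> m"
  have "\<not> m < n0"
  proof
    assume "m < n0"
    then have "ole (lead (alpha m)) c" by (rule c(2))
    also have "ole c (oadd \<beta>0 c)" by (rule ole_oadd_self2)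
    also have "ole (oadd \<beta>0 c) (oadd (oadd (gamma \<theta> alpha \<epsilon> m) (BS (BS BZ))) (oadd \<beta>0 c))"
      by (rule ole_oadd_self2)
    also note m
    finally show False by simp
  qed
  then have th_le: "\<theta> m < \<epsilon> / 2" using n0 by simp
  have th: "0 < \<theta> m" by (rule theta_pos)
  obtain D where D: "\<theta> 0 ^ D < \<theta> m / \<epsilon>"
    using real_arch_pow_inv[of "\<theta> m / \<epsilon>" "\<theta> 0"] th eps theta0 by auto
  \<comment> \<open>\<open>BS g\<close> dominates the cuts at weight
    \<open>\<theta> m / \<epsilon>\<close>, \<open>e\<close> accounts for \<open>H\<close>, and the
    last summand makes the inequality between the powers strict.\<close>
  define \<delta> where "\<delta> = oadd (oadd (BS g) e) (BS BZ)"
  have g_lt: "olt g (opow omega \<xi>)"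
  proof -
    have "ole g (oadd (oadd g (BS (BS BZ))) (oadd \<beta>0 c))"
      by (rule ole_trans[OF ole_oadd_self ole_oadd_self])
    also note m[folded g_def]
    also note lead_lt
    finally show ?thesis .
  qed
  have "olt (oadd g (BS BZ)) (opow omega \<xi>)" by (intro oadd_lt_wpow g_lt one)
  then have delta_lt: "olt \<delta> (opow omega \<xi>)"
    unfolding \<delta>_def by (intro oadd_lt_wpow e one) simp
  have "\<theta> m / \<epsilon> < 1" using th_le eps by simp
  from rk_lt_fam[where d = D, OF alpha_rk_lt _ this] th eps obtain ns where
    ns: "\<theta> m / \<epsilon> < prod_list (map \<theta> ns)" "rk_lt (BS (oprodl alpha ns)) (fam (\<theta> m / \<epsilon>) D 1)" by auto
  have "\<theta> m < \<epsilon> * prod_list (map \<theta> ns)" using ns(1) eps by (simp add: field_simps)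
  from oprodl_lt_gamma[OF alpha_pos eps this]
  have "ole (oprodl alpha ns) (opow omega (BS g))" unfolding g_def by (rule olt_imp_ole)
  then have "ole (omul (oprodl alpha ns) (opow omega e)) (opow omega (oadd (BS g) e))"
    unfolding opow_oadd by (rule ole_omul_left)
  also have "olt (opow omega (oadd (BS g) e)) (opow omega \<delta>)"
    unfolding \<delta>_def oadd.simps by (rule wpow_lt_Suc)
  finally have "ole (BS (omul (oprodl alpha ns) (opow omega e))) (opow omega \<delta>)"
    by (simp only: olt_def)
  from rk_lt_mono[OF this rk_lt_comp[OF ns(2) H]]
  have small: "rk_lt (opow omega \<delta>) (comp_fam H (fam (\<theta> m / \<epsilon>) D 1))" .
  define \<eta> where "\<eta> = \<theta> m * min r (1 / \<epsilon>)"
  have "\<eta> \<le> \<theta> m * (1 / \<epsilon>)" unfolding \<eta>_def using th by (intro mult_left_mono) auto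
  also have "\<dots> < 1" using \<open>\<theta> m / \<epsilon> < 1\<close> by simp
  finally have "\<eta> < 1" .
  moreover have "0 < \<eta>" using th eps r by (simp add: \<eta>_def)
  ultimately have eta: "0 < \<eta>" "\<eta> < 1" by simp_all
  from rk_lt_fam[where d = D, OF alpha_rk_lt eta] obtain ns' where
    ns': "rk_lt (BS (oprodl alpha ns')) (fam \<eta> D 1)" by blast
  obtain e1 where e1: "olt e1 (opow omega \<xi>)" "ole (oprodl alpha ns') (opow omega e1)"
    using oprodl_bounded[where alpha = alpha, OF xi alpha_lt] by blast
  have "ole (BS (omul (oprodl alpha ns') (opow omega e))) (BS (opow omega (oadd e1 e)))"
    unfolding opow_oadd using ole_omul_left[OF e1(2)] by simp
  from rk_lt_mono[OF this rk_lt_comp[OF ns' H]]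
  have H': "rk_lt (BS (opow omega (oadd e1 e))) (comp_fam H (fam \<eta> D 1))" .
  have "ole (oadd (oadd \<delta> s) b) (oadd (oadd g (BS (BS BZ))) (oadd \<beta>0 c))"
  proof -
    have "oadd (oadd \<delta> s) b = oadd (BS g) \<beta>0" by (simp only: \<delta>_def \<beta>0_def oadd_assoc)
    also have "ole \<dots> (oadd (oadd g (BS (BS BZ))) \<beta>0)" by (rule ole_oadd_left) simp
    also have "ole \<dots> (oadd (oadd g (BS (BS BZ))) (oadd \<beta>0 c))"
      by (rule ole_oadd_right[OF ole_oadd_self])
    finally show ?thesis .
  qed
  also note m[folded g_def]
  finally have "ole (oadd (oadd \<delta> s) b) (lead (alpha m))" by (rule olt_imp_ole)
  then have "ole (opow omega (oadd (oadd \<delta> s) b)) (alpha m)"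
    by (rule ole_trans[OF ole_wpow lead_le])
  from rk_ge_antimono[OF this alpha_rk_ge hered]
  have "rk_ge (opow omega (oadd (oadd \<delta> s) b)) (Fs m)" .
  moreover have "olt (oadd e1 e) (opow omega \<xi>)" by (rule oadd_lt_wpow[OF e1(1) e])
  ultimately show ?thesis
    using th_le D delta_lt small H' unfolding \<eta>_def by (meson less_imp_le)
qed

end

text \<open>While levels are chosen, \<open>s\<close> grows by a new summand on the left;
  \<open>sumd\<close> starts with the newest summand and appends older ones on the right. Both yield
  \<open>\<delta> j + ... + \<delta> 0\<close>.\<close>

lemma (in tower) sumd_closed_form:
  assumes s: "s 0 = BZ" "\<And>n. s (Suc n) = oadd (\<delta> n) (s n)"
  shows "sumd j (Suc j) = s (Suc j)"
proof -
  have "oadd (sumd j t) (s (Suc j - t)) = s (Suc j)" if "t \<le> Suc j" for t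
    using that
  proof (induction t)
    case (Suc t)
    then have "Suc j - t = Suc (j - t)" by (simp add: Suc_diff_le)
    then show ?case using Suc s(2)[of "j - t"] by (simp add: oadd_assoc)
  qed simp
  from this[of "Suc j"] show ?thesis by (simp add: s(1))
qed

theorem theorem4:
  fixes \<theta> :: "nat \<Rightarrow> real" and Fs :: "nat \<Rightarrow> nat set set"
    and alpha :: "nat \<Rightarrow> bord" and \<xi> :: bord and sq :: "bord \<Rightarrow> nat \<Rightarrow> bord"
  assumes theta_range: "\<forall>n. 0 < \<theta> n \<and> \<theta> n < 1"
    and theta_noninc: "\<forall>n. \<theta> (Suc n) \<le> \<theta> n"
    and theta_null: "\<theta> \<longlonglongrightarrow> 0"
    and regular: "\<forall>n. regular_family (Fs n)"
    and index: "\<forall>n. cb_index (Fs n) (alpha n)"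
    and index_gt1: "\<forall>n. olt (BS BZ) (alpha n)"
    and sup_not_attained: "\<forall>n. \<not> oeq (BL alpha) (alpha n)"
    and sup_eq: "oeq (BL alpha) (opow omega (opow omega \<xi>))"
    and xi_pos: "olt BZ \<xi>"
    and dagger: "\<exists>\<epsilon>>0. \<forall>\<beta>. olt \<beta> (opow omega \<xi>) \<longrightarrow>
                   (\<exists>m. olt (oadd (oadd (gamma \<theta> alpha \<epsilon> m) (BS (BS BZ))) \<beta>) (lead (alpha m)))"
    and seq: "valid_seq sq"
  shows "\<forall>M. infinite M \<longrightarrow> (\<exists>xs. (\<forall>k. xs k \<in> closed_span \<theta> Fs M)
            \<and> l1_spreading_model \<theta> Fs (Collect (schreier sq (opow omega \<xi>))) xs)"
proof (intro allI impI)
  fix M :: "nat set" assume M: "infinite M"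
  let ?W = "opow omega \<xi>"
  obtain \<epsilon> where eps: "0 < \<epsilon>" and dag: "\<And>\<beta>. olt \<beta> ?W \<Longrightarrow>
      \<exists>m. olt (oadd (oadd (gamma \<theta> alpha \<epsilon> m) (BS (BS BZ))) \<beta>) (lead (alpha m))"
    using dagger by blast
  have decr: "\<theta> n \<le> \<theta> 0" for n
    by (rule decseqD[of \<theta> 0 n]) (use theta_noninc in \<open>simp_all add: decseq_Suc_iff\<close>)
  interpret mixed_tsirelson \<theta> Fs
    by unfold_locales (use theta_range decr theta_null in auto)
  have hered: "hereditary (Fs n)" for n using regular by (simp add: regular_family_def)
  have alpha_rk_lt: "rk_lt (BS (alpha n)) (Fs n)" and alpha_rk_ge: "rk_ge (alpha n) (Fs n)" for n
    using cb_index_imp_rk_lt cb_index_imp_rk_ge regular index by blast+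
  have alpha_pos: "olt BZ (alpha n)" for n
    by (rule olt_trans[OF _ index_gt1[rule_format]]) simp
  have alpha_lt: "olt (alpha n) (opow omega (opow omega \<xi>))" for n
  proof (rule ccontr)
    assume "\<not> ?thesis"
    then have "ole (opow omega (opow omega \<xi>)) (alpha n)" using not_ole by blast
    moreover have "ole (BL alpha) (opow omega (opow omega \<xi>))" using sup_eq by (simp add: oeq_def)
    ultimately have "ole (BL alpha) (alpha n)" by (rule ole_trans[rotated])
    moreover have "ole (alpha n) (BL alpha)" by (rule ole_cocone) (rule ole_refl)
    ultimately show False using sup_not_attained by (simp add: oeq_def)
  qed
  have lim: "is_limit ?W" by (rule is_limit_wpow[OF xi_pos])
  have sq_lt: "olt (sq ?W n) ?W" for n by (rule valid_seq_below[OF seq lim])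
  \<comment> \<open>The recursion carries the order exponent \<open>e\<close> of \<open>H\<close>
    and the accumulated exponent \<open>s\<close>. Both stay below the additively indecomposable
    \<open>?W\<close>, so the dagger condition remains applicable at every level.\<close>
  define good where "good = (\<lambda>(e :: bord, s :: bord, H :: nat set set).
      rk_lt (BS (opow omega e)) H \<and> olt e ?W \<and> olt s ?W)"
  define next_level where "next_level = (\<lambda>n (e :: bord, s :: bord, H) (m, D, \<delta>) (e' :: bord, s', H').
      \<theta> m \<le> \<epsilon> / 2 \<and> \<theta> 0 ^ D \<le> \<theta> m / \<epsilon> \<and>
      rk_lt (opow omega \<delta>) (comp_fam H (fam (\<theta> m / \<epsilon>) D 1)) \<and> s' = oadd \<delta> s \<and>
      H' = comp_fam H (fam (\<theta> m * min ((1/2)^n / 2) (1 / \<epsilon>)) D 1) \<and>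
      rk_ge (opow omega (oadd s' (sq ?W n))) (Fs m))"
  have "\<exists>f. \<forall>n. (good (f n) \<and> (n = 0 \<longrightarrow> f n = (BZ, BZ, sing)))
      \<and> (\<exists>l. next_level n (f n) l (f (Suc n)))"
  proof (rule dependent_nat_choice)
    show "\<exists>x. good x \<and> ((0::nat) = 0 \<longrightarrow> x = (BZ, BZ, sing))"
      by (intro exI[of _ "(BZ, BZ, sing)"])
        (use rk_lt_sing wpow_pos in \<open>simp add: good_def del: rk_lt.simps\<close>)
    fix x and n :: nat assume "good x \<and> (n = 0 \<longrightarrow> x = (BZ, BZ, sing))"
    then obtain e s H where x: "x = (e, s, H)" "rk_lt (BS (opow omega e)) H" "olt e ?W" "olt s ?W"
      unfolding good_def by (cases x) auto
    from level_exists[OF xi_pos eps alpha_pos alpha_lt alpha_rk_lt alpha_rk_ge hered dag x(3,4) sq_lt[of n] x(2)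
        half_gt_zero[OF zero_less_power[OF half_gt_zero[OF zero_less_one]]], of n]
    obtain m D \<delta> e' where l: "\<theta> m \<le> \<epsilon> / 2" "\<theta> 0 ^ D \<le> \<theta> m / \<epsilon>" "olt \<delta> ?W"
      "rk_lt (opow omega \<delta>) (comp_fam H (fam (\<theta> m / \<epsilon>) D 1))" "olt e' ?W"
      "rk_lt (BS (opow omega e')) (comp_fam H (fam (\<theta> m * min ((1/2)^n / 2) (1 / \<epsilon>)) D 1))"
      "rk_ge (opow omega (oadd (oadd \<delta> s) (sq ?W n))) (Fs m)"
      by blast
    define y where "y = (e', oadd \<delta> s, comp_fam H (fam (\<theta> m * min ((1/2)^n / 2) (1 / \<epsilon>)) D 1))"
    have "olt (oadd \<delta> s) ?W" using oadd_lt_wpow l(3) x(4) by blast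
    then have "good y" using l unfolding good_def y_def by (simp del: rk_lt.simps)
    moreover have "next_level n x (m, D, \<delta>) y"
      using l unfolding next_level_def y_def x(1) by (simp del: rk_lt.simps)
    ultimately show "\<exists>y. (good y \<and> (Suc n = 0 \<longrightarrow> y = (BZ, BZ, sing))) \<and> (\<exists>l. next_level n x l y)"
      by blast
  qed
  then obtain f L where f0: "f 0 = (BZ, BZ, sing)"
    and L: "\<And>n. next_level n (f n) (L n) (f (Suc n))"
    by metis
  define m where "m n = fst (L n)" for n
  define D where "D n = fst (snd (L n))" for n
  define \<delta> where "\<delta> n = snd (snd (L n))" for n
  define s where "s n = fst (snd (f n))" for n
  define H where "H n = snd (snd (f n))" for n
  have level: "\<theta> (m n) \<le> \<epsilon> / 2 \<and> \<theta> 0 ^ D n \<le> \<theta> (m n) / \<epsilon> \<and>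
      rk_lt (opow omega (\<delta> n)) (comp_fam (H n) (fam (\<theta> (m n) / \<epsilon>) (D n) 1)) \<and>
      s (Suc n) = oadd (\<delta> n) (s n) \<and>
      H (Suc n) = comp_fam (H n) (fam (\<theta> (m n) * min ((1/2)^n / 2) (1 / \<epsilon>)) (D n) 1) \<and>
      rk_ge (opow omega (oadd (s (Suc n)) (sq ?W n))) (Fs (m n))" for n
    using L[of n] unfolding next_level_def case_prod_unfold m_def D_def \<delta>_def s_def H_def .
  note lev = level[THEN conjunct1] level[THEN conjunct2, THEN conjunct1]
    level[THEN conjunct2, THEN conjunct2, THEN conjunct1]
    level[THEN conjunct2, THEN conjunct2, THEN conjunct2, THEN conjunct1]
    level[THEN conjunct2, THEN conjunct2, THEN conjunct2, THEN conjunct2, THEN conjunct1]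
    level[THEN conjunct2, THEN conjunct2, THEN conjunct2, THEN conjunct2, THEN conjunct2]
  interpret tower \<theta> Fs m H \<delta> \<epsilon> D M
    by unfold_locales (use eps lev M f0 in \<open>simp_all add: H_def\<close>)
  have tau0: "tau n 0 = opow omega (s (Suc n))" for n
    unfolding tau_def using sumd_closed_form[of s n] lev(4) f0 by (simp add: s_def)
  \<comment> \<open>Already for \<open>\<beta> = 0\<close> the dagger condition yields a family of
    index at least omega, which contains sets of every finite size; a large enough one beats its own
    weight.\<close>
  have "\<exists>n Es. admissible (Fs n) Es \<and> 1 < \<theta> n * real (length Es)"
  proof -
    obtain k where "olt (oadd (oadd (gamma \<theta> alpha \<epsilon> k) (BS (BS BZ))) BZ) (lead (alpha k))"
      using dag[of BZ] wpow_pos by blast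
    then have "ole (BS BZ) (lead (alpha k))"
      unfolding olt_def by (rule ole_trans[rotated]) (simp add: ole_zero)
    then have "ole (opow omega (BS BZ)) (alpha k)"
      by (rule ole_trans[OF ole_wpow lead_spec(1)[OF alpha_pos]])
    then have w: "ole omega (alpha k)" by simp
    obtain j where j: "1 / \<theta> k < real j" using reals_Archimedean2 by blast
    have "rk_ge (ofnat j) (Fs k)"
      by (rule rk_ge_antimono[OF ole_trans[OF ofnat_le_omega w] alpha_rk_ge hered])
    from rk_ge_card[OF this] obtain A where A: "A \<in> Fs k" "finite A" "card A = j" by blast
    define Es where "Es = map (\<lambda>i::nat. {i}) (sorted_list_of_set A)"
    have "admissible (Fs k) Es"
      using A by (simp add: admissible_def Es_def sorted_wrt_map comp_def)
    moreover have "length Es = j" using A by (simp add: Es_def)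
    then have "1 < \<theta> k * real (length Es)" using j theta_pos[of k] by (simp add: field_simps)
    ultimately show ?thesis by blast
  qed
  then interpret tower_seq \<theta> Fs m H \<delta> \<epsilon> D M "\<lambda>n. {F. schreier sq (sq ?W n) F}" "sq ?W"
  proof unfold_locales
    show "hereditary (Fs n)" for n by (rule hered)
    show "rk_ge (omul (tau n 0) (opow omega (sq ?W n))) (Fs (m n))" for n
      unfolding tau0 using lev(6)[of n] by (simp add: opow_oadd)
    show "rk_lt (BS (opow omega (sq ?W n))) {F. schreier sq (sq ?W n) F}" for n
      by (rule rk_lt_schreier[OF seq ole_refl])
  qed
  obtain xs where "\<forall>k. c00 (xs k) \<and> supp (xs k) \<subseteq> M \<and> Tn (xs k) = 1"
    and *: "\<forall>n K a. K \<in> {F. schreier sq (sq ?W n) F} \<longrightarrow> finite K \<longrightarrow> (\<forall>k\<in>K. n \<le> k) \<longrightarrow>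
      (\<Sum>k\<in>K. \<bar>a k\<bar>) / bound 0 \<le> Tn (\<lambda>i. \<Sum>k\<in>K. a k * xs k i)"
    using spreading_sequence by (elim exE conjE)
  then have xs: "\<And>k. c00 (xs k)" "\<And>k. supp (xs k) \<subseteq> M" "\<And>k. Tn (xs k) = 1" by auto
  have low: "(\<Sum>k\<in>K. \<bar>a k\<bar>) / bound 0 \<le> Tn (\<lambda>i. \<Sum>k\<in>K. a k * xs k i)"
    if "schreier sq (sq ?W n) K" "finite K" "\<forall>k\<in>K. n \<le> k" for n K a
    using *[rule_format, of K n a] that by simp
  have "\<exists>K>0. \<forall>F\<in>Collect (schreier sq ?W). \<forall>a::nat \<Rightarrow> real.
          xnorm \<theta> Fs (\<lambda>i. \<Sum>n\<in>F. a n * xs n i) \<ge> (\<Sum>n\<in>F. \<bar>a n\<bar>) / K"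
  proof (intro exI[of _ "bound 0"] conjI ballI allI)
    show "0 < bound 0" using eps by (simp add: bound_def add_pos_pos)
    fix F and a :: "nat \<Rightarrow> real" assume "F \<in> Collect (schreier sq ?W)"
    then have F: "schreier sq ?W F" by simp
    then have fin: "finite F" by (rule schreier_finite)
    \<comment> \<open>At the limit \<open>?W\<close> membership comes from some
      \<open>sq ?W n\<close> with \<open>n\<close> a lower bound of \<open>F\<close>. All vectors
      with indices in \<open>F\<close> then carry level \<open>n\<close>, the level built for this
      Schreier family.\<close>
    from F obtain n where n: "\<forall>k\<in>F. n \<le> k" "schreier sq (sq ?W n) F"
      using lim by cases (auto simp: is_limit_def)
    have "c00 (\<lambda>i. \<Sum>k\<in>F. a k * xs k i)" by (rule c00_sum[OF fin xs(1)])
    then show "(\<Sum>k\<in>F. \<bar>a k\<bar>) / bound 0 \<le> xnorm \<theta> Fs (\<lambda>i. \<Sum>k\<in>F. a k * xs k i)"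
      using low[OF n(2) fin n(1)] by (simp add: xnorm_c00)
  qed
  moreover have "xnorm \<theta> Fs (xs k) = 1" for k using xs by (simp add: xnorm_c00)
  moreover have "xs k \<in> closed_span \<theta> Fs M" for k by (rule closed_span_c00[OF xs(1,2)])
  ultimately show "\<exists>xs. (\<forall>k. xs k \<in> closed_span \<theta> Fs M)
            \<and> l1_spreading_model \<theta> Fs (Collect (schreier sq (opow omega \<xi>))) xs"
    unfolding l1_spreading_model_def by blast
qed

end
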